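(* Consider the Brownian case $\gamma=2$: let $(\mathcal T,d)$ be the $2$-stable tree under the excursion measure $\mathbf N$, with mass measure $\mathbf m$. Then there are two constants $c,C\in(0,\infty)$ such that, $\mathbf N$-a.e., there exists $r_0\in(0,\infty)$ such that for all $r\in(0,r_0)$ and all $\sigma\in\mathcal T$, $$\frac{c}{\log 1/r}\ \le\ r^{-2}\,\mathbf m(B(\sigma,r))\ \le\ C\log 1/r .$$
   Context: Let $X=(X_t)_{t\ge 0}$ be the L\'evy process on a probability space $(\Omega,\mathcal F,\mathbf P)$ with $X_0=0$ and $\mathbf E[\exp(-\lambda X_t)] = \exp(t\lambda^2)$ for $t,\lambda\ge 0$ (a Brownian motion with variance $2t$; this is the case $\gamma=2$ of the spectrally positive $\gamma$-stable process with $\mathbf E[\exp(-\lambda X_t)] = \exp(t\lambda^\gamma)$). Set $I_t=\inf_{0\le s\le t}X_s$ and $I^s_t=\inf_{s\le r\le t}X_r$. The height process is the continuous process $H=(H_t)_{t\ge0}$ such that, for each $t$, $H_t=\lim_{\varepsilon\to0}\frac1\varepsilon\int_0^t \mathbf 1_{\{I^s_t<X_s<I^s_t+\varepsilon\}}ds$ in probability. The process $-I$ is a local time at $0$ for the strong Markov process $X-I$. $\mathbf N$ denotes the excursion measure of $X-I$ above $0$ associated with the local time $-I$. If $t$ lies in an excursion interval of $X-I$, then $H_t$ depends only on the corresponding excursion; hence $H$ is defined under $\mathbf N$ as a measurable functional of the excursion. Equivalently, if $(a_j,b_j)$, $j\in\mathcal I$, are the excursion intervals of $X-I$ above $0$ (which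 are also those of $H$ above $0$) and $H^j=H_{(a_j+\cdot)\wedge b_j}$, then $\sum_{j}\delta_{(-I_{a_j},H^j)}$ is, under $\mathbf P$, a Poisson point measure on $[0,\infty)\times C([0,\infty),\mathbb R)$ with intensity $\ell\otimes\mathbf N$ ($\ell$ = Lebesgue measure). Let $\zeta$ be the lifetime of $H$ under $\mathbf N$; one has $0<\zeta<\infty$ $\mathbf N$-a.e. Under $\mathbf N$, for $s,t\in[0,\zeta]$ let $d(s,t)=H_s+H_t-2\min_{s\wedge t\le r\le s\vee t}H_r$, a pseudo-metric; write $s\sim t$ iff $d(s,t)=0$. The $2$-stable tree is the compact metric space $(\mathcal T,d)=([0,\zeta]/\!\sim,\,d)$, with canonical projection $\mathrm p:[0,\zeta]\to\mathcal T$. The mass measure is $\mathbf m(A)=\ell(\mathrm p^{-1}(A))$ for Borel $A\subset\mathcal T$. $B(\sigma,r)$ is the open ball in $\mathcal T$ with center $\sigma$ and radius $r$. *)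

theory Defs
  imports "HOL-Probability.Probability" "HOL-Analysis.Abstract_Metric_Spaces"
begin

text \<open>Processes are maps from time (a real, only the values at times \<open>\<ge> 0\<close> matter) and
  outcome to the reals.\<close>

section \<open>The Levy process with exponent 2 and its height process\<close>

definition levy_process :: "'w measure \<Rightarrow> (real \<Rightarrow> 'w \<Rightarrow> real) \<Rightarrow> bool" where
  "levy_process P X \<longleftrightarrow>
     prob_space P \<and>
     (\<forall>t\<ge>0. X t \<in> borel_measurable P) \<and>
     (\<forall>\<omega>\<in>space P. X 0 \<omega> = 0) \<and>
     (\<forall>\<omega>\<in>space P. \<forall>t\<ge>0. continuous (at_right t) (\<lambda>s. X s \<omega>)) \<and>
     (\<forall>\<omega>\<in>space P. \<forall>t>0. \<exists>l. ((\<lambda>s. X s \<omega>) \<longlongrightarrow> l) (at_left t)) \<and>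
     (\<forall>s\<ge>0. \<forall>t\<ge>0. distr P borel (\<lambda>\<omega>. X (s + t) \<omega> - X s \<omega>) = distr P borel (X t)) \<and>
     (\<forall>(n::nat) \<tau>. 0 \<le> \<tau> 0 \<and> (\<forall>i<n. \<tau> i \<le> \<tau> (Suc i)) \<longrightarrow>
        prob_space.indep_vars P (\<lambda>_. borel) (\<lambda>i \<omega>. X (\<tau> (Suc i)) \<omega> - X (\<tau> i) \<omega>) {..<n})"

definition brownian_var_2t :: "'w measure \<Rightarrow> (real \<Rightarrow> 'w \<Rightarrow> real) \<Rightarrow> bool" where
  "brownian_var_2t P X \<longleftrightarrow>
     levy_process P X \<and>
     (\<forall>t\<ge>0. \<forall>l\<ge>0. integrable P (\<lambda>\<omega>. exp (- l * X t \<omega>)) \<and>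
        prob_space.expectation P (\<lambda>\<omega>. exp (- l * X t \<omega>)) = exp (t * l\<^sup>2))"

definition inf_between :: "(real \<Rightarrow> 'w \<Rightarrow> real) \<Rightarrow> 'w \<Rightarrow> real \<Rightarrow> real \<Rightarrow> real" where
  "inf_between X \<omega> s t = (INF r\<in>{s..t}. X r \<omega>)"

abbreviation running_inf :: "(real \<Rightarrow> 'w \<Rightarrow> real) \<Rightarrow> 'w \<Rightarrow> real \<Rightarrow> real" where
  "running_inf X \<omega> t \<equiv> inf_between X \<omega> 0 t"

definition tendsto_in_prob ::
    "'w measure \<Rightarrow> ('i \<Rightarrow> 'w \<Rightarrow> real) \<Rightarrow> ('w \<Rightarrow> real) \<Rightarrow> 'i filter \<Rightarrow> bool" where
  "tendsto_in_prob P f l F \<longleftrightarrow>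
     (\<forall>\<delta>>0. ((\<lambda>i. measure P {\<omega> \<in> space P. \<delta> < \<bar>f i \<omega> - l \<omega>\<bar>}) \<longlongrightarrow> 0) F)"

definition height_process ::
    "'w measure \<Rightarrow> (real \<Rightarrow> 'w \<Rightarrow> real) \<Rightarrow> (real \<Rightarrow> 'w \<Rightarrow> real) \<Rightarrow> bool" where
  "height_process P X H \<longleftrightarrow>
     (\<forall>t\<ge>0. H t \<in> borel_measurable P) \<and>
     (\<forall>\<omega>\<in>space P. continuous_on {0..} (\<lambda>t. H t \<omega>)) \<and>
     (\<forall>t\<ge>0. tendsto_in_prob P
        (\<lambda>\<epsilon> \<omega>. 1 / \<epsilon> * (LBINT s:{0..t}.
           indicator {u. inf_between X \<omega> u t < X u \<omega> \<and> X u \<omega> < inf_between X \<omega> u t + \<epsilon>} s))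
        (H t) (at_right 0))"


section \<open>Poisson point measures and the excursion measure\<close>

definition poisson_point_measure ::
    "'w measure \<Rightarrow> ('w \<Rightarrow> 'e measure) \<Rightarrow> 'e measure \<Rightarrow> bool" where
  "poisson_point_measure P \<eta> \<mu> \<longleftrightarrow>
     (\<forall>\<omega>\<in>space P. sets (\<eta> \<omega>) = sets \<mu>) \<and>
     (\<forall>A\<in>sets \<mu>. (\<lambda>\<omega>. emeasure (\<eta> \<omega>) A) \<in> borel_measurable P) \<and>
     (\<forall>A\<in>sets \<mu>. emeasure \<mu> A < \<infinity> \<longrightarrow>
        (\<forall>k::nat. measure P {\<omega> \<in> space P. emeasure (\<eta> \<omega>) A = of_nat k} =
           measure \<mu> A ^ k / fact k * exp (- measure \<mu> A))) \<and>
     (\<forall>A\<in>sets \<mu>. emeasure \<mu> A = \<infinity> \<longrightarrow> (AE \<omega> in P. emeasure (\<eta> \<omega>) A = \<infinity>)) \<and>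
     (\<forall>(n::nat) A. disjoint_family_on A {..<n} \<and> A ` {..<n} \<subseteq> sets \<mu> \<longrightarrow>
        prob_space.indep_vars P (\<lambda>_. borel) (\<lambda>i \<omega>. emeasure (\<eta> \<omega>) (A i)) {..<n})"

text \<open>\<open>C([0,\<infinity>), \<real>)\<close>: the trace of the product sigma-algebra on the continuous functions is
  the Borel sigma-algebra of locally uniform convergence.  As elements of a product space, paths
  are \<open>undefined\<close> outside \<open>{0..}\<close>.\<close>

definition path_space :: "(real \<Rightarrow> real) measure" where
  "path_space = restrict_space (\<Pi>\<^sub>M t\<in>{0..}. borel) {w. continuous_on {0..} w}"

definition excursion_intervals :: "(real \<Rightarrow> real) \<Rightarrow> (real \<times> real) set" where
  "excursion_intervals f =
     {(a, b). 0 \<le> a \<and> a < b \<and> f a = 0 \<and> f b = 0 \<and> (\<forall>t\<in>{a<..<b}. 0 < f t)}"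

definition excursion :: "(real \<Rightarrow> real) \<Rightarrow> real \<times> real \<Rightarrow> real \<Rightarrow> real" where
  "excursion h = (\<lambda>(a, b). \<lambda>t\<in>{0..}. h (min (a + t) b))"

text \<open>The intensity \<open>\<ell> \<otimes> N\<close> on \<open>[0,\<infinity>) \<times> C([0,\<infinity>), \<real>)\<close>.\<close>

definition excursion_intensity :: "(real \<Rightarrow> real) measure \<Rightarrow> (real \<times> (real \<Rightarrow> real)) measure" where
  "excursion_intensity N = restrict_space lborel {0..} \<Otimes>\<^sub>M N"

text \<open>The sum of the Dirac masses at \<open>(- I\<^sub>a, H\<^sup>a\<^sup>,\<^sup>b)\<close> over the excursion intervals \<open>(a, b)\<close> of
  \<open>X - I\<close> is the image of the counting measure on these intervals; \<open>N\<close> only fixes the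
  sigma-algebra here.\<close>

definition excursion_point_measure ::
    "(real \<Rightarrow> 'w \<Rightarrow> real) \<Rightarrow> (real \<Rightarrow> 'w \<Rightarrow> real) \<Rightarrow> (real \<Rightarrow> real) measure \<Rightarrow>
     'w \<Rightarrow> (real \<times> (real \<Rightarrow> real)) measure" where
  "excursion_point_measure X H N \<omega> =
     distr (count_space (excursion_intervals (\<lambda>t. X t \<omega> - running_inf X \<omega> t)))
       (excursion_intensity N)
       (\<lambda>(a, b). (- running_inf X \<omega> a, excursion (\<lambda>t. H t \<omega>) (a, b)))"

text \<open>\<open>N\<close> is the law of the height excursion under the excursion measure of \<open>X - I\<close> for the local
  time \<open>- I\<close>; it is determined by the Poisson property.  The completion of \<open>P\<close> appears because
  the excursion counts are only required to be measurable up to null sets (the paths of \<open>X\<close> are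
  continuous only almost surely).\<close>

definition height_excursion_measure ::
    "'w measure \<Rightarrow> (real \<Rightarrow> 'w \<Rightarrow> real) \<Rightarrow> (real \<Rightarrow> 'w \<Rightarrow> real) \<Rightarrow>
     (real \<Rightarrow> real) measure \<Rightarrow> bool" where
  "height_excursion_measure P X H N \<longleftrightarrow>
     sets N = sets path_space \<and> sigma_finite_measure N \<and>
     poisson_point_measure (completion P) (excursion_point_measure X H N) (excursion_intensity N)"


section \<open>The tree coded by an excursion\<close>

definition lifetime :: "(real \<Rightarrow> real) \<Rightarrow> real" where
  "lifetime w = Inf {t. 0 < t \<and> w t = 0}"

definition tree_pdist :: "(real \<Rightarrow> real) \<Rightarrow> real \<Rightarrow> real \<Rightarrow> real" where
  "tree_pdist w s t = w s + w t - 2 * (INF r\<in>{min s t..max s t}. w r)"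

definition tree_rel :: "(real \<Rightarrow> real) \<Rightarrow> (real \<times> real) set" where
  "tree_rel w = {(s, t). s \<in> {0..lifetime w} \<and> t \<in> {0..lifetime w} \<and> tree_pdist w s t = 0}"

definition tree :: "(real \<Rightarrow> real) \<Rightarrow> real set set" where
  "tree w = {0..lifetime w} // tree_rel w"

definition tree_proj :: "(real \<Rightarrow> real) \<Rightarrow> real \<Rightarrow> real set" where
  "tree_proj w t = tree_rel w `` {t}"

text \<open>Outside the tree the value is 0 because \<open>Metric_space\<close> asks for nonnegativity and
  symmetry on the whole type.\<close>

definition tree_dist :: "(real \<Rightarrow> real) \<Rightarrow> real set \<Rightarrow> real set \<Rightarrow> real" where
  "tree_dist w \<sigma> \<tau> =
     (if \<sigma> \<in> tree w \<and> \<tau> \<in> tree w then tree_pdist w (SOME s. s \<in> \<sigma>) (SOME t. t \<in> \<tau>) else 0)"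

definition tree_ball :: "(real \<Rightarrow> real) \<Rightarrow> real set \<Rightarrow> real \<Rightarrow> real set set" where
  "tree_ball w = Metric_space.mball (tree w) (tree_dist w)"

definition tree_borel :: "(real \<Rightarrow> real) \<Rightarrow> real set measure" where
  "tree_borel w = sigma (tree w) {U. openin (Metric_space.mtopology (tree w) (tree_dist w)) U}"

definition mass_measure :: "(real \<Rightarrow> real) \<Rightarrow> real set measure" where
  "mass_measure w = distr (restrict_space lborel {0..lifetime w}) (tree_borel w) (tree_proj w)"

end

theory Submission
  imports Defs "HOL-Complex_Analysis.Complex_Analysis"
begin

text \<open>The height process of Brownian motion \<open>X\<close> is the process reflected at its running infimum,
  \<open>H = X - I\<close> almost surely (\<open>AE_height_eq\<close>).  Seen backwards from time \<open>t\<close>, the quantity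
  \<open>X\<^sub>s - I\<^sup>s\<^sub>t\<close> is the distance of a Brownian motion from its running maximum, and the
  density of its occupation measure at \<open>0\<close> is the running maximum \<open>X\<^sub>t - I\<^sub>t\<close>.  A discrete
  Tanaka formula with \<open>L\<^sup>1\<close> error bounds proves this without stochastic integrals.  Hence
  the tree is coded by a piece of a Brownian path, and the tree distance between two times
  is \<open>X\<^sub>s + X\<^sub>t - 2 min X\<close> over the interval between them.

  Two uniform properties of Brownian paths give the two bounds.  By Levy's modulus of
  continuity (\<open>AE_levy_modulus\<close>) all times at distance at most \<open>r\<^sup>2 / log (1/r)\<close>, up to a
  constant, from \<open>s\<close> lie in the ball of radius \<open>r\<close> around \<open>s\<close>, which gives the lower bound
  (\<open>ball_lower_bound\<close>).  For the upper bound, a time \<open>t > s\<close> lies in the ball only if the path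
  ends within \<open>r\<close> of its value at \<open>s\<close> and does not fall more than \<open>r\<close> below that value in
  between.  Look at such visits along times with spacing \<open>r\<^sup>2\<close>: after each visit the
  next increment falls by more than \<open>6 r\<close> with a probability that does not depend on \<open>r\<close>, and
  then no later time is a visit.  So the number of visits has a geometric tail
  (\<open>geometric_visits\<close>).  With \<open>r = 2\<^sup>-\<^sup>n\<close> it exceeds a multiple of \<open>n\<close> with a
  probability that is summable even after a union over a grid of starting times, whence
  a ball has mass at most a multiple of \<open>n r\<^sup>2\<close>, uniformly in its centre
  (\<open>AE_near_measure\<close>, \<open>ball_upper_bound\<close>).

  Both properties, together with positivity just after time \<open>0\<close> and a finite lifetime, are
  collected in the predicate \<open>good_path\<close>, which only looks at rational times and is therefore
  measurable.  Almost surely every excursion of \<open>X\<close> above its running infimum is good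
  (\<open>AE_excursions_good\<close>).  So the Poisson point measure of the excursions does not charge
  \<open>[0, 1]\<close> times the set of bad paths, and a Poisson variable that vanishes almost surely has
  mean \<open>0\<close> (\<open>poisson_null\<close>); this mean is the mass of the bad paths under the excursion measure.\<close>

section \<open>Balls of the tree as sets of times\<close>

definition low :: "(real \<Rightarrow> real) \<Rightarrow> real \<Rightarrow> real \<Rightarrow> real" where
  "low w s t = (INF r\<in>{min s t..max s t}. w r)"

lemma tree_pdist_low: "tree_pdist w s t = w s + w t - 2 * low w s t"
  by (simp add: tree_pdist_def low_def)

lemma low_attained:
  assumes "continuous_on {0..} w" "0 \<le> s" "0 \<le> t"
  obtains m where "m \<in> {min s t..max s t}" "low w s t = w m" "\<And>q. q \<in> {min s t..max s t} \<Longrightarrow> w m \<le> w q"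
proof -
  have "continuous_on {min s t..max s t} w"
    by (rule continuous_on_subset[OF assms(1)]) (use assms in auto)
  then obtain m where m: "m \<in> {min s t..max s t}" "\<forall>q\<in>{min s t..max s t}. w m \<le> w q"
    using continuous_attains_inf[of "{min s t..max s t}" w] by (metis atLeastatMost_empty_iff2 compact_Icc max.cobounded1 min.coboundedI1)
  have "low w s t = w m" unfolding low_def
    by (rule cInf_eq_minimum) (use m in auto)
  then show ?thesis using m that by auto
qed

lemma low_le: "continuous_on {0..} w \<Longrightarrow> 0 \<le> s \<Longrightarrow> 0 \<le> t \<Longrightarrow> q \<in> {min s t..max s t} \<Longrightarrow> low w s t \<le> w q"
  by (metis low_attained)

lemma le_low_iff:
  assumes "continuous_on {0..} w" "0 \<le> s" "0 \<le> t"
  shows "y \<le> low w s t \<longleftrightarrow> (\<forall>q\<in>{min s t..max s t}. y \<le> w q)"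
  by (metis assms low_attained low_le order_trans)

lemma low_commute: "low w s t = low w t s"
  by (simp add: low_def min.commute max.commute)

lemma low_self [simp]: "low w s s = w s"
  by (simp add: low_def)

text \<open>The smaller of the two minima bounds the minimum over the hull from below, and the larger one
  is at most the value at the common end point.  This is the triangle inequality of the tree.\<close>

lemma low_triangle:
  assumes "continuous_on {0..} w" "0 \<le> s" "0 \<le> t" "0 \<le> u"
  shows "low w s t + low w t u \<le> w t + low w s u"
proof -
  have "min (low w s t) (low w t u) \<le> low w s u"
    unfolding le_low_iff[OF assms(1,2,4)]
  proof
    fix q assume "q \<in> {min s u..max s u}"
    then have "q \<in> {min s t..max s t} \<or> q \<in> {min t u..max t u}" by auto
    then show "min (low w s t) (low w t u) \<le> w q"
      using low_le[OF assms(1,2,3), of q] low_le[OF assms(1,3,4), of q] by linarith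
  qed
  moreover have "low w s t \<le> w t" "low w t u \<le> w t"
    using low_le[OF assms(1,2,3), of t] low_le[OF assms(1,3,4), of t] by auto
  ultimately show ?thesis by linarith
qed

context
  fixes w :: "real \<Rightarrow> real"
  assumes cont: "continuous_on {0..} w" and life: "0 \<le> lifetime w"
begin

lemma pdist_nonneg: "0 \<le> s \<Longrightarrow> 0 \<le> t \<Longrightarrow> 0 \<le> tree_pdist w s t"
  using low_le[OF cont, of s t s] low_le[OF cont, of s t t] by (simp add: tree_pdist_low)

lemma pdist_commute: "tree_pdist w s t = tree_pdist w t s"
  by (simp add: tree_pdist_low low_commute)

lemma pdist_triangle: "0 \<le> s \<Longrightarrow> 0 \<le> t \<Longrightarrow> 0 \<le> u \<Longrightarrow> tree_pdist w s u \<le> tree_pdist w s t + tree_pdist w t u"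
  using low_triangle[OF cont, of s t u] by (simp add: tree_pdist_low)

lemma pdist_self: "tree_pdist w s s = 0"
  by (simp add: tree_pdist_low)

lemma mem_tree_proj: "t \<in> tree_proj w s \<longleftrightarrow> s \<in> {0..lifetime w} \<and> t \<in> {0..lifetime w} \<and> tree_pdist w s t = 0"
  by (auto simp: tree_proj_def tree_rel_def)

lemma tree_eq_image: "tree w = tree_proj w ` {0..lifetime w}"
  by (auto simp: tree_def tree_proj_def quotient_def)

lemma tree_proj_in_tree: "s \<in> {0..lifetime w} \<Longrightarrow> tree_proj w s \<in> tree w"
  by (auto simp: tree_eq_image)

text \<open>The quotient distance is defined through chosen representatives; the triangle inequality makes
  the choice irrelevant.\<close>

lemma tree_dist_proj:
  assumes "s \<in> {0..lifetime w}" "t \<in> {0..lifetime w}"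
  shows "tree_dist w (tree_proj w s) (tree_proj w t) = tree_pdist w s t"
proof -
  define a where "a = (SOME a. a \<in> tree_proj w s)"
  define b where "b = (SOME b. b \<in> tree_proj w t)"
  have "s \<in> tree_proj w s" "t \<in> tree_proj w t" using assms by (auto simp: mem_tree_proj pdist_self)
  then have "a \<in> tree_proj w s" "b \<in> tree_proj w t"
    unfolding a_def b_def by (metis someI)+
  then have ab: "0 \<le> a" "0 \<le> b" "tree_pdist w s a = 0" "tree_pdist w t b = 0"
    by (auto simp: mem_tree_proj)
  have "tree_pdist w a b = tree_pdist w s t"
    using pdist_triangle[of s a t] pdist_triangle[of a b t] pdist_triangle[of a s b] pdist_triangle[of s t b]
      ab assms pdist_commute[of a s] pdist_commute[of t b] by auto
  then show ?thesis
    using tree_proj_in_tree[OF assms(1)] tree_proj_in_tree[OF assms(2)]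
    by (simp add: tree_dist_def a_def b_def)
qed

lemma tree_proj_eq:
  assumes "s \<in> {0..lifetime w}" "t \<in> {0..lifetime w}" "tree_pdist w s t = 0"
  shows "tree_proj w s = tree_proj w t"
proof -
  have "x \<in> tree_proj w s \<longleftrightarrow> x \<in> tree_proj w t" for x
  proof (cases "x \<in> {0..lifetime w}")
    case True
    then have "tree_pdist w s x = tree_pdist w t x"
      using pdist_triangle[of s t x] pdist_triangle[of t s x] assms pdist_commute[of s t] by auto
    then show ?thesis using assms True by (auto simp: mem_tree_proj)
  qed (auto simp: mem_tree_proj)
  then show ?thesis by blast
qed

lemma tree_Metric_space: "Metric_space (tree w) (tree_dist w)"
proof
  fix x y
  show "0 \<le> tree_dist w x y"
  proof (cases "x \<in> tree w \<and> y \<in> tree w")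
    case True
    then obtain s t where "x = tree_proj w s" "y = tree_proj w t" "s \<in> {0..lifetime w}" "t \<in> {0..lifetime w}"
      by (auto simp: tree_eq_image)
    then show ?thesis using tree_dist_proj pdist_nonneg by auto
  qed (auto simp: tree_dist_def)
  show "tree_dist w x y = tree_dist w y x"
    by (auto simp: tree_dist_def pdist_commute)
next
  fix x y assume "x \<in> tree w" "y \<in> tree w"
  then obtain s t where "x = tree_proj w s" "y = tree_proj w t" "s \<in> {0..lifetime w}" "t \<in> {0..lifetime w}"
    by (auto simp: tree_eq_image)
  then show "(tree_dist w x y = 0) = (x = y)"
    using tree_dist_proj tree_proj_eq pdist_self by metis
next
  fix x y z assume "x \<in> tree w" "y \<in> tree w" "z \<in> tree w"
  then obtain s t u where "x = tree_proj w s" "y = tree_proj w t" "z = tree_proj w u"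
      "s \<in> {0..lifetime w}" "t \<in> {0..lifetime w}" "u \<in> {0..lifetime w}"
    by (auto simp: tree_eq_image)
  then show "tree_dist w x z \<le> tree_dist w x y + tree_dist w y z"
    using tree_dist_proj pdist_triangle by auto
qed

lemma proj_in_ball:
  assumes "s \<in> {0..lifetime w}" "t \<in> {0..lifetime w}"
  shows "tree_proj w t \<in> tree_ball w (tree_proj w s) r \<longleftrightarrow> tree_pdist w s t < r"
  using assms tree_proj_in_tree
  by (simp add: tree_ball_def Metric_space.in_mball[OF tree_Metric_space] tree_dist_proj)

lemma pdist_small:
  assumes "t \<in> {0..lifetime w}" "0 < e"
  shows "\<exists>d>0. \<forall>u\<in>{0..lifetime w}. \<bar>u - t\<bar> < d \<longrightarrow> tree_pdist w t u < e"
proof -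
  have "t \<in> {0..}" using assms by auto
  then obtain d where d: "d > 0" "\<And>u. 0 \<le> u \<Longrightarrow> dist u t < d \<Longrightarrow> dist (w u) (w t) < e/3"
    using cont assms(2) unfolding continuous_on_iff by (metis atLeast_iff zero_less_divide_iff zero_less_numeral)
  show ?thesis
  proof (intro exI[of _ d] conjI ballI impI)
    fix u assume u: "u \<in> {0..lifetime w}" "\<bar>u - t\<bar> < d"
    have le: "0 \<le> t" "0 \<le> u" using assms u by auto
    obtain m where m: "m \<in> {min t u..max t u}" "low w t u = w m"
      using low_attained[OF cont le] by metis
    have "\<bar>m - t\<bar> \<le> \<bar>u - t\<bar>" "0 \<le> m" using m(1) le by auto
    then have "\<bar>w m - w t\<bar> < e/3" "\<bar>w u - w t\<bar> < e/3"
      using d(2)[of m] d(2)[of u] u le by (auto simp: dist_real_def)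
    then show "tree_pdist w t u < e" using m(2) unfolding tree_pdist_low by linarith
  qed (use d in auto)
qed

lemma tree_proj_measurable: "tree_proj w \<in> restrict_space lborel {0..lifetime w} \<rightarrow>\<^sub>M tree_borel w"
  unfolding tree_borel_def
proof (rule measurable_sigma_sets[OF sets_measure_of])
  interpret T: Metric_space "tree w" "tree_dist w" by (rule tree_Metric_space)
  show "{U. openin T.mtopology U} \<subseteq> Pow (tree w)"
    by (auto simp: T.openin_mtopology)
  then show "{U. openin T.mtopology U} \<subseteq> Pow (tree w)" .
  show "tree_proj w \<in> space (restrict_space lborel {0..lifetime w}) \<rightarrow> tree w"
    by (auto simp: space_restrict_space tree_eq_image)
  fix U assume "U \<in> {U. openin T.mtopology U}"
  then have U: "\<And>x. x \<in> U \<Longrightarrow> \<exists>r>0. T.mball x r \<subseteq> U" by (auto simp: T.openin_mtopology)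
  define V where "V = tree_proj w -` U \<inter> {0..lifetime w}"
  have "openin (top_of_set {0..lifetime w}) V"
    unfolding openin_euclidean_subtopology_iff
  proof (intro conjI ballI)
    fix t assume t: "t \<in> V"
    then obtain r where r: "r > 0" "T.mball (tree_proj w t) r \<subseteq> U" using U by (auto simp: V_def)
    have tl: "t \<in> {0..lifetime w}" using t by (auto simp: V_def)
    obtain d where d: "d > 0" "\<And>u. u\<in>{0..lifetime w} \<Longrightarrow> \<bar>u - t\<bar> < d \<Longrightarrow> tree_pdist w t u < r"
      using pdist_small[OF tl r(1)] by auto
    show "\<exists>e>0. \<forall>x'\<in>{0..lifetime w}. dist x' t < e \<longrightarrow> x' \<in> V"
    proof (intro exI[of _ d] conjI ballI impI)
      fix u assume u: "u\<in>{0..lifetime w}" "dist u t < d"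
      then have "tree_proj w u \<in> tree_ball w (tree_proj w t) r"
        using d proj_in_ball[OF tl u(1)] by (auto simp: dist_real_def)
      then show "u \<in> V" using r u by (auto simp: V_def tree_ball_def)
    qed (use d in auto)
  qed (auto simp: V_def)
  then obtain W where "open W" "V = W \<inter> {0..lifetime w}" by (auto simp: openin_open)
  then have "V \<in> sets (restrict_space lborel {0..lifetime w})"
    by (auto simp: sets_restrict_space_iff)
  then show "tree_proj w -` U \<inter> space (restrict_space lborel {0..lifetime w}) \<in> sets (restrict_space lborel {0..lifetime w})"
    by (simp add: V_def space_restrict_space)
qed

text \<open>Everything about the tree that enters the estimates: the mass of a ball is the length of
  the set of times that code it.\<close>

lemma mass_ball:
  assumes s: "s \<in> {0..lifetime w}"
  shows "measure (mass_measure w) (tree_ball w (tree_proj w s) r) = measure lborel {t \<in> {0..lifetime w}. tree_pdist w s t < r}"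
    and "{t \<in> {0..lifetime w}. tree_pdist w s t < r} \<in> sets lborel"
proof -
  interpret T: Metric_space "tree w" "tree_dist w" by (rule tree_Metric_space)
  have sub: "{U. openin T.mtopology U} \<subseteq> Pow (tree w)"
    by (auto simp: T.openin_mtopology)
  have op: "openin T.mtopology (tree_ball w (tree_proj w s) r)"
    unfolding tree_ball_def by (rule T.openin_mball)
  then have meas: "tree_ball w (tree_proj w s) r \<in> sets (tree_borel w)"
    using sub by (simp add: tree_borel_def sets_measure_of sigma_sets.Basic)
  have pre: "tree_proj w -` tree_ball w (tree_proj w s) r \<inter> space (restrict_space lborel {0..lifetime w})
     = {t \<in> {0..lifetime w}. tree_pdist w s t < r}" (is "_ = ?S")
    using proj_in_ball[OF s] by (auto simp: space_restrict_space)
  have S: "?S \<in> sets (restrict_space lborel {0..lifetime w})"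
    using measurable_sets[OF tree_proj_measurable meas] pre by simp
  then show "?S \<in> sets lborel" by (simp add: sets_restrict_space_iff)
  show "measure (mass_measure w) (tree_ball w (tree_proj w s) r) = measure lborel ?S"
    unfolding mass_measure_def measure_distr[OF tree_proj_measurable meas] pre
    by (rule measure_restrict_space) auto
qed

end

section \<open>Gaussian laws from Laplace transforms on a half-line\<close>

lemma exp_partial_sum_le:
  fixes r :: real assumes "0 \<le> r"
  shows "(\<Sum>k<n. r ^ k / fact k) \<le> exp r"
proof -
  have "(\<lambda>k. r ^ k / fact k) sums exp r"
    using exp_converges[of r] by (simp add: scaleR_conv_of_real field_simps)
  then show ?thesis using assms
    by (metis (no_types, lifting) sum_le_suminf sums_summable sums_unique divide_nonneg_nonneg finite_lessThan fact_ge_zero zero_le_power)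
qed

text \<open>Around a real point \<open>x0 > 0\<close> the exponential series can be integrated term by term, because
  the two exponentials \<open>exp (- (x0 \<plusminus> \<rho>) x)\<close> dominate all its partial sums.  It exhibits the
  Laplace transform as a holomorphic function near \<open>x0\<close>.\<close>

lemma (in real_distribution) laplace_transform_power_series:
  fixes z :: complex
  assumes int: "\<And>l. 0 \<le> l \<Longrightarrow> integrable M (\<lambda>x. exp (- l * x))"
    and z: "z \<in> ball (of_real x0) x0"
  shows "(\<lambda>k. (\<integral>x. of_real (exp (- x0 * x) * (- x) ^ k / fact k) \<partial>M) * (z - of_real x0) ^ k)
     sums (\<integral>x. exp (- z * of_real x) \<partial>M)"
proof -
  define \<rho> where "\<rho> = cmod (z - of_real x0)"
  have \<rho>: "0 \<le> \<rho>" "\<rho> < x0" using z by (auto simp: \<rho>_def dist_norm norm_minus_commute)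
  define g where "g = (\<lambda>x. exp (- (x0 - \<rho>) * x) + exp (- (x0 + \<rho>) * x))"
  have g: "integrable M g" unfolding g_def using \<rho> by (intro Bochner_Integration.integrable_add int) auto
  define f where "f = (\<lambda>k x. complex_of_real (exp (- x0 * x)) * ((- of_real x * (z - of_real x0)) ^ k / fact k))"
  have fm [measurable]: "f k \<in> borel_measurable M" for k unfolding f_def by measurable
  have bound: "(\<Sum>k<n. norm (f k x)) \<le> g x" for n x
  proof -
    have "norm (f k x) = exp (- x0 * x) * ((\<rho> * \<bar>x\<bar>) ^ k / fact k)" for k
      by (simp add: f_def norm_mult norm_divide norm_power \<rho>_def mult.commute power_mult_distrib)
    then have "(\<Sum>k<n. norm (f k x)) = exp (- x0 * x) * (\<Sum>k<n. (\<rho> * \<bar>x\<bar>) ^ k / fact k)"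
      by (simp add: sum_distrib_left)
    also have "\<dots> \<le> exp (- x0 * x) * exp (\<rho> * \<bar>x\<bar>)"
      using \<rho> by (intro mult_left_mono exp_partial_sum_le) auto
    also have "\<dots> = exp (- x0 * x + \<rho> * \<bar>x\<bar>)" by (simp add: exp_add[symmetric])
    also have "\<dots> \<le> g x"
    proof (cases "x \<ge> 0")
      case True
      then have "- x0 * x + \<rho> * \<bar>x\<bar> = - (x0 - \<rho>) * x" by (simp add: algebra_simps)
      then show ?thesis by (simp add: g_def)
    next
      case False
      then have "- x0 * x + \<rho> * \<bar>x\<bar> = - (x0 + \<rho>) * x" by (simp add: algebra_simps)
      then show ?thesis by (simp add: g_def)
    qed
    finally show ?thesis .
  qed
  have fint: "integrable M (f k)" for k
  proof (rule Bochner_Integration.integrable_bound[OF g])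
    have "norm (f k x) \<le> (\<Sum>k<Suc k. norm (f k x))" for x
      by (simp add: sum_nonneg)
    then have "norm (f k x) \<le> g x" for x using bound[of x "Suc k"] by (meson order_trans)
    then show "AE x in M. norm (f k x) \<le> norm (g x)" by (auto intro!: AE_I2 simp: g_def abs_of_pos add_pos_pos)
  qed auto
  have lim: "(\<lambda>n. \<Sum>k<n. f k x) \<longlonglongrightarrow> exp (- z * of_real x)" for x
  proof -
    have "(\<lambda>k. (- of_real x * (z - of_real x0)) ^ k / fact k) sums exp (- of_real x * (z - of_real x0))"
      using exp_converges[of "- of_real x * (z - of_real x0)"] by (simp add: scaleR_conv_of_real field_simps)
    from sums_mult[OF this, of "complex_of_real (exp (- x0 * x))"]
    have "(\<lambda>k. f k x) sums (complex_of_real (exp (- x0 * x)) * exp (- of_real x * (z - of_real x0)))"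
      by (simp add: f_def)
    also have "complex_of_real (exp (- x0 * x)) * exp (- of_real x * (z - of_real x0)) = exp (- z * of_real x)"
      by (simp add: exp_of_real[symmetric] exp_add[symmetric] algebra_simps)
    finally show ?thesis by (simp add: sums_def)
  qed
  have "(\<lambda>n. \<integral>x. (\<Sum>k<n. f k x) \<partial>M) \<longlonglongrightarrow> (\<integral>x. exp (- z * of_real x) \<partial>M)"
  proof (rule integral_dominated_convergence[where w=g])
    show "AE x in M. (\<lambda>n. \<Sum>k<n. f k x) \<longlonglongrightarrow> exp (- z * complex_of_real x)" using lim by auto
    show "AE x in M. norm (\<Sum>k<n. f k x) \<le> g x" for n
      using bound by (auto intro!: AE_I2 intro: order_trans[OF norm_sum])
  qed (use g in measurable)
  then have "(\<lambda>n. \<Sum>k<n. \<integral>x. f k x \<partial>M) \<longlonglongrightarrow> (\<integral>x. exp (- z * of_real x) \<partial>M)"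
    using fint by (simp add: Bochner_Integration.integral_sum)
  then have "(\<lambda>k. \<integral>x. f k x \<partial>M) sums (\<integral>x. exp (- z * of_real x) \<partial>M)"
    by (simp add: sums_def)
  also have "(\<lambda>k. \<integral>x. f k x \<partial>M) = (\<lambda>k. (\<integral>x. of_real (exp (- x0 * x) * (- x) ^ k / fact k) \<partial>M) * (z - of_real x0) ^ k)"
  proof
    fix k
    have "f k = (\<lambda>x. of_real (exp (- x0 * x) * (- x) ^ k / fact k) * (z - of_real x0) ^ k)"
      unfolding f_def power_mult_distrib by (auto simp: fun_eq_iff)
    then show "(\<integral>x. f k x \<partial>M) = (\<integral>x. of_real (exp (- x0 * x) * (- x) ^ k / fact k) \<partial>M) * (z - of_real x0) ^ k"
      by (simp only: integral_mult_left_zero)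
  qed
  finally show ?thesis .
qed

text \<open>Every point of the right half-plane lies in a disc centred on the real axis and touching the
  origin.  In this disc the transform and \<open>exp (t z\<^sup>2)\<close> are holomorphic and agree on the real
  diameter, hence everywhere.\<close>

lemma (in real_distribution) laplace_transform_right_half_plane:
  assumes int: "\<And>l. 0 \<le> l \<Longrightarrow> integrable M (\<lambda>x. exp (- l * x))"
    and val: "\<And>l. 0 \<le> l \<Longrightarrow> (\<integral>x. exp (- l * x) \<partial>M) = exp (t * l\<^sup>2)"
    and z: "0 < Re z"
  shows "(\<integral>x. exp (- z * of_real x) \<partial>M) = exp (of_real t * z\<^sup>2)"
proof -
  \<comment> \<open>The disc of radius \<open>x0\<close> around \<open>x0\<close> contains \<open>z\<close> iff \<open>|z|\<^sup>2 < 2 x0 Re z\<close>.\<close>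
  define x0 where "x0 = (cmod z)\<^sup>2 / Re z"
  have zn: "z \<noteq> 0" using z by auto
  have x0: "0 < x0" using z zn by (simp add: x0_def)
  have zb: "z \<in> ball (of_real x0) x0"
  proof -
    have "(cmod (z - of_real x0))\<^sup>2 = (Re z - x0)\<^sup>2 + (Im z)\<^sup>2" by (simp add: cmod_power2)
    also have "\<dots> = (cmod z)\<^sup>2 - 2 * (x0 * Re z) + x0\<^sup>2"
      unfolding cmod_power2 by (simp add: power2_eq_square algebra_simps)
    also have "x0 * Re z = (cmod z)\<^sup>2" using z by (simp add: x0_def)
    finally have "(cmod (z - of_real x0))\<^sup>2 < x0\<^sup>2" using zn by simp
    then have "cmod (z - of_real x0) < x0" using x0 by (simp add: power2_less_imp_less)
    then show ?thesis by (simp add: dist_norm norm_minus_commute)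
  qed
  define F where "F = (\<lambda>z. \<integral>x. exp (- z * complex_of_real x) \<partial>M)"
  have hol: "F holomorphic_on ball (of_real x0) x0"
    using laplace_transform_power_series[OF int] unfolding F_def by (rule power_series_holomorphic)
  define U where "U = complex_of_real ` {0<..<2*x0}"
  have "F z - exp (of_real t * z\<^sup>2) = 0"
  proof (rule analytic_continuation[of "\<lambda>z. F z - exp (of_real t * z\<^sup>2)" "ball (of_real x0) x0" U "of_real x0"])
    show "(\<lambda>z. F z - exp (of_real t * z\<^sup>2)) holomorphic_on ball (of_real x0) x0"
      by (intro holomorphic_intros hol)
    show "U \<subseteq> ball (of_real x0) x0"
    proof
      fix u assume "u \<in> U"
      then obtain y where "u = of_real y" "0 < y" "y < 2 * x0" by (auto simp: U_def)
      then show "u \<in> ball (of_real x0) x0" by (simp add: dist_of_real dist_real_def)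
    qed
    show "of_real x0 islimpt U"
      unfolding islimpt_approachable
    proof (intro allI impI)
      fix e :: real assume e: "0 < e"
      define y where "y = x0 + min (e/2) (x0/2)"
      have "0 < y" "y < 2 * x0" "y \<noteq> x0" "dist y x0 < e"
        using e x0 by (auto simp: y_def dist_real_def)
      then have "complex_of_real y \<in> U" "complex_of_real y \<noteq> of_real x0"
        "dist (complex_of_real y) (of_real x0) < e"
        unfolding U_def of_real_eq_iff dist_of_real by auto
      then show "\<exists>x'\<in>U. x' \<noteq> complex_of_real x0 \<and> dist x' (complex_of_real x0) < e" by blast
    qed
    fix u assume "u \<in> U"
    then obtain y where y: "u = of_real y" "0 < y" "y < 2 * x0" by (auto simp: U_def)
    have "F u = (\<integral>x. complex_of_real (exp (- y * x)) \<partial>M)"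
      unfolding F_def y(1) by (simp add: exp_of_real[symmetric])
    also have "\<dots> = complex_of_real (exp (t * y\<^sup>2))"
      by (subst integral_complex_of_real) (use val[of y] y in simp)
    finally show "F u - exp (of_real t * u\<^sup>2) = 0" by (simp add: y(1) exp_of_real[symmetric])
  qed (use zb x0 in auto)
  then show ?thesis by (simp add: F_def)
qed

text \<open>The characteristic function is the boundary value of the Laplace transform on the imaginary
  axis; the limit from the right is dominated by \<open>1 + exp (- x)\<close>.\<close>

lemma (in real_distribution) char_from_laplace_transform:
  assumes int: "\<And>l. 0 \<le> l \<Longrightarrow> integrable M (\<lambda>x. exp (- l * x))"
    and val: "\<And>l. 0 \<le> l \<Longrightarrow> (\<integral>x. exp (- l * x) \<partial>M) = exp (t * l\<^sup>2)"
  shows "char M u = exp (- of_real (t * u\<^sup>2))"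
proof (rule LIMSEQ_unique)
  define e where "e = (\<lambda>n. inverse (real (Suc n)))"
  have e: "e \<longlonglongrightarrow> 0" "\<And>n. 0 < e n" "\<And>n. e n \<le> 1"
    unfolding e_def by (rule LIMSEQ_inverse_real_of_nat) (auto simp: field_simps)
  define z where "z = (\<lambda>n. complex_of_real (e n) - \<i> * of_real u)"
  have zl: "z \<longlonglongrightarrow> of_real 0 - \<i> * of_real u"
    unfolding z_def by (intro tendsto_intros e)
  then have zl: "z \<longlonglongrightarrow> - \<i> * of_real u" by simp
  have eq: "(\<integral>x. exp (- z n * of_real x) \<partial>M) = exp (of_real t * (z n)\<^sup>2)" for n
    by (rule laplace_transform_right_half_plane[OF int val]) (auto simp: z_def e(2))
  have "(\<lambda>n. exp (of_real t * (z n)\<^sup>2)) \<longlonglongrightarrow> exp (of_real t * (- \<i> * of_real u)\<^sup>2)"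
    by (intro tendsto_intros zl)
  also have "exp (of_real t * (- \<i> * of_real u)\<^sup>2) = exp (- of_real (t * u\<^sup>2))"
    by (simp add: power_mult_distrib)
  finally show "(\<lambda>n. \<integral>x. exp (- z n * of_real x) \<partial>M) \<longlonglongrightarrow> exp (- of_real (t * u\<^sup>2))"
    unfolding eq .
  have "(\<lambda>n. \<integral>x. exp (- z n * of_real x) \<partial>M) \<longlonglongrightarrow> (\<integral>x. iexp (u * x) \<partial>M)"
  proof (rule integral_dominated_convergence[where w="\<lambda>x. 1 + exp (- 1 * x)"])
    show "integrable M (\<lambda>x. 1 + exp (- 1 * x))" using int[of 1] by (intro Bochner_Integration.integrable_add) auto
    show "AE x in M. (\<lambda>n. exp (- z n * complex_of_real x)) \<longlonglongrightarrow> iexp (u * x)"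
    proof (rule AE_I2)
      fix x
      have "(\<lambda>n. exp (- z n * complex_of_real x)) \<longlonglongrightarrow> exp (- (- \<i> * of_real u) * of_real x)"
        by (intro tendsto_intros zl)
      then show "(\<lambda>n. exp (- z n * complex_of_real x)) \<longlonglongrightarrow> iexp (u * x)" by (simp add: mult.assoc)
    qed
    fix n
    show "AE x in M. norm (exp (- z n * complex_of_real x)) \<le> 1 + exp (- 1 * x)"
    proof (rule AE_I2)
      fix x
      have "norm (exp (- z n * complex_of_real x)) = exp (- (e n * x))"
        by (simp add: z_def)
      also have "\<dots> \<le> 1 + exp (- 1 * x)"
      proof (cases "x \<ge> 0")
        case True
        then have "exp (- (e n * x)) \<le> 1" using e(2)[of n] by simp
        then show ?thesis by (simp add: add_increasing2)
      next
        case False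
        have "e n * (- x) \<le> 1 * (- x)"
          using False e(3) by (intro mult_right_mono) auto
        then have "exp (- (e n * x)) \<le> exp (- 1 * x)" by simp
        then show ?thesis by linarith
      qed
      finally show "norm (exp (- z n * complex_of_real x)) \<le> 1 + exp (- 1 * x)" .
    qed
  qed auto
  then show "(\<lambda>n. \<integral>x. exp (- z n * of_real x) \<partial>M) \<longlonglongrightarrow> char M u"
    by (simp add: char_def)
qed

text \<open>A one-sided Laplace transform determines the law even though the variable takes both signs:
  it continues analytically to the imaginary axis.\<close>

lemma (in prob_space) std_normal_from_laplace_transform:
  assumes X [measurable]: "X \<in> borel_measurable M" and t: "0 < t"
    and int: "\<And>l. 0 \<le> l \<Longrightarrow> integrable M (\<lambda>x. exp (- l * X x))"
    and val: "\<And>l. 0 \<le> l \<Longrightarrow> expectation (\<lambda>x. exp (- l * X x)) = exp (t * l\<^sup>2)"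
  shows "distr M borel (\<lambda>x. X x / sqrt (2 * t)) = std_normal_distribution"
proof (rule Levy_uniqueness)
  interpret D: real_distribution "distr M borel X" by simp
  have ch: "char (distr M borel X) u = exp (- of_real (t * u\<^sup>2))" for u
    by (rule D.char_from_laplace_transform) (use int val in \<open>auto simp: integrable_distr_eq integral_distr\<close>)
  show "char (distr M borel (\<lambda>x. X x / sqrt (2 * t))) = char std_normal_distribution"
  proof
    fix u
    have "char (distr M borel (\<lambda>x. X x / sqrt (2 * t))) u = char (distr M borel X) (u / sqrt (2 * t))"
      by (simp add: char_def integral_distr)
    also have "\<dots> = char std_normal_distribution u"
      using t by (simp add: ch char_std_normal_distribution power_divide exp_of_real[symmetric])
    finally show "char (distr M borel (\<lambda>x. X x / sqrt (2 * t))) u = char std_normal_distribution u" .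
  qed
qed (use real_dist_normal_dist in auto)

section \<open>Independence of the next variable from the past\<close>

text \<open>Used to reverse time, which numbers the increments in the opposite order.\<close>

lemma (in prob_space) indep_vars_reindex:
  assumes ind: "indep_vars (\<lambda>_. N) X I" and f: "inj_on f J" "f ` J \<subseteq> I"
  shows "indep_vars (\<lambda>_. N) (\<lambda>i. X (f i)) J"
  unfolding indep_vars_def2
proof (intro conjI ballI)
  show "random_variable N (X (f i))" if "i \<in> J" for i
    using ind f that unfolding indep_vars_def2 by auto
  let ?F = "\<lambda>i. {X i -` A \<inter> space M |A. A \<in> sets N}"
  have F: "indep_sets ?F I" using ind unfolding indep_vars_def2 by auto
  show "indep_sets (\<lambda>i. ?F (f i)) J"
  proof (rule indep_setsI)
    fix A K assume K: "K \<noteq> {}" "K \<subseteq> J" "finite K" "\<forall>j\<in>K. A j \<in> ?F (f j)"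
    have inj: "inj_on f K" using f K inj_on_subset by blast
    define B where "B = (\<lambda>x. A (the_inv_into K f x))"
    have B: "B (f k) = A k" if "k \<in> K" for k using that inj by (simp add: B_def the_inv_into_f_f)
    have "prob (\<Inter>x\<in>f ` K. B x) = (\<Prod>x\<in>f ` K. prob (B x))"
    proof (rule indep_setsD[OF F])
      show "\<forall>j\<in>f ` K. B j \<in> ?F j" using K(4) B by force
      show "f ` K \<subseteq> I" using K(2) f(2) by blast
    qed (use K in auto)
    then show "prob (\<Inter>j\<in>K. A j) = (\<Prod>j\<in>K. prob (A j))"
      using B by (simp add: prod.reindex[OF inj])
  qed (use F f in \<open>auto simp: indep_sets_def\<close>)
qed

text \<open>The sigma-algebra generated by the first \<open>k\<close> variables, so not including number \<open>k\<close> itself.\<close>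

definition past :: "'w measure \<Rightarrow> (nat \<Rightarrow> 'w \<Rightarrow> real) \<Rightarrow> nat \<Rightarrow> 'w measure" where
  "past M \<xi> k = vimage_algebra (space M) (\<lambda>\<omega>. \<lambda>i\<in>{..<k}. \<xi> i \<omega>) (\<Pi>\<^sub>M i\<in>{..<k}. borel)"

lemma space_past [simp]: "space (past M \<xi> k) = space M"
  by (simp add: past_def)

lemma past_component: "i < k \<Longrightarrow> \<xi> i \<in> borel_measurable (past M \<xi> k)"
proof -
  assume "i < k"
  have "(\<lambda>\<omega>. \<lambda>i\<in>{..<k}. \<xi> i \<omega>) \<in> past M \<xi> k \<rightarrow>\<^sub>M (\<Pi>\<^sub>M i\<in>{..<k}. borel)"
    unfolding past_def by (rule measurable_vimage_algebra1) (auto simp: space_PiM)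
  from measurable_compose[OF this measurable_component_singleton[of i]] \<open>i < k\<close>
  show ?thesis by simp
qed

lemma measurable_past_into:
  assumes "\<And>i. i < k \<Longrightarrow> \<xi> i \<in> borel_measurable N" "space N = space M"
  shows "sets (past M \<xi> k) \<subseteq> sets N"
  unfolding past_def
  by (rule sets_image_in_sets) (use assms in \<open>auto intro!: measurable_restrict\<close>)

lemma past_measurable_mono:
  assumes "Q \<in> borel_measurable (past M \<xi> k)" "k \<le> k'"
  shows "Q \<in> borel_measurable (past M \<xi> k')"
proof -
  have "sets (past M \<xi> k) \<subseteq> sets (past M \<xi> k')"
    using assms(2) by (intro measurable_past_into past_component) auto
  then show ?thesis using assms(1) unfolding measurable_def by auto
qed

context prob_space
begin

lemma past_measurable_rv:
  assumes "Q \<in> borel_measurable (past M \<xi> k)" "\<And>i. i < k \<Longrightarrow> \<xi> i \<in> borel_measurable M"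
  shows "Q \<in> borel_measurable M"
proof -
  have "sets (past M \<xi> k) \<subseteq> sets M"
    using assms(2) by (intro measurable_past_into) auto
  then show ?thesis using assms(1) unfolding measurable_def by auto
qed

lemma indep_var_past:
  assumes ind: "indep_vars (\<lambda>_. borel) \<xi> {..<n}" and k: "k < n"
    and Q: "Q \<in> borel_measurable (past M \<xi> k)"
  shows "indep_var borel Q borel (\<xi> k)"
proof -
  have rv: "\<xi> i \<in> borel_measurable M" if "i < n" for i
    using ind that unfolding indep_vars_def2 by auto
  let ?V = "\<lambda>\<omega>. \<lambda>i\<in>{..<k}. \<xi> i \<omega>"
  have "indep_var (PiM {..<k} (\<lambda>_. borel)) ?V (PiM {k} (\<lambda>_. borel)) (\<lambda>\<omega>. \<lambda>i\<in>{k}. \<xi> i \<omega>)"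
    using k by (intro indep_var_restrict[OF ind]) auto
  then have set: "indep_set (sets (past M \<xi> k))
      (sigma_sets (space M) {(\<lambda>\<omega>. \<lambda>i\<in>{k}. \<xi> i \<omega>) -` A \<inter> space M | A. A \<in> sets (PiM {k} (\<lambda>_. borel))})"
    unfolding indep_var_eq past_def sets_vimage_algebra by simp
  have sub: "sigma_sets (space M) {\<xi> k -` A \<inter> space M | A. A \<in> sets borel} \<subseteq>
      sigma_sets (space M) {(\<lambda>\<omega>. \<lambda>i\<in>{k}. \<xi> i \<omega>) -` A \<inter> space M | A. A \<in> sets (PiM {k} (\<lambda>_. borel))}"
  proof (rule sigma_sets_subseteq, safe)
    fix A :: "real set" assume "A \<in> sets borel"
    from measurable_sets[OF measurable_component_singleton[of k "{k}" "\<lambda>_. borel", OF singletonI] this]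
    have "(\<lambda>x. x k) -` A \<inter> space (PiM {k} (\<lambda>_. borel)) \<in> sets (PiM {k} (\<lambda>_. borel))" .
    then show "\<exists>B. \<xi> k -` A \<inter> space M = (\<lambda>\<omega>. \<lambda>i\<in>{k}. \<xi> i \<omega>) -` B \<inter> space M \<and> B \<in> sets (PiM {k} (\<lambda>_. borel))"
      by (intro exI[of _ "(\<lambda>x. x k) -` A \<inter> space (PiM {k} (\<lambda>_. borel))"]) (auto simp: space_PiM)
  qed
  show ?thesis unfolding indep_var_eq
  proof (intro conjI)
    show "random_variable borel Q" by (rule past_measurable_rv[OF Q]) (use rv k in auto)
    show "random_variable borel (\<xi> k)" using rv k by auto
    have "sigma_sets (space M) {Q -` A \<inter> space M |A. A \<in> sets borel} \<subseteq> sets (past M \<xi> k)"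
      using sets.sigma_sets_subset[of "{Q -` A \<inter> space M |A. A \<in> sets borel}" "past M \<xi> k"]
        measurable_sets[OF Q] by auto
    then show "indep_set (sigma_sets (space M) {Q -` A \<inter> space M |A. A \<in> sets borel})
        (sigma_sets (space M) {\<xi> k -` A \<inter> space M | A. A \<in> sets borel})"
      unfolding indep_set_def
      by (intro indep_sets_mono_sets[OF set[unfolded indep_set_def]]) (use sub in \<open>auto split: bool.split\<close>)
  qed
qed

text \<open>All martingale arguments below use only this factorisation.\<close>

lemma expectation_past_mult:
  fixes g :: "real \<Rightarrow> real"
  assumes ind: "indep_vars (\<lambda>_. borel) \<xi> {..<n}" and k: "k < n"
    and Q: "Q \<in> borel_measurable (past M \<xi> k)" "integrable M Q"
    and g: "g \<in> borel_measurable borel" "integrable M (\<lambda>\<omega>. g (\<xi> k \<omega>))"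
  shows "integrable M (\<lambda>\<omega>. Q \<omega> * g (\<xi> k \<omega>))"
    and "expectation (\<lambda>\<omega>. Q \<omega> * g (\<xi> k \<omega>)) = expectation Q * expectation (\<lambda>\<omega>. g (\<xi> k \<omega>))"
proof -
  have "indep_var borel ((\<lambda>x. x) \<circ> Q) borel (g \<circ> \<xi> k)"
    by (rule indep_var_compose[OF indep_var_past[OF ind k Q(1)]]) (use g in auto)
  then have "indep_var borel Q borel (\<lambda>\<omega>. g (\<xi> k \<omega>))" by (simp add: comp_def)
  from indep_var_integrable[OF this Q(2) g(2)] indep_var_lebesgue_integral[OF this Q(2) g(2)]
  show "integrable M (\<lambda>\<omega>. Q \<omega> * g (\<xi> k \<omega>))"
    and "expectation (\<lambda>\<omega>. Q \<omega> * g (\<xi> k \<omega>)) = expectation Q * expectation (\<lambda>\<omega>. g (\<xi> k \<omega>))" by auto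
qed

end

section \<open>Processes with Gaussian increments\<close>

text \<open>Brownian motion with variance \<open>2 t\<close> on \<open>[0, T]\<close> up to its starting value.  Leaving the start
  free and bounding time makes the notion invariant under time reversal and change of sign.\<close>

definition gaussian_increments :: "'w measure \<Rightarrow> (real \<Rightarrow> 'w \<Rightarrow> real) \<Rightarrow> real \<Rightarrow> bool" where
  "gaussian_increments P Y T \<longleftrightarrow> prob_space P \<and>
    (\<forall>u\<in>{0..T}. Y u \<in> borel_measurable P) \<and>
    (\<forall>(n::nat) \<tau>. 0 \<le> \<tau> 0 \<and> (\<forall>i<n. \<tau> i \<le> \<tau> (Suc i)) \<and> \<tau> n \<le> T \<longrightarrow>
       prob_space.indep_vars P (\<lambda>_. borel) (\<lambda>i \<omega>. Y (\<tau> (Suc i)) \<omega> - Y (\<tau> i) \<omega>) {..<n}) \<and>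
    (\<forall>a b. 0 \<le> a \<and> a < b \<and> b \<le> T \<longrightarrow>
       distr P borel (\<lambda>\<omega>. (Y b \<omega> - Y a \<omega>) / sqrt (2 * (b - a))) = std_normal_distribution)"

lemma gaussian_increments_indep:
  assumes "gaussian_increments P Y T" "0 \<le> \<tau> 0" "\<And>i. i < n \<Longrightarrow> \<tau> i \<le> \<tau> (Suc i)" "\<tau> n \<le> T"
  shows "prob_space.indep_vars P (\<lambda>_. borel) (\<lambda>i \<omega>. Y (\<tau> (Suc i)) \<omega> - Y (\<tau> i) \<omega>) {..<n}"
  using assms unfolding gaussian_increments_def by blast

lemma gaussian_increments_distr:
  assumes "gaussian_increments P Y T" "0 \<le> a" "a < b" "b \<le> T"
  shows "distr P borel (\<lambda>\<omega>. (Y b \<omega> - Y a \<omega>) / sqrt (2 * (b - a))) = std_normal_distribution"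
  using assms unfolding gaussian_increments_def by blast

lemma gaussian_increments_rv:
  assumes "gaussian_increments P Y T" "0 \<le> u" "u \<le> T"
  shows "Y u \<in> borel_measurable P"
  using assms unfolding gaussian_increments_def by auto

lemma gaussian_incrementsI:
  assumes "prob_space P"
    "\<And>u. 0 \<le> u \<Longrightarrow> u \<le> T \<Longrightarrow> Y u \<in> borel_measurable P"
    "\<And>n \<tau>. 0 \<le> \<tau> 0 \<Longrightarrow> (\<And>i. i < n \<Longrightarrow> \<tau> i \<le> \<tau> (Suc i)) \<Longrightarrow> \<tau> n \<le> T \<Longrightarrow>
       prob_space.indep_vars P (\<lambda>_. borel) (\<lambda>i \<omega>. Y (\<tau> (Suc i)) \<omega> - Y (\<tau> i) \<omega>) {..<n}"
    "\<And>a b. 0 \<le> a \<Longrightarrow> a < b \<Longrightarrow> b \<le> T \<Longrightarrow>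
       distr P borel (\<lambda>\<omega>. (Y b \<omega> - Y a \<omega>) / sqrt (2 * (b - a))) = std_normal_distribution"
  shows "gaussian_increments P Y T"
  unfolding gaussian_increments_def using assms by simp

lemma brownian_gaussian_increments:
  assumes "brownian_var_2t P X"
  shows "gaussian_increments P X T"
proof -
  have L: "levy_process P X" using assms by (simp add: brownian_var_2t_def)
  interpret prob_space P using L by (simp add: levy_process_def)
  have rv: "X t \<in> borel_measurable P" if "0 \<le> t" for t using L that by (simp add: levy_process_def)
  have "distr P borel (\<lambda>\<omega>. (X b \<omega> - X a \<omega>) / sqrt (2 * (b - a))) = std_normal_distribution"
    if ab: "0 \<le> a" "a < b" for a b
  proof -
    have eq: "distr P borel (\<lambda>\<omega>. X b \<omega> - X a \<omega>) = distr P borel (X (b - a))"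
    proof -
      have "\<And>s t. 0 \<le> s \<Longrightarrow> 0 \<le> t \<Longrightarrow> distr P borel (\<lambda>\<omega>. X (s + t) \<omega> - X s \<omega>) = distr P borel (X t)"
        using L unfolding levy_process_def by blast
      from this[of a "b - a"] show ?thesis using ab by simp
    qed
    have [measurable]: "X b \<in> borel_measurable P" "X a \<in> borel_measurable P" "X (b - a) \<in> borel_measurable P"
      using ab rv by auto
    have "distr P borel (\<lambda>\<omega>. (X b \<omega> - X a \<omega>) / sqrt (2 * (b - a)))
        = distr (distr P borel (\<lambda>\<omega>. X b \<omega> - X a \<omega>)) borel (\<lambda>x. x / sqrt (2 * (b - a)))"
      by (subst distr_distr) (auto simp: comp_def)
    also have "\<dots> = distr P borel (\<lambda>\<omega>. X (b - a) \<omega> / sqrt (2 * (b - a)))"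
      unfolding eq by (subst distr_distr) (auto simp: comp_def)
    also have "\<dots> = std_normal_distribution"
      using assms ab by (intro std_normal_from_laplace_transform) (auto simp: brownian_var_2t_def)
    finally show ?thesis .
  qed
  then show ?thesis
    using L rv prob_space_axioms by (intro gaussian_incrementsI) (simp_all add: levy_process_def)
qed

lemma std_normal_uminus: "distr std_normal_distribution borel uminus = std_normal_distribution"
proof (rule Levy_uniqueness)
  interpret D: real_distribution std_normal_distribution by (rule real_dist_normal_dist)
  show "real_distribution (distr std_normal_distribution borel uminus)" by (rule D.real_distribution_distr) simp
  show "char (distr std_normal_distribution borel uminus) = char std_normal_distribution"
  proof
    fix u
    have "char (distr std_normal_distribution borel uminus) u = char std_normal_distribution (- u)"
      by (simp add: char_def integral_distr)
    also have "\<dots> = char std_normal_distribution u" by (simp add: char_std_normal_distribution)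
    finally show "char (distr std_normal_distribution borel uminus) u = char std_normal_distribution u" .
  qed
qed (rule real_dist_normal_dist)

lemma std_normal_distr_uminus:
  assumes "distr P borel f = std_normal_distribution" and [measurable]: "f \<in> borel_measurable P"
  shows "distr P borel (\<lambda>\<omega>. - f \<omega>) = std_normal_distribution"
proof -
  have "distr P borel (\<lambda>\<omega>. - f \<omega>) = distr (distr P borel f) borel uminus"
    by (subst distr_distr) (auto simp: comp_def)
  then show ?thesis using assms std_normal_uminus by simp
qed

lemma gaussian_increments_reverse:
  assumes "gaussian_increments P Y T"
  shows "gaussian_increments P (\<lambda>u. Y (T - u)) T"
proof -
  interpret prob_space P using assms by (simp add: gaussian_increments_def)
  have rv: "Y u \<in> borel_measurable P" if "0 \<le> u" "u \<le> T" for u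
    using gaussian_increments_rv[OF assms that] .
  have 1: "indep_vars (\<lambda>_. borel) (\<lambda>i \<omega>. Y (T - \<tau> (Suc i)) \<omega> - Y (T - \<tau> i) \<omega>) {..<n}"
    if \<tau>: "0 \<le> \<tau> 0" "\<And>i. i < n \<Longrightarrow> \<tau> i \<le> \<tau> (Suc i)" "\<tau> n \<le> T" for n :: nat and \<tau>
  proof -
    define \<sigma> where "\<sigma> = (\<lambda>j. T - \<tau> (n - j))"
    have "\<sigma> i \<le> \<sigma> (Suc i)" if "i < n" for i
      using \<tau>(2)[of "n - Suc i"] that by (simp add: \<sigma>_def Suc_diff_Suc)
    then have "indep_vars (\<lambda>_. borel) (\<lambda>i \<omega>. Y (\<sigma> (Suc i)) \<omega> - Y (\<sigma> i) \<omega>) {..<n}"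
      by (intro gaussian_increments_indep[OF assms, of \<sigma>]) (use \<tau> in \<open>auto simp: \<sigma>_def\<close>)
    then have "indep_vars (\<lambda>_. borel) (\<lambda>i \<omega>. Y (\<sigma> (Suc (n - Suc i))) \<omega> - Y (\<sigma> (n - Suc i)) \<omega>) {..<n}"
      by (rule indep_vars_reindex) (auto simp: inj_on_def)
    then have "indep_vars (\<lambda>_. borel) (\<lambda>i \<omega>. - (Y (\<sigma> (Suc (n - Suc i))) \<omega> - Y (\<sigma> (n - Suc i)) \<omega>)) {..<n}"
      by (rule indep_vars_compose2) auto
    also have "?this \<longleftrightarrow> ?thesis"
      by (rule indep_vars_cong) (auto simp: \<sigma>_def fun_eq_iff Suc_diff_Suc)
    finally show ?thesis .
  qed
  have 2: "distr P borel (\<lambda>\<omega>. (Y (T - b) \<omega> - Y (T - a) \<omega>) / sqrt (2 * (b - a))) = std_normal_distribution"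
    if ab: "0 \<le> a" "a < b" "b \<le> T" for a b
  proof -
    have "distr P borel (\<lambda>\<omega>. (Y (T - a) \<omega> - Y (T - b) \<omega>) / sqrt (2 * ((T - a) - (T - b)))) = std_normal_distribution"
      using ab by (intro gaussian_increments_distr[OF assms]) auto
    from std_normal_distr_uminus[OF this] rv[of "T - a"] rv[of "T - b"] ab
    have "distr P borel (\<lambda>\<omega>. - ((Y (T - a) \<omega> - Y (T - b) \<omega>) / sqrt (2 * (b - a)))) = std_normal_distribution"
      by simp
    then show ?thesis by (simp only: minus_divide_left minus_diff_eq)
  qed
  show ?thesis
    using 1 2 rv prob_space_axioms by (intro gaussian_incrementsI) simp_all
qed

lemma gaussian_increments_uminus:
  assumes "gaussian_increments P Y T"
  shows "gaussian_increments P (\<lambda>u \<omega>. - Y u \<omega>) T"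
proof -
  interpret prob_space P using assms by (simp add: gaussian_increments_def)
  have rv: "Y u \<in> borel_measurable P" if "0 \<le> u" "u \<le> T" for u
    using gaussian_increments_rv[OF assms that] .
  have 1: "indep_vars (\<lambda>_. borel) (\<lambda>i \<omega>. - Y (\<tau> (Suc i)) \<omega> - - Y (\<tau> i) \<omega>) {..<n}"
    if \<tau>: "0 \<le> \<tau> 0" "\<And>i. i < n \<Longrightarrow> \<tau> i \<le> \<tau> (Suc i)" "\<tau> n \<le> T" for n :: nat and \<tau>
  proof -
    have "indep_vars (\<lambda>_. borel) (\<lambda>i \<omega>. Y (\<tau> (Suc i)) \<omega> - Y (\<tau> i) \<omega>) {..<n}"
      by (intro gaussian_increments_indep[OF assms]) (use \<tau> in auto)
    then have "indep_vars (\<lambda>_. borel) (\<lambda>i \<omega>. - (Y (\<tau> (Suc i)) \<omega> - Y (\<tau> i) \<omega>)) {..<n}"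
      by (rule indep_vars_compose2) auto
    then show ?thesis by simp
  qed
  have 2: "distr P borel (\<lambda>\<omega>. (- Y b \<omega> - - Y a \<omega>) / sqrt (2 * (b - a))) = std_normal_distribution"
    if ab: "0 \<le> a" "a < b" "b \<le> T" for a b
  proof -
    have "distr P borel (\<lambda>\<omega>. (Y b \<omega> - Y a \<omega>) / sqrt (2 * (b - a))) = std_normal_distribution"
      using ab by (intro gaussian_increments_distr[OF assms]) auto
    from std_normal_distr_uminus[OF this] rv[of a] rv[of b] ab
    have "distr P borel (\<lambda>\<omega>. - ((Y b \<omega> - Y a \<omega>) / sqrt (2 * (b - a)))) = std_normal_distribution"
      by simp
    moreover have "(\<lambda>\<omega>. - ((Y b \<omega> - Y a \<omega>) / sqrt (2 * (b - a)))) = (\<lambda>\<omega>. (- Y b \<omega> - - Y a \<omega>) / sqrt (2 * (b - a)))"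
      by (simp only: minus_divide_left minus_diff_eq minus_diff_minus)
    ultimately show ?thesis by simp
  qed
  show ?thesis
    using 1 2 rv prob_space_axioms by (intro gaussian_incrementsI) simp_all
qed

section \<open>Moments and tails of Gaussian increments\<close>

lemma std_normal_exp_moment:
  shows "integrable std_normal_distribution (\<lambda>x. exp (l * x))"
    and "(\<integral>x. exp (l * x) \<partial>std_normal_distribution) = exp (l\<^sup>2 / 2)"
proof -
  have eq: "std_normal_density x *\<^sub>R exp (l * x) = exp (l\<^sup>2 / 2) * normal_density l 1 x" for x
    by (simp add: normal_density_def exp_add[symmetric] power2_eq_square field_simps)
  have int: "integrable lborel (\<lambda>x. std_normal_density x *\<^sub>R exp (l * x))" unfolding eq by simp
  then show "integrable std_normal_distribution (\<lambda>x. exp (l * x))"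
    by (subst integrable_density) (auto simp: normal_density_nonneg)
  have "(\<integral>x. exp (l * x) \<partial>std_normal_distribution) = (\<integral>x. std_normal_density x *\<^sub>R exp (l * x) \<partial>lborel)"
    by (subst integral_density) (auto simp: normal_density_nonneg)
  also have "\<dots> = exp (l\<^sup>2 / 2)" unfolding eq by simp
  finally show "(\<integral>x. exp (l * x) \<partial>std_normal_distribution) = exp (l\<^sup>2 / 2)" .
qed

text \<open>Chernoff's bound with the optimal exponent \<open>y\<close>.\<close>

lemma std_normal_upper_tail:
  assumes "0 < y"
  shows "measure std_normal_distribution {y..} \<le> exp (- y\<^sup>2 / 2)"
proof -
  interpret S: real_distribution std_normal_distribution by (rule real_dist_normal_dist)
  have "measure std_normal_distribution {x \<in> space std_normal_distribution. exp (y * y) \<le> exp (y * x)}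
      \<le> (\<integral>x. exp (y * x) \<partial>std_normal_distribution) / exp (y * y)"
    by (rule integral_Markov_inequality_measure[where A="{}"]) (auto intro: std_normal_exp_moment)
  also have "{x \<in> space std_normal_distribution. exp (y * y) \<le> exp (y * x)} = {y..}"
    using assms by auto
  also have "(\<integral>x. exp (y * x) \<partial>std_normal_distribution) / exp (y * y) = exp (y\<^sup>2 / 2 - y * y)"
    by (simp only: std_normal_exp_moment exp_diff)
  also have "y\<^sup>2 / 2 - y * y = - y\<^sup>2 / 2" by (simp add: power2_eq_square)
  finally show ?thesis .
qed

lemma std_normal_symmetric:
  assumes "A \<in> sets borel"
  shows "measure std_normal_distribution {x. - x \<in> A} = measure std_normal_distribution A"
proof -
  have "measure (distr std_normal_distribution borel uminus) A = measure std_normal_distribution {x. - x \<in> A}"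
    using assms by (subst measure_distr) (auto simp: vimage_def)
  then show ?thesis unfolding std_normal_uminus by simp
qed

lemma std_normal_tail:
  assumes "0 < y"
  shows "measure std_normal_distribution {x. y \<le> \<bar>x\<bar>} \<le> 2 * exp (- y\<^sup>2 / 2)"
proof -
  interpret S: real_distribution std_normal_distribution by (rule real_dist_normal_dist)
  have "{x. y \<le> \<bar>x\<bar>} = {y..} \<union> {x. - x \<in> {y..}}" by auto
  then have "measure std_normal_distribution {x. y \<le> \<bar>x\<bar>}
     \<le> measure std_normal_distribution {y..} + measure std_normal_distribution {x. - x \<in> {y..}}"
    by (simp add: measure_Un_le)
  then show ?thesis using std_normal_symmetric[of "{y..}"] std_normal_upper_tail[OF assms] by auto
qed

lemma std_normal_lower_pos: "0 < measure std_normal_distribution {..< (c::real)}"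
proof -
  interpret S: real_distribution std_normal_distribution by (rule real_dist_normal_dist)
  have "emeasure std_normal_distribution {..<c} \<noteq> 0"
  proof
    assume "emeasure std_normal_distribution {..<c} = 0"
    then have "(\<integral>\<^sup>+x. ennreal (std_normal_density x) * indicator {..<c} x \<partial>lborel) = 0"
      by (subst (asm) emeasure_density) auto
    then have "AE x in lborel. ennreal (std_normal_density x) * indicator {..<c} x = 0"
      by (subst (asm) nn_integral_0_iff_AE) auto
    then have "AE x in lborel. x \<notin> {..<c}"
    proof eventually_elim
      case (elim x)
      then show ?case using normal_density_pos[of 1 0 x] by (auto simp: indicator_def split: if_splits)
    qed
    then have "AE x in lborel. x \<notin> {c-1<..<c}" by eventually_elim auto
    then have "{c-1<..<c} \<in> null_sets lborel" by (subst (asm) AE_iff_null_sets[symmetric]) auto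
    then show False by (auto dest!: null_setsD1)
  qed
  then show ?thesis by (simp add: S.emeasure_eq_measure zero_less_measure_iff)
qed

context
  fixes P :: "'w measure" and Y T a b
  assumes G: "gaussian_increments P Y T" and ab: "0 \<le> a" "a < b" "b \<le> T"
begin

interpretation prob_space P using G by (simp add: gaussian_increments_def)

lemma increment_rv [measurable]: "Y a \<in> borel_measurable P" "Y b \<in> borel_measurable P"
  using gaussian_increments_rv[OF G] ab by auto

lemma increment_transfer:
  fixes g :: "real \<Rightarrow> real"
  assumes [measurable]: "g \<in> borel_measurable borel"
  shows "integrable P (\<lambda>\<omega>. g (Y b \<omega> - Y a \<omega>)) \<longleftrightarrow> integrable std_normal_distribution (\<lambda>x. g (sqrt (2 * (b - a)) * x))"
    and "expectation (\<lambda>\<omega>. g (Y b \<omega> - Y a \<omega>)) = (\<integral>x. g (sqrt (2 * (b - a)) * x) \<partial>std_normal_distribution)"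
proof -
  have s: "sqrt (2 * (b - a)) \<noteq> 0" using ab by simp
  show "integrable P (\<lambda>\<omega>. g (Y b \<omega> - Y a \<omega>)) \<longleftrightarrow> integrable std_normal_distribution (\<lambda>x. g (sqrt (2 * (b - a)) * x))"
    unfolding gaussian_increments_distr[OF G ab, symmetric]
    by (subst integrable_distr_eq) (use s in auto)
  show "expectation (\<lambda>\<omega>. g (Y b \<omega> - Y a \<omega>)) = (\<integral>x. g (sqrt (2 * (b - a)) * x) \<partial>std_normal_distribution)"
    unfolding gaussian_increments_distr[OF G ab, symmetric]
    by (subst integral_distr) (use s in auto)
qed

lemma increment_power_integrable: "integrable P (\<lambda>\<omega>. (Y b \<omega> - Y a \<omega>) ^ k)"
  using increment_transfer(1)[of "\<lambda>x. x ^ k"] integrable_std_normal_distribution_moment[of k]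
  by (simp add: power_mult_distrib)

lemma increment_mean: "expectation (\<lambda>\<omega>. Y b \<omega> - Y a \<omega>) = 0"
  using increment_transfer(2)[of "\<lambda>x. x"] integral_std_normal_distribution_moment_odd[of 1] by simp

lemma increment_square: "expectation (\<lambda>\<omega>. (Y b \<omega> - Y a \<omega>)\<^sup>2) = 2 * (b - a)"
  using increment_transfer(2)[of "\<lambda>x. x^2"] std_normal_distribution_even_moments(1)[of 1] ab
  by (simp add: power_mult_distrib)

lemma increment_fourth: "expectation (\<lambda>\<omega>. (Y b \<omega> - Y a \<omega>) ^ 4) = 12 * (b - a)\<^sup>2"
proof -
  have e: "2 * 2 = (4::nat)" "fact 4 = (24::real)" by (simp_all add: fact_numeral)
  have m: "(\<integral>x. x ^ 4 \<partial>std_normal_distribution) = 3"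
    using std_normal_distribution_even_moments(1)[of 2, unfolded e] by simp
  have s: "sqrt (2 * (b - a)) ^ 4 = 4 * (b - a)\<^sup>2"
  proof -
    have "sqrt (2 * (b - a)) ^ (2 * 2) = ((sqrt (2 * (b - a)))\<^sup>2)\<^sup>2" by (rule power_mult)
    also have "(sqrt (2 * (b - a)))\<^sup>2 = 2 * (b - a)" using ab by simp
    finally show ?thesis unfolding e by (simp only: power_mult_distrib) simp
  qed
  have "expectation (\<lambda>\<omega>. (Y b \<omega> - Y a \<omega>) ^ 4) = (\<integral>x. (sqrt (2 * (b - a)) * x) ^ 4 \<partial>std_normal_distribution)"
    by (rule increment_transfer(2)[of "\<lambda>x. x^4"]) simp
  also have "\<dots> = sqrt (2 * (b - a)) ^ 4 * (\<integral>x. x ^ 4 \<partial>std_normal_distribution)"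
    by (simp only: power_mult_distrib integral_mult_right_zero)
  also have "\<dots> = 12 * (b - a)\<^sup>2" unfolding s m by simp
  finally show ?thesis .
qed

lemma increment_abs_cube: "expectation (\<lambda>\<omega>. \<bar>Y b \<omega> - Y a \<omega>\<bar> ^ 3) \<le> 6 * ((b - a) * sqrt (b - a))"
proof -
  have "sqrt 2 \<le> (3/2::real)" by (rule real_le_lsqrt) (auto simp: power2_eq_square)
  then have "2 * (b - a) * (sqrt 2 * sqrt (b - a)) \<le> 2 * (b - a) * (3/2 * sqrt (b - a))"
    using ab by (intro mult_left_mono mult_right_mono) auto
  moreover have "sqrt (2 * (b - a)) ^ 3 = 2 * (b - a) * (sqrt 2 * sqrt (b - a))"
  proof -
    have "sqrt (2 * (b - a)) ^ 3 = (sqrt (2 * (b - a)))\<^sup>2 * sqrt (2 * (b - a))"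
      by (simp only: power3_eq_cube power2_eq_square)
    also have "(sqrt (2 * (b - a)))\<^sup>2 = 2 * (b - a)" using ab by simp
    also have "2 * (b - a) * sqrt (2 * (b - a)) = 2 * (b - a) * (sqrt 2 * sqrt (b - a))" by (simp only: real_sqrt_mult)
    finally show ?thesis .
  qed
  ultimately have s: "sqrt (2 * (b - a)) ^ 3 \<le> 3 * ((b - a) * sqrt (b - a))"
    by linarith
  have "sqrt (2 / pi) \<le> 1" using pi_ge_two by simp
  then have m: "(\<integral>x. \<bar>x\<bar> ^ 3 \<partial>std_normal_distribution) \<le> 2"
  proof -
    have "2 * 1 + 1 = (3::nat)" by simp
    from std_normal_distribution_odd_moments_abs[of 1, unfolded this]
    have "(\<integral>x. \<bar>x\<bar> ^ 3 \<partial>std_normal_distribution) = sqrt (2 / pi) * 2" by (simp only: power_one_right fact_1 mult_1_right)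
    then show ?thesis using \<open>sqrt (2 / pi) \<le> 1\<close> by linarith
  qed
  have "expectation (\<lambda>\<omega>. \<bar>Y b \<omega> - Y a \<omega>\<bar> ^ 3) = sqrt (2 * (b - a)) ^ 3 * (\<integral>x. \<bar>x\<bar> ^ 3 \<partial>std_normal_distribution)"
  proof -
    have "expectation (\<lambda>\<omega>. \<bar>Y b \<omega> - Y a \<omega>\<bar> ^ 3) = (\<integral>x. \<bar>sqrt (2 * (b - a)) * x\<bar> ^ 3 \<partial>std_normal_distribution)"
      by (rule increment_transfer(2)[of "\<lambda>x. \<bar>x\<bar>^3"]) simp
    also have "\<dots> = (\<integral>x. sqrt (2 * (b - a)) ^ 3 * \<bar>x\<bar> ^ 3 \<partial>std_normal_distribution)"
      using ab by (simp only: abs_mult power_mult_distrib abs_of_nonneg real_sqrt_ge_zero mult_nonneg_nonneg zero_le_numeral diff_ge_0_iff_ge less_imp_le)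
    also have "\<dots> = sqrt (2 * (b - a)) ^ 3 * (\<integral>x. \<bar>x\<bar> ^ 3 \<partial>std_normal_distribution)"
      by (rule integral_mult_right_zero)
    finally show ?thesis .
  qed
  also have "\<dots> \<le> (3 * ((b - a) * sqrt (b - a))) * 2"
    by (rule mult_mono[OF s m]) (use ab in auto)
  finally show ?thesis by simp
qed

lemma increment_symmetric:
  fixes g :: "real \<Rightarrow> real"
  assumes [measurable]: "g \<in> borel_measurable borel"
  shows "expectation (\<lambda>\<omega>. g (- (Y b \<omega> - Y a \<omega>))) = expectation (\<lambda>\<omega>. g (Y b \<omega> - Y a \<omega>))"
proof -
  have "expectation (\<lambda>\<omega>. g (- (Y b \<omega> - Y a \<omega>))) = (\<integral>x. g (- (sqrt (2 * (b - a)) * x)) \<partial>std_normal_distribution)"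
    by (rule increment_transfer(2)[of "\<lambda>x. g (- x)"]) simp
  also have "\<dots> = (\<integral>x. g (sqrt (2 * (b - a)) * x) \<partial>distr std_normal_distribution borel uminus)"
    by (subst integral_distr) auto
  finally show ?thesis unfolding std_normal_uminus increment_transfer(2)[OF assms] .
qed

text \<open>Small negative increments carry a fixed part of the variance: by symmetry they contribute half
  of what \<open>[- c, c]\<close> contributes, and outside this interval \<open>x\<^sup>2 \<le> x ^ 4 / c\<^sup>2\<close>, which the fourth
  moment controls.\<close>

lemma increment_truncated_square:
  assumes c: "0 < c" "12 * (b - a) \<le> c\<^sup>2"
  shows "(b - a) / 2 \<le> expectation (\<lambda>\<omega>. (Y b \<omega> - Y a \<omega>)\<^sup>2 * indicator {-c..0} (Y b \<omega> - Y a \<omega>))"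
proof -
  let ?D = "\<lambda>\<omega>. Y b \<omega> - Y a \<omega>"
  define g where "g = (\<lambda>x::real. x\<^sup>2 * indicator {-c..0} x)"
  have [measurable]: "g \<in> borel_measurable borel" unfolding g_def by measurable
  have i2: "integrable P (\<lambda>\<omega>. (?D \<omega>)\<^sup>2)" and i4: "integrable P (\<lambda>\<omega>. (?D \<omega>) ^ 4)"
    by (rule increment_power_integrable)+
  have ig: "integrable P (\<lambda>\<omega>. g (?D \<omega>))" "integrable P (\<lambda>\<omega>. g (- ?D \<omega>))"
  proof -
    have gen: "integrable P (\<lambda>\<omega>. h (?D \<omega>))"
      if [measurable]: "h \<in> borel_measurable borel" and "\<And>x. \<bar>h x\<bar> \<le> x\<^sup>2" for h :: "real \<Rightarrow> real"
      by (rule Bochner_Integration.integrable_bound[OF i2]) (use that(2) in auto)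
    show "integrable P (\<lambda>\<omega>. g (?D \<omega>))" by (rule gen) (auto simp: g_def indicator_def)
    show "integrable P (\<lambda>\<omega>. g (- ?D \<omega>))" by (rule gen[of "\<lambda>x. g (- x)"]) (auto simp: g_def indicator_def)
  qed
  have pt: "x\<^sup>2 - x ^ 4 / c\<^sup>2 \<le> g x + g (- x)" for x
  proof (cases "\<bar>x\<bar> \<le> c")
    case True
    then have "x\<^sup>2 \<le> g x + g (- x)" by (auto simp: g_def indicator_def)
    moreover have "0 \<le> x ^ 4 / c\<^sup>2" by simp
    ultimately show ?thesis by linarith
  next
    case False
    then have "c\<^sup>2 \<le> x\<^sup>2" using c by (simp add: abs_le_square_iff[symmetric])
    then have "x\<^sup>2 * c\<^sup>2 \<le> x\<^sup>2 * x\<^sup>2" by (intro mult_left_mono) auto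
    also have "x\<^sup>2 * x\<^sup>2 = x ^ 4" by (simp only: power_add[symmetric]) simp
    finally have "x\<^sup>2 \<le> x ^ 4 / c\<^sup>2" using c by (simp add: pos_le_divide_eq)
    moreover have "0 \<le> g x" "0 \<le> g (- x)" by (auto simp: g_def indicator_def)
    ultimately show ?thesis by linarith
  qed
  have "2 * (b - a) - 12 * (b - a)\<^sup>2 / c\<^sup>2 = expectation (\<lambda>\<omega>. (?D \<omega>)\<^sup>2 - (?D \<omega>) ^ 4 / c\<^sup>2)"
    using i2 i4 increment_square increment_fourth by simp
  also have "\<dots> \<le> expectation (\<lambda>\<omega>. g (?D \<omega>) + g (- ?D \<omega>))"
  proof (rule integral_mono)
    show "integrable P (\<lambda>\<omega>. (?D \<omega>)\<^sup>2 - (?D \<omega>) ^ 4 / c\<^sup>2)" using i2 i4 by simp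
    show "integrable P (\<lambda>\<omega>. g (?D \<omega>) + g (- ?D \<omega>))" using ig by (rule Bochner_Integration.integrable_add)
  qed (rule pt)
  also have "\<dots> = 2 * expectation (\<lambda>\<omega>. g (?D \<omega>))"
    using ig increment_symmetric[of g] by simp
  finally have 1: "2 * (b - a) - 12 * (b - a)\<^sup>2 / c\<^sup>2 \<le> 2 * expectation (\<lambda>\<omega>. g (?D \<omega>))" .
  have "12 * (b - a) * (b - a) \<le> c\<^sup>2 * (b - a)" using c ab by (intro mult_right_mono) auto
  then have "12 * (b - a)\<^sup>2 / c\<^sup>2 \<le> b - a" using c by (simp add: pos_divide_le_eq power2_eq_square mult_ac)
  then show ?thesis using 1 by (simp add: g_def)
qed

lemma increment_prob:
  assumes [measurable]: "A \<in> sets borel"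
  shows "prob {\<omega>\<in>space P. Y b \<omega> - Y a \<omega> \<in> A} = measure std_normal_distribution {x. sqrt (2 * (b - a)) * x \<in> A}"
proof -
  have s: "sqrt (2 * (b - a)) \<noteq> 0" using ab by simp
  have "measure (distr P borel (\<lambda>\<omega>. (Y b \<omega> - Y a \<omega>) / sqrt (2 * (b - a)))) {x. sqrt (2 * (b - a)) * x \<in> A}
     = prob {\<omega>\<in>space P. Y b \<omega> - Y a \<omega> \<in> A}"
    using s by (subst measure_distr) (auto intro!: arg_cong[where f=prob])
  then show ?thesis unfolding gaussian_increments_distr[OF G ab] by simp
qed

lemma increment_tail:
  assumes "0 < x"
  shows "prob {\<omega>\<in>space P. x \<le> \<bar>Y b \<omega> - Y a \<omega>\<bar>} \<le> 2 * exp (- x\<^sup>2 / (4 * (b - a)))"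
proof -
  have s: "sqrt (2 * (b - a)) > 0" using ab by simp
  have "{y. x \<le> \<bar>sqrt (2 * (b - a)) * y\<bar>} = {y. x / sqrt (2 * (b - a)) \<le> \<bar>y\<bar>}"
    using s by (auto simp: abs_mult field_simps)
  then have "prob {\<omega>\<in>space P. x \<le> \<bar>Y b \<omega> - Y a \<omega>\<bar>} = measure std_normal_distribution {y. x / sqrt (2 * (b - a)) \<le> \<bar>y\<bar>}"
    using increment_prob[of "{y. x \<le> \<bar>y\<bar>}"] by simp
  also have "\<dots> \<le> 2 * exp (- (x / sqrt (2 * (b - a)))\<^sup>2 / 2)"
    using assms s by (intro std_normal_tail) auto
  also have "- (x / sqrt (2 * (b - a)))\<^sup>2 / 2 = - x\<^sup>2 / (4 * (b - a))"
    using ab by (simp add: power_divide)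
  finally show ?thesis .
qed

lemma increment_below:
  assumes "b - a = r\<^sup>2" "0 < r"
  shows "prob {\<omega>\<in>space P. Y b \<omega> - Y a \<omega> < - (c * r)} = measure std_normal_distribution {..< - c / sqrt 2}"
proof -
  have "sqrt (2 * (b - a)) = sqrt 2 * r" using assms by (simp add: real_sqrt_mult)
  moreover have "{x. sqrt 2 * r * x < - (c * r)} = {..< - c / sqrt 2}"
  proof -
    have "sqrt 2 * r * x < - (c * r) \<longleftrightarrow> x < - c / sqrt 2" for x
    proof -
      have "sqrt 2 * r * x < - (c * r) \<longleftrightarrow> r * (sqrt 2 * x) < r * (- c)" by (simp add: mult_ac)
      also have "\<dots> \<longleftrightarrow> sqrt 2 * x < - c" using assms(2) by (rule mult_less_cancel_left_pos)
      also have "\<dots> \<longleftrightarrow> x < - c / sqrt 2" by (subst pos_less_divide_eq) (auto simp: mult.commute)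
      finally show ?thesis .
    qed
    then show ?thesis by auto
  qed
  ultimately show ?thesis
    using increment_prob[of "{..< - (c * r)}"] by simp
qed

end

section \<open>The modulus of continuity of Brownian motion\<close>

text \<open>Approximate \<open>s\<close> from above by dyadic points of increasing level; consecutive approximations are
  equal or neighbours at the finer level.  Approximating from above makes
  right-continuity sufficient.\<close>

lemma dyadic_chaining:
  fixes f :: "real \<Rightarrow> real" and N m :: nat
  assumes incr: "\<And>l i. m < l \<Longrightarrow> i < N * 2 ^ l \<Longrightarrow> \<bar>f (real (Suc i) / 2 ^ l) - f (real i / 2 ^ l)\<bar> \<le> b l"
    and b: "summable (\<lambda>l. b (Suc m + l))" "\<And>l. 0 \<le> b l"
    and rc: "\<And>s. 0 \<le> s \<Longrightarrow> continuous (at_right s) f"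
    and s: "0 \<le> s" "s \<le> real N"
  shows "\<bar>f s - f (real (nat \<lceil>s * 2 ^ m\<rceil>) / 2 ^ m)\<bar> \<le> (\<Sum>l. b (Suc m + l))"
proof -
  define c where "c = (\<lambda>l. nat \<lceil>s * 2 ^ l\<rceil>)"
  have c: "s * 2 ^ l \<le> real (c l)" "real (c l) < s * 2 ^ l + 1" for l
  proof -
    have "0 \<le> s * 2 ^ l" using s by simp
    then have "real (c l) = of_int \<lceil>s * 2 ^ l\<rceil>" by (simp add: c_def)
    then show "s * 2 ^ l \<le> real (c l)" "real (c l) < s * 2 ^ l + 1" by linarith+
  qed
  have cN: "c l \<le> N * 2 ^ l" for l
  proof -
    have "s * 2 ^ l \<le> real N * 2 ^ l" using s by (intro mult_right_mono) auto
    then have "real (c l) < real N * 2 ^ l + 1" using c(2)[of l] by linarith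
    also have "real N * 2 ^ l = real (N * 2 ^ l)" by simp
    finally have "real (c l) < real (N * 2 ^ l) + 1" .
    then show ?thesis by linarith
  qed
  have step: "c (Suc l) = 2 * c l \<or> Suc (c (Suc l)) = 2 * c l" for l
  proof -
    have "real (c (Suc l)) < 2 * real (c l) + 1" "2 * real (c l) < real (c (Suc l)) + 2"
      using c(1)[of l] c(2)[of l] c(1)[of "Suc l"] c(2)[of "Suc l"] by (auto simp: algebra_simps)
    then show ?thesis by linarith
  qed
  have one: "\<bar>f (real (c (Suc l)) / 2 ^ Suc l) - f (real (c l) / 2 ^ l)\<bar> \<le> b (Suc l)" if "m \<le> l" for l
  proof -
    have eq: "real (c l) / 2 ^ l = real (2 * c l) / 2 ^ Suc l" by simp
    show ?thesis
    proof (cases "c (Suc l) = 2 * c l")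
      case True
      then show ?thesis unfolding eq using b by simp
    next
      case False
      then have S: "2 * c l = Suc (c (Suc l))" using step[of l] by simp
      have "c (Suc l) < N * 2 ^ Suc l" using S cN[of l] by simp
      then show ?thesis unfolding eq S using incr[of "Suc l" "c (Suc l)"] that by (simp only: abs_minus_commute)
    qed
  qed
  have "\<bar>f (real (c (m + k)) / 2 ^ (m + k)) - f (real (c m) / 2 ^ m)\<bar> \<le> (\<Sum>l<k. b (Suc m + l))" for k
  proof (induction k)
    case (Suc k)
    then show ?case using one[of "m + k"] by simp
  qed simp
  moreover have "(\<Sum>l<k. b (Suc m + l)) \<le> (\<Sum>l. b (Suc m + l))" for k
    using b by (intro sum_le_suminf) auto
  ultimately have bd: "\<bar>f (real (c (m + k)) / 2 ^ (m + k)) - f (real (c m) / 2 ^ m)\<bar> \<le> (\<Sum>l. b (Suc m + l))" for k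
    using order_trans by blast
  have "(\<lambda>k. f (real (c (m + k)) / 2 ^ (m + k))) \<longlonglongrightarrow> f s"
  proof (rule LIMSEQ_I)
    fix e :: real assume "0 < e"
    then obtain d where d: "d > 0" "\<And>x. s < x \<Longrightarrow> dist x s < d \<Longrightarrow> dist (f x) (f s) < e"
      using rc[OF s(1)] unfolding continuous_within Lim_within by (metis dist_nz greaterThan_iff less_irrefl)
    obtain M where M: "1 / 2 ^ M < d"
      using real_arch_pow_inv[of d "1/2"] d by (auto simp: power_one_over)
    show "\<exists>no. \<forall>n\<ge>no. norm (f (real (c (m + n)) / 2 ^ (m + n)) - f s) < e"
    proof (intro exI[of _ M] allI impI)
      fix k assume "M \<le> k"
      let ?x = "real (c (m + k)) / 2 ^ (m + k)"
      have "(1::real) / 2 ^ (m + k) \<le> 1 / 2 ^ M" using \<open>M \<le> k\<close> by (simp add: frac_le)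
      moreover have "s \<le> ?x" using c(1)[of "m + k"] by (simp add: pos_le_divide_eq)
      moreover have "?x < (s * 2 ^ (m + k) + 1) / 2 ^ (m + k)"
        using c(2)[of "m + k"] by (rule divide_strict_right_mono) simp
      moreover have "(s * 2 ^ (m + k) + 1) / 2 ^ (m + k) = s + 1 / 2 ^ (m + k)" by (simp add: add_divide_distrib)
      ultimately have "s \<le> ?x" "?x - s < d" using M by linarith+
      then show "norm (f ?x - f s) < e"
        using d(2)[of ?x] \<open>0 < e\<close> by (cases "?x = s") (auto simp: dist_real_def)
    qed
  qed
  then have "(\<lambda>k. \<bar>f (real (c (m + k)) / 2 ^ (m + k)) - f (real (c m) / 2 ^ m)\<bar>) \<longlonglongrightarrow> \<bar>f s - f (real (c m) / 2 ^ m)\<bar>"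
    by (intro tendsto_intros)
  from LIMSEQ_le_const2[OF this] bd show ?thesis unfolding c_def by blast
qed

text \<open>At level \<open>l\<close> an increment exceeds this bound with probability at most \<open>2 exp (- 4 l)\<close>, which beats
  the \<open>2\<^sup>l\<close> increments per unit of time.\<close>

definition dyadic_bound :: "nat \<Rightarrow> real" where
  "dyadic_bound l = 4 * sqrt (real l / 2 ^ l)"

text \<open>The squared ratio is \<open>(l + 1) / (2 l) \<le> 3/4\<close>.  Geometric decay bounds all finer levels together
  by \<open>9\<close> times the present one.\<close>

lemma dyadic_bound_Suc:
  assumes "2 \<le> l" shows "dyadic_bound (Suc l) \<le> 9/10 * dyadic_bound l"
proof -
  have "real (Suc l) / 2 ^ Suc l \<le> (9/10)\<^sup>2 * (real l / 2 ^ l)"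
    using assms by (simp add: field_simps power2_eq_square)
  then have "sqrt (real (Suc l) / 2 ^ Suc l) \<le> sqrt ((9/10)\<^sup>2 * (real l / 2 ^ l))" by (rule real_sqrt_le_mono)
  also have "\<dots> = 9/10 * sqrt (real l / 2 ^ l)" unfolding real_sqrt_mult by simp
  finally show ?thesis by (simp add: dyadic_bound_def)
qed

lemma dyadic_bound_nonneg: "0 \<le> dyadic_bound l"
  by (simp add: dyadic_bound_def)

lemma dyadic_bound_geometric:
  assumes "2 \<le> m" shows "dyadic_bound (m + k) \<le> dyadic_bound m * (9/10) ^ k"
proof (induction k)
  case (Suc k)
  then show ?case using dyadic_bound_Suc[of "m + k"] assms by simp
qed simp

lemma dyadic_bound_sum:
  assumes "2 \<le> m"
  shows "summable (\<lambda>l. dyadic_bound (Suc m + l))" "(\<Sum>l. dyadic_bound (Suc m + l)) \<le> 9 * dyadic_bound m"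
proof -
  have le: "dyadic_bound (Suc m + l) \<le> 9/10 * dyadic_bound m * (9/10) ^ l" for l
    using dyadic_bound_geometric[OF assms, of "Suc l"] by simp
  have g: "(\<lambda>l. 9/10 * dyadic_bound m * (9/10) ^ l) sums (9/10 * dyadic_bound m * (1 / (1 - 9/10)))"
    by (intro sums_mult geometric_sums) simp
  show s: "summable (\<lambda>l. dyadic_bound (Suc m + l))"
    by (rule summable_comparison_test'[OF sums_summable[OF g]]) (use le dyadic_bound_nonneg in auto)
  have "(\<Sum>l. dyadic_bound (Suc m + l)) \<le> (\<Sum>l. 9/10 * dyadic_bound m * (9/10) ^ l)"
    by (rule suminf_le[OF le s sums_summable[OF g]])
  then show "(\<Sum>l. dyadic_bound (Suc m + l)) \<le> 9 * dyadic_bound m" using sums_unique[OF g] by simp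
qed

text \<open>Levy's modulus \<open>sqrt (\<delta> log (1/\<delta>))\<close> at \<open>\<delta> = 2\<^sup>-\<^sup>m\<close>.  The constant is \<open>4 * (9 + 1 + 9)\<close>: two chains down
  to the two times and one step at level \<open>m\<close>, in units of \<open>sqrt (m / 2\<^sup>m)\<close>.\<close>

definition levy_modulus :: "nat \<Rightarrow> real \<Rightarrow> (real \<Rightarrow> real) \<Rightarrow> bool" where
  "levy_modulus m0 N f \<longleftrightarrow> (\<forall>m\<ge>m0. \<forall>s\<in>{0..N}. \<forall>t\<in>{0..N}. \<bar>s - t\<bar> \<le> 1 / 2 ^ m \<longrightarrow> \<bar>f s - f t\<bar> \<le> 76 * sqrt (real m / 2 ^ m))"

lemma levy_modulus_from_dyadic:
  fixes f :: "real \<Rightarrow> real" and N m0 :: nat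
  assumes incr: "\<And>l i. m0 \<le> l \<Longrightarrow> i < N * 2 ^ l \<Longrightarrow> \<bar>f (real (Suc i) / 2 ^ l) - f (real i / 2 ^ l)\<bar> \<le> dyadic_bound l"
    and rc: "\<And>s. 0 \<le> s \<Longrightarrow> continuous (at_right s) f" and m0: "2 \<le> m0"
  shows "levy_modulus m0 (real N) f"
  unfolding levy_modulus_def
proof (intro allI ballI impI)
  have main: "\<bar>f s - f t\<bar> \<le> 76 * sqrt (real m / 2 ^ m)"
    if m: "m0 \<le> m" and st: "0 \<le> s" "s \<le> t" "t \<le> real N" "t - s \<le> 1 / 2 ^ m" for m s t
  proof -
    define c where "c = (\<lambda>s::real. nat \<lceil>s * 2 ^ m\<rceil>)"
    have c: "real (c s) = of_int \<lceil>s * 2 ^ m\<rceil>" if "0 \<le> s" for s using that by (simp add: c_def)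
    have near: "\<bar>f s - f (real (c s) / 2 ^ m)\<bar> \<le> 9 * dyadic_bound m" if "0 \<le> s" "s \<le> real N" for s
    proof -
      have "\<bar>f s - f (real (c s) / 2 ^ m)\<bar> \<le> (\<Sum>l. dyadic_bound (Suc m + l))"
        unfolding c_def using m m0 that
        by (intro dyadic_chaining[where N=N] incr dyadic_bound_sum dyadic_bound_nonneg rc) auto
      also have "\<dots> \<le> 9 * dyadic_bound m" using m m0 by (intro dyadic_bound_sum) auto
      finally show ?thesis .
    qed
    have mid: "\<bar>f (real (c s) / 2 ^ m) - f (real (c t) / 2 ^ m)\<bar> \<le> dyadic_bound m"
    proof -
      have "s * 2 ^ m \<le> t * 2 ^ m" "t * 2 ^ m \<le> s * 2 ^ m + 1" "t * 2 ^ m \<le> real N * 2 ^ m"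
        using st by (auto intro!: mult_right_mono simp: field_simps)
      then have "s * 2 ^ m \<le> t * 2 ^ m" "t * 2 ^ m \<le> s * 2 ^ m + 1" "t * 2 ^ m \<le> of_int (int (N * 2 ^ m))" by auto
      then have "\<lceil>s * 2 ^ m\<rceil> \<le> \<lceil>t * 2 ^ m\<rceil>" "\<lceil>t * 2 ^ m\<rceil> \<le> \<lceil>s * 2 ^ m\<rceil> + 1" "\<lceil>t * 2 ^ m\<rceil> \<le> int (N * 2 ^ m)"
        by linarith+
      then have "c t = c s \<or> c t = Suc (c s) \<and> c s < N * 2 ^ m"
        using c[of s] c[of t] st by linarith
      then show ?thesis
      proof
        assume "c t = Suc (c s) \<and> c s < N * 2 ^ m"
        then show ?thesis using incr[OF m, of "c s"] by (simp only: abs_minus_commute)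
      qed (use dyadic_bound_nonneg in simp)
    qed
    have "\<bar>f s - f t\<bar> \<le> 19 * dyadic_bound m"
      using near[of s] near[of t] mid st by linarith
    then show ?thesis by (simp add: dyadic_bound_def)
  qed
  fix m s t
  assume "m0 \<le> m" "s \<in> {0..real N}" "t \<in> {0..real N}" "\<bar>s - t\<bar> \<le> 1 / 2 ^ m"
  then show "\<bar>f s - f t\<bar> \<le> 76 * sqrt (real m / 2 ^ m)"
    using main[of m s t] main[of m t s] by (cases "s \<le> t") (auto simp: abs_minus_commute)
qed

lemma modulus_tendsto_0: "(\<lambda>m. c * sqrt (real m / 2 ^ m)) \<longlonglongrightarrow> 0"
proof -
  have "(\<lambda>m. real m / 2 ^ m) \<longlonglongrightarrow> 0"
    using powser_times_n_limit_0[of "1/2::real"] by (simp add: power_divide)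
  from tendsto_mult_right_zero[OF tendsto_real_sqrt[OF this, simplified], of c] show ?thesis by simp
qed

lemma levy_modulus_continuous:
  assumes "levy_modulus m0 N f" shows "continuous_on {0..N} f"
  unfolding continuous_on_iff
proof (intro ballI allI impI)
  fix s e :: real assume s: "s \<in> {0..N}" and "0 < e"
  have "eventually (\<lambda>m. 76 * sqrt (real m / 2 ^ m) < e) sequentially"
    using order_tendstoD(2)[OF modulus_tendsto_0 \<open>0 < e\<close>] .
  then obtain m where m: "m0 \<le> m" "76 * sqrt (real m / 2 ^ m) < e"
    unfolding eventually_sequentially by (meson nle_le)
  show "\<exists>d>0. \<forall>x'\<in>{0..N}. dist x' s < d \<longrightarrow> dist (f x') (f s) < e"
  proof (intro exI[of _ "1 / 2 ^ m"] conjI ballI impI)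
    fix t assume "t \<in> {0..N}" "dist t s < 1 / 2 ^ m"
    then have "\<bar>f t - f s\<bar> \<le> 76 * sqrt (real m / 2 ^ m)"
      using assms m(1) s unfolding levy_modulus_def by (auto simp: dist_real_def)
    then show "dist (f t) (f s) < e" using m(2) by (simp add: dist_real_def)
  qed simp
qed

text \<open>Borel-Cantelli over the levels and chaining.\<close>

lemma AE_levy_modulus:
  assumes G: "gaussian_increments P Y (real N)"
    and rc: "\<And>\<omega> s. \<omega> \<in> space P \<Longrightarrow> 0 \<le> s \<Longrightarrow> continuous (at_right s) (\<lambda>u. Y u \<omega>)"
  shows "AE \<omega> in P. \<exists>m0. levy_modulus m0 (real N) (\<lambda>u. Y u \<omega>)"
proof -
  interpret prob_space P using G unfolding gaussian_increments_def by blast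
  define B where "B = (\<lambda>l i. {\<omega>\<in>space P. dyadic_bound l \<le> \<bar>Y (real (Suc i) / 2 ^ l) \<omega> - Y (real i / 2 ^ l) \<omega>\<bar>})"
  \<comment> \<open>The shift to level \<open>l + 1\<close> avoids level \<open>0\<close>, where the bound is \<open>0\<close>.\<close>
  define A where "A = (\<lambda>l. \<Union>i<N * 2 ^ Suc l. B (Suc l) i)"
  have le: "real (Suc i) / 2 ^ l \<le> real N" if "i < N * 2 ^ l" for i l
  proof -
    have "Suc i \<le> N * 2 ^ l" using that by simp
    then have "real (Suc i) \<le> real (N * 2 ^ l)" by (rule of_nat_mono)
    then have "real (Suc i) \<le> real N * 2 ^ l" by simp
    then show ?thesis by (subst pos_divide_le_eq) (simp_all del: of_nat_Suc)
  qed
  have Bm [measurable]: "B l i \<in> sets P" if "i < N * 2 ^ l" for l i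
  proof -
    have le': "real i / 2 ^ l \<le> real N" using le[OF that] by (rule order_trans[rotated]) (simp add: divide_right_mono)
    have [measurable]: "Y (real (Suc i) / 2 ^ l) \<in> borel_measurable P" "Y (real i / 2 ^ l) \<in> borel_measurable P"
      using gaussian_increments_rv[OF G _ le[OF that]] gaussian_increments_rv[OF G _ le'] by auto
    show ?thesis unfolding B_def by measurable
  qed
  have Bp: "prob (B l i) \<le> 2 * exp (- 4 * real l)" if "i < N * 2 ^ l" "0 < l" for l i
  proof -
    have d: "real (Suc i) / 2 ^ l - real i / 2 ^ l = 1 / 2 ^ l" by (simp add: diff_divide_distrib[symmetric])
    have pos: "0 < dyadic_bound l" using that by (simp add: dyadic_bound_def)
    have "prob (B l i) \<le> 2 * exp (- (dyadic_bound l)\<^sup>2 / (4 * (real (Suc i) / 2 ^ l - real i / 2 ^ l)))"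
      unfolding B_def by (rule increment_tail[OF G _ _ le[OF that(1)] pos]) (auto simp: divide_strict_right_mono)
    also have "- (dyadic_bound l)\<^sup>2 / (4 * (real (Suc i) / 2 ^ l - real i / 2 ^ l)) = - 4 * real l"
      unfolding d by (simp add: dyadic_bound_def power_mult_distrib)
    finally show ?thesis .
  qed
  have Am: "A l \<in> sets P" for l unfolding A_def by (intro sets.finite_UN) auto
  have Ap: "prob (A l) \<le> 2 * real N * (1/2) ^ l" for l
  proof -
    have "exp (-4::real) \<le> 1/4"
      using exp_ge_add_one_self[of "4::real"] by (simp add: exp_minus field_simps)
    then have q: "2 * exp (-4::real) \<le> 1/2" by simp
    have "prob (A l) \<le> (\<Sum>i<N * 2 ^ Suc l. prob (B (Suc l) i))"
      unfolding A_def by (rule finite_measure_subadditive_finite) auto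
    also have "\<dots> \<le> (\<Sum>i<N * 2 ^ Suc l. 2 * exp (- 4 * real (Suc l)))"
      by (rule sum_mono, rule Bp) auto
    also have "\<dots> = 2 * real N * (2 ^ Suc l * exp (- 4 * real (Suc l)))" by simp
    also have "2 ^ Suc l * exp (- 4 * real (Suc l)) = (2 * exp (-4::real)) ^ Suc l"
      unfolding power_mult_distrib exp_of_nat_mult[symmetric] by (simp add: mult.commute)
    also have "2 * real N * (2 * exp (-4::real)) ^ Suc l \<le> 2 * real N * (1/2) ^ Suc l"
      by (intro mult_left_mono power_mono q) auto
    also have "\<dots> \<le> 2 * real N * (1/2) ^ l" by (intro mult_left_mono power_decreasing) auto
    finally show ?thesis .
  qed
  have "summable (\<lambda>l. prob (A l))"
    by (rule summable_comparison_test'[where g="\<lambda>l. 2 * real N * (1/2) ^ l" and N=0])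
       (use Ap in \<open>auto intro!: summable_mult summable_geometric\<close>)
  from borel_cantelli_AE1[OF Am _ this]
  have "AE \<omega> in P. eventually (\<lambda>l. \<omega> \<in> space P - A l) sequentially" by (simp add: emeasure_eq_measure)
  then show ?thesis
  proof eventually_elim
    case (elim \<omega>)
    then obtain l0 where l0: "\<And>l. l0 \<le> l \<Longrightarrow> \<omega> \<in> space P - A l" by (auto simp: eventually_sequentially)
    have \<omega>: "\<omega> \<in> space P" using l0 by auto
    have "levy_modulus (Suc l0 + 2) (real N) (\<lambda>u. Y u \<omega>)"
    proof (rule levy_modulus_from_dyadic)
      fix l i assume l: "Suc l0 + 2 \<le> l" "i < N * 2 ^ l"
      then obtain l' where l': "l = Suc l'" "l0 \<le> l'" by (cases l) auto
      then have "\<omega> \<notin> B l i" using l0[of l'] l by (auto simp: A_def)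
      then show "\<bar>Y (real (Suc i) / 2 ^ l) \<omega> - Y (real i / 2 ^ l) \<omega>\<bar> \<le> dyadic_bound l"
        using \<omega> by (auto simp: B_def)
    qed (use rc \<omega> in auto)
    then show ?case by blast
  qed
qed

section \<open>The number of visits is geometric\<close>

text \<open>\<open>U j\<close> is the event of a visit at step \<open>j\<close>.  A visit at step \<open>i\<close> can only be followed by a later visit
  if the next variable stays above \<open>c\<close>, which fails with probability at least \<open>p\<close>.  Multiply
  by \<open>1 + p\<close> at each visit that is survived and by \<open>0\<close> at each one that is not: the product
  is a supermartingale because \<open>(1 + p) (1 - p) \<le> 1\<close>, and on the event in question it has
  collected at least \<open>m\<close> factors \<open>1 + p\<close>.  Markov's inequality gives the geometric bound.\<close>

lemma (in prob_space) geometric_visits: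
  fixes \<xi> :: "nat \<Rightarrow> 'a \<Rightarrow> real" and U :: "nat \<Rightarrow> 'a set"
  assumes ind: "indep_vars (\<lambda>_. borel) \<xi> {..<n}"
    and U: "\<And>j. j \<le> n \<Longrightarrow> U j \<in> sets (past M \<xi> j)"
    and kill: "\<And>i j \<omega>. i < j \<Longrightarrow> j \<le> n \<Longrightarrow> \<omega> \<in> U i \<Longrightarrow> \<omega> \<in> U j \<Longrightarrow> c \<le> \<xi> i \<omega>"
    and p: "0 \<le> p" "\<And>i. i < n \<Longrightarrow> U i \<noteq> {} \<Longrightarrow> p \<le> prob {\<omega>\<in>space M. \<xi> i \<omega> < c}"
    and k: "k \<le> n"
  shows "prob {\<omega>\<in>space M. \<omega> \<in> U k \<and> m \<le> card {j. j < k \<and> \<omega> \<in> U j}} \<le> 1 / (1 + p) ^ m"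
    and "{\<omega>\<in>space M. \<omega> \<in> U k \<and> m \<le> card {j. j < k \<and> \<omega> \<in> U j}} \<in> events"
proof -
  have rv: "\<xi> i \<in> borel_measurable M" if "i < n" for i
    using ind that unfolding indep_vars_def2 by auto
  have Um: "U j \<in> events" if "j \<le> n" for j
  proof -
    have "sets (past M \<xi> j) \<subseteq> events" by (intro measurable_past_into) (use rv that in auto)
    then show ?thesis using U[OF that] by auto
  qed
  define V where "V = (\<lambda>x. indicator {c..} x :: real)"
  define F where "F = (\<lambda>i \<omega>. (1 - indicator (U i) \<omega>) + (1 + p) * indicator (U i) \<omega> * V (\<xi> i \<omega>) :: real)"
  define Q where "Q = (\<lambda>k \<omega>. \<Prod>i<k. F i \<omega>)"
  have F: "0 \<le> F i \<omega>" "F i \<omega> \<le> 1 + p" for i \<omega>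
    using p(1) by (auto simp: F_def V_def indicator_def)
  have Vm: "V \<in> borel_measurable borel" unfolding V_def by measurable
  have ind_past: "(\<lambda>\<omega>. indicator (U j) \<omega> :: real) \<in> borel_measurable (past M \<xi> k)" if "j \<le> k" "j \<le> n" for j k
    by (rule past_measurable_mono[OF borel_measurable_indicator[OF U[OF that(2)]] that(1)])
  have Q_past: "Q k \<in> borel_measurable (past M \<xi> k)" if "k \<le> n" for k
    unfolding Q_def F_def
  proof (rule borel_measurable_prod)
    fix i assume i: "i \<in> {..<k}"
    have [measurable]: "(\<lambda>\<omega>. indicator (U i) \<omega> :: real) \<in> borel_measurable (past M \<xi> k)"
      "(\<lambda>\<omega>. V (\<xi> i \<omega>)) \<in> borel_measurable (past M \<xi> k)"
      using i that ind_past measurable_compose[OF past_component Vm] by auto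
    show "(\<lambda>\<omega>. 1 - indicator (U i) \<omega> + (1 + p) * indicator (U i) \<omega> * V (\<xi> i \<omega>)) \<in> borel_measurable (past M \<xi> k)"
      by measurable
  qed
  have Q_rv: "Q k \<in> borel_measurable M" if "k \<le> n" for k
    by (rule past_measurable_rv[OF Q_past[OF that]]) (use rv that in auto)
  have Qb: "0 \<le> Q k \<omega>" "Q k \<omega> \<le> (1 + p) ^ k" for k \<omega>
  proof -
    show "0 \<le> Q k \<omega>" unfolding Q_def using F by (intro prod_nonneg) auto
    have "Q k \<omega> \<le> (\<Prod>i<k. 1 + p)" unfolding Q_def using F by (intro prod_mono) auto
    then show "Q k \<omega> \<le> (1 + p) ^ k" by simp
  qed
  have Qint: "integrable M (Q k)" if "k \<le> n" for k
    by (rule integrable_const_bound[where B="(1 + p) ^ k"]) (use Qb Q_rv that in auto)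
  have EQ: "expectation (Q k) \<le> 1" if "k \<le> n" for k
    using that
  proof (induction k)
    case 0
    then show ?case by (simp add: Q_def prob_space)
  next
    case (Suc k)
    then have kn: "k < n" "k \<le> n" by auto
    have [measurable]: "U k \<in> events" using Um kn by auto
    have [measurable]: "Q k \<in> borel_measurable M" "\<xi> k \<in> borel_measurable M" using Q_rv rv kn by auto
    have QU: "(\<lambda>\<omega>. Q k \<omega> * indicator (U k) \<omega>) \<in> borel_measurable (past M \<xi> k)"
      using Q_past[OF kn(2)] ind_past[of k k] kn by (intro borel_measurable_times) auto
    have QUi: "integrable M (\<lambda>\<omega>. Q k \<omega> * indicator (U k) \<omega>)"
      using Qint[OF kn(2)] by (intro integrable_real_mult_indicator) auto
    have Vi: "integrable M (\<lambda>\<omega>. V (\<xi> k \<omega>))"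
      using measurable_compose[OF rv[OF kn(1)] Vm]
      by (intro integrable_const_bound[where B=1]) (auto simp: V_def indicator_def)
    note mult = expectation_past_mult[OF ind kn(1) QU QUi Vm Vi]
    have eq: "Q (Suc k) \<omega> = Q k \<omega> - Q k \<omega> * indicator (U k) \<omega> + (1 + p) * (Q k \<omega> * indicator (U k) \<omega> * V (\<xi> k \<omega>))" for \<omega>
      by (simp add: Q_def F_def algebra_simps)
    have "expectation (Q (Suc k)) = expectation (Q k) - expectation (\<lambda>\<omega>. Q k \<omega> * indicator (U k) \<omega>)
        + (1 + p) * (expectation (\<lambda>\<omega>. Q k \<omega> * indicator (U k) \<omega>) * expectation (\<lambda>\<omega>. V (\<xi> k \<omega>)))"
      unfolding eq using Qint[OF kn(2)] QUi mult by simp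
    also have "\<dots> \<le> expectation (Q k)"
    proof (cases "U k = {}")
      case False
      have "expectation (\<lambda>\<omega>. V (\<xi> k \<omega>)) = expectation (indicator {\<omega>\<in>space M. c \<le> \<xi> k \<omega>})"
        by (intro Bochner_Integration.integral_cong) (auto simp: V_def indicator_def)
      also have "\<dots> = prob {\<omega>\<in>space M. c \<le> \<xi> k \<omega>}"
        by (simp add: Int_absorb2)
      also have "{\<omega>\<in>space M. c \<le> \<xi> k \<omega>} = space M - {\<omega>\<in>space M. \<xi> k \<omega> < c}" by auto
      also have "prob \<dots> = 1 - prob {\<omega>\<in>space M. \<xi> k \<omega> < c}"
        by (rule prob_compl) measurable
      finally have "expectation (\<lambda>\<omega>. V (\<xi> k \<omega>)) \<le> 1 - p" using p(2)[OF kn(1) False] by simp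
      then have "(1 + p) * expectation (\<lambda>\<omega>. V (\<xi> k \<omega>)) \<le> (1 + p) * (1 - p)"
        using p(1) by (intro mult_left_mono) auto
      also have "\<dots> \<le> 1" by (simp add: algebra_simps)
      finally have le: "(1 + p) * expectation (\<lambda>\<omega>. V (\<xi> k \<omega>)) \<le> 1" .
      have "0 \<le> expectation (\<lambda>\<omega>. Q k \<omega> * indicator (U k) \<omega>)"
        using Qb by (intro integral_nonneg_AE) auto
      from mult_left_mono[OF le this] show ?thesis by (simp add: algebra_simps)
    qed simp
    also have "\<dots> \<le> 1" using Suc kn by simp
    finally show ?case .
  qed
  let ?E = "{\<omega>\<in>space M. \<omega> \<in> U k \<and> m \<le> card {j. j < k \<and> \<omega> \<in> U j}}"
  have card_eq: "real (card {j. j < k \<and> \<omega> \<in> U j}) = (\<Sum>j<k. indicator (U j) \<omega>)" for \<omega>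
  proof -
    have "(\<Sum>j<k. indicator (U j) \<omega> :: real) = (\<Sum>j<k. if \<omega> \<in> U j then 1 else 0)"
      by (intro sum.cong) (auto simp: indicator_def)
    also have "\<dots> = real (card ({..<k} \<inter> {j. \<omega> \<in> U j}))" by (simp add: sum.If_cases)
    also have "{..<k} \<inter> {j. \<omega> \<in> U j} = {j. j < k \<and> \<omega> \<in> U j}" by auto
    finally show ?thesis by simp
  qed
  have E_eq: "?E = U k \<inter> {\<omega>\<in>space M. real m \<le> (\<Sum>j<k. indicator (U j) \<omega>)}"
    using sets.sets_into_space[OF Um[OF k]] unfolding card_eq[symmetric] by auto
  have [measurable]: "(\<lambda>\<omega>. \<Sum>j<k. indicator (U j) \<omega> :: real) \<in> borel_measurable M"
    using Um k by (intro borel_measurable_sum borel_measurable_indicator) auto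
  show Em: "?E \<in> events" unfolding E_eq using Um[OF k] by auto
  have "?E \<subseteq> {\<omega>\<in>space M. (1 + p) ^ m \<le> Q k \<omega>}"
  proof safe
    fix \<omega> assume \<omega>: "\<omega> \<in> U k" "m \<le> card {j. j < k \<and> \<omega> \<in> U j}"
    have "F i \<omega> = (if \<omega> \<in> U i then 1 + p else 1)" if "i < k" for i
      using kill[OF that k _ \<omega>(1)] by (auto simp: F_def V_def)
    then have "Q k \<omega> = (\<Prod>i<k. if \<omega> \<in> U i then 1 + p else 1)" unfolding Q_def by (intro prod.cong) auto
    also have "\<dots> = (\<Prod>i\<in>{i\<in>{..<k}. \<omega> \<in> U i}. 1 + p)" by (subst prod.inter_filter) auto
    also have "{i\<in>{..<k}. \<omega> \<in> U i} = {j. j < k \<and> \<omega> \<in> U j}" by auto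
    finally have "Q k \<omega> = (1 + p) ^ card {j. j < k \<and> \<omega> \<in> U j}" by simp
    then show "(1 + p) ^ m \<le> Q k \<omega>" using \<omega>(2) p(1) by (simp add: power_increasing)
  qed
  then have "prob ?E \<le> prob {\<omega>\<in>space M. (1 + p) ^ m \<le> Q k \<omega>}"
  proof (rule finite_measure_mono)
    have [measurable]: "Q k \<in> borel_measurable M" by (rule Q_rv[OF k])
    show "{\<omega>\<in>space M. (1 + p) ^ m \<le> Q k \<omega>} \<in> events" by measurable
  qed
  also have "\<dots> \<le> expectation (Q k) / (1 + p) ^ m"
    using Qint[OF k] Qb p(1) by (intro integral_Markov_inequality_measure[where A="{}"]) (auto simp: zero_less_power)
  also have "\<dots> \<le> 1 / (1 + p) ^ m"
    using EQ[OF k] p(1) by (intro divide_right_mono) auto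
  finally show "prob ?E \<le> 1 / (1 + p) ^ m" .
qed

text \<open>The probability that an increment over a time \<open>r\<^sup>2\<close> is below \<open>- 6 r\<close>; by scaling it does not
  depend on \<open>r\<close>.\<close>

definition escape_prob :: real where
  "escape_prob = measure std_normal_distribution {..< - 6 / sqrt 2}"

lemma escape_prob_pos: "0 < escape_prob"
  unfolding escape_prob_def by (rule std_normal_lower_pos)

text \<open>At a visit the path is at most \<open>3 r\<close> above its start and has not gone more than \<open>3 r\<close> below it, so
  a fall by more than \<open>6 r\<close> rules out all later visits.  The thresholds are \<open>3 r\<close> because \<open>r\<close> comes
  from the tree distance and another \<open>2 r\<close> from moving two times to the grid.
  Index \<open>0\<close> is the start and not a visit, since the first step may be shorter than \<open>r\<^sup>2\<close>.\<close>

definition visit :: "real \<Rightarrow> (nat \<Rightarrow> real) \<Rightarrow> nat \<Rightarrow> (real \<Rightarrow> real) \<Rightarrow> bool" where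
  "visit r \<tau> k f \<longleftrightarrow> 1 \<le> k \<and> f (\<tau> k) \<le> f (\<tau> 0) + 3 * r \<and> (\<forall>j\<in>{1..k}. f (\<tau> 0) - 3 * r \<le> f (\<tau> j))"

lemma gaussian_visits:
  assumes G: "gaussian_increments P Y T" and r: "0 < r"
    and \<tau>: "0 \<le> \<tau> 0" "\<tau> 0 \<le> \<tau> 1" "\<And>i. 1 \<le> i \<Longrightarrow> i < n \<Longrightarrow> \<tau> (Suc i) = \<tau> i + r\<^sup>2" "\<tau> n \<le> T" and n: "1 \<le> n"
  shows "measure P {\<omega>\<in>space P. visit r \<tau> n (\<lambda>u. Y u \<omega>) \<and> m \<le> card {j. j < n \<and> visit r \<tau> j (\<lambda>u. Y u \<omega>)}} \<le> 1 / (1 + escape_prob) ^ m"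
    and "{\<omega>\<in>space P. visit r \<tau> n (\<lambda>u. Y u \<omega>) \<and> m \<le> card {j. j < n \<and> visit r \<tau> j (\<lambda>u. Y u \<omega>)}} \<in> sets P"
proof -
  interpret prob_space P using G unfolding gaussian_increments_def by blast
  have mono: "\<tau> i \<le> \<tau> (Suc i)" if "i < n" for i
    using \<tau>(2) \<tau>(3)[of i] that by (cases i) auto
  have mono': "\<tau> i \<le> \<tau> j" if "i \<le> j" "j \<le> n" for i j
    using that(1,2) by (induction j rule: dec_induct) (use mono order_trans in force)+
  define \<xi> where "\<xi> = (\<lambda>i \<omega>. Y (\<tau> (Suc i)) \<omega> - Y (\<tau> i) \<omega>)"
  have ind: "indep_vars (\<lambda>_. borel) \<xi> {..<n}"
    unfolding \<xi>_def by (rule gaussian_increments_indep[OF G \<tau>(1) mono \<tau>(4)])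
  have W: "Y (\<tau> j) \<omega> - Y (\<tau> 0) \<omega> = (\<Sum>i<j. \<xi> i \<omega>)" for j \<omega>
    unfolding \<xi>_def by (induction j) auto
  define U where "U = (\<lambda>k. {\<omega>\<in>space P. visit r \<tau> k (\<lambda>u. Y u \<omega>)})"
  have U_alt: "U k = {\<omega>\<in>space P. 1 \<le> k \<and> (\<Sum>i<k. \<xi> i \<omega>) \<le> 3 * r \<and> (\<forall>j\<in>{1..k}. - 3 * r \<le> (\<Sum>i<j. \<xi> i \<omega>))}" for k
    unfolding U_def visit_def W[symmetric] by (auto simp: algebra_simps)
  have Um: "U k \<in> sets (past P \<xi> k)" for k
  proof -
    have [measurable]: "(\<lambda>\<omega>. \<Sum>i<j. \<xi> i \<omega>) \<in> borel_measurable (past P \<xi> k)" if "j \<le> k" for j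
      using that by (intro borel_measurable_sum past_component) auto
    have "{\<omega>\<in>space (past P \<xi> k). 1 \<le> k \<and> (\<Sum>i<k. \<xi> i \<omega>) \<le> 3 * r \<and> (\<forall>j\<in>{1..k}. - 3 * r \<le> (\<Sum>i<j. \<xi> i \<omega>))} \<in> sets (past P \<xi> k)"
      by (intro sets.sets_Collect_conj sets.sets_Collect_finite_All sets.sets_Collect_const) measurable
    then show ?thesis by (simp only: U_alt space_past)
  qed
  have kill: "- (6 * r) \<le> \<xi> i \<omega>" if "i < j" "j \<le> n" "\<omega> \<in> U i" "\<omega> \<in> U j" for i j \<omega>
  proof -
    have "(\<Sum>i<i. \<xi> i \<omega>) \<le> 3 * r" "- 3 * r \<le> (\<Sum>i<Suc i. \<xi> i \<omega>)"
    proof -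
      have "\<forall>l\<in>{1..j}. - 3 * r \<le> (\<Sum>i<l. \<xi> i \<omega>)" using that(4) unfolding U_alt by blast
      moreover have "Suc i \<in> {1..j}" using that(1) by simp
      ultimately show "- 3 * r \<le> (\<Sum>i<Suc i. \<xi> i \<omega>)" by blast
      show "(\<Sum>i<i. \<xi> i \<omega>) \<le> 3 * r" using that(3) unfolding U_alt by blast
    qed
    then show ?thesis by simp
  qed
  have p: "escape_prob \<le> prob {\<omega>\<in>space P. \<xi> i \<omega> < - (6 * r)}" if i: "i < n" "U i \<noteq> {}" for i
  proof -
    have "1 \<le> i" using i(2) unfolding U_alt by auto
    then have d: "\<tau> (Suc i) - \<tau> i = r\<^sup>2" using \<tau>(3) i by simp
    have "0 \<le> \<tau> i" "\<tau> i < \<tau> (Suc i)" "\<tau> (Suc i) \<le> T"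
      using mono'[of 0 i] mono'[of "Suc i" n] \<tau> i d r by (auto simp: algebra_simps zero_less_power)
    from increment_below[OF G this d r, of 6] show ?thesis by (simp add: \<xi>_def escape_prob_def)
  qed
  have eq: "{\<omega>\<in>space P. visit r \<tau> n (\<lambda>u. Y u \<omega>) \<and> m \<le> card {j. j < n \<and> visit r \<tau> j (\<lambda>u. Y u \<omega>)}}
      = {\<omega>\<in>space P. \<omega> \<in> U n \<and> m \<le> card {j. j < n \<and> \<omega> \<in> U j}}"
    unfolding U_def by (auto cong: conj_cong)
  show "measure P {\<omega>\<in>space P. visit r \<tau> n (\<lambda>u. Y u \<omega>) \<and> m \<le> card {j. j < n \<and> visit r \<tau> j (\<lambda>u. Y u \<omega>)}} \<le> 1 / (1 + escape_prob) ^ m"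
    unfolding eq
  proof (rule geometric_visits(1)[OF ind])
    show "- (6 * r) \<le> \<xi> i \<omega>" if "i < j" "j \<le> n" "\<omega> \<in> U i" "\<omega> \<in> U j" for i j \<omega>
      using that by (rule kill)
    show "escape_prob \<le> prob {\<omega>\<in>space P. \<xi> i \<omega> < - (6 * r)}" if "i < n" "U i \<noteq> {}" for i
      using that by (rule p)
  qed (use Um escape_prob_pos in auto)
  show "{\<omega>\<in>space P. visit r \<tau> n (\<lambda>u. Y u \<omega>) \<and> m \<le> card {j. j < n \<and> visit r \<tau> j (\<lambda>u. Y u \<omega>)}} \<in> sets P"
    unfolding eq
  proof (rule geometric_visits(2)[OF ind])
    show "- (6 * r) \<le> \<xi> i \<omega>" if "i < j" "j \<le> n" "\<omega> \<in> U i" "\<omega> \<in> U j" for i j \<omega>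
      using that by (rule kill)
    show "escape_prob \<le> prob {\<omega>\<in>space P. \<xi> i \<omega> < - (6 * r)}" if "i < n" "U i \<noteq> {}" for i
      using that by (rule p)
  qed (use Um escape_prob_pos in auto)
qed

section \<open>Counting visits on a fine grid\<close>

text \<open>At scale \<open>2\<^sup>-\<^sup>n\<close> there are of order \<open>256\<^sup>n\<close> events to be excluded; with \<open>visit_rate * n\<close> visits each
  has probability at most \<open>512\<^sup>-\<^sup>n\<close>.\<close>

definition visit_rate :: nat where
  "visit_rate = (LEAST K. 512 \<le> (1 + escape_prob) ^ K)"

lemma visit_rate: "512 \<le> (1 + escape_prob) ^ visit_rate"
proof -
  obtain K where "512 < (1 + escape_prob) ^ K"
    using real_arch_pow[of "1 + escape_prob" 512] escape_prob_pos by auto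
  then have "512 \<le> (1 + escape_prob) ^ K" by simp
  then show ?thesis unfolding visit_rate_def by (rule LeastI)
qed

text \<open>A grid version of being close in the tree distance at scale \<open>r = 2\<^sup>-\<^sup>n\<close>.  The mesh
  \<open>16\<^sup>-\<^sup>n\<close> is much finer than \<open>r\<^sup>2\<close>, so that for large \<open>n\<close> Levy's modulus bounds the movement
  between neighbouring grid points by \<open>r\<close>.\<close>

definition near_grid :: "nat \<Rightarrow> (real \<Rightarrow> real) \<Rightarrow> nat \<Rightarrow> nat \<Rightarrow> bool" where
  "near_grid n f i g \<longleftrightarrow> f (real g / 16 ^ n) \<le> f (real i / 16 ^ n) + 3 * (1 / 2 ^ n) \<and>
     (\<forall>q\<in>{i..g}. f (real i / 16 ^ n) - 3 * (1 / 2 ^ n) \<le> f (real q / 16 ^ n))"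

text \<open>The grid splits into \<open>4\<^sup>n\<close> progressions with step \<open>4\<^sup>n / 16\<^sup>n = r\<^sup>2\<close>.  The chain starts at grid point
  \<open>i\<close> and continues with the grid points \<open>i + j\<close>, \<open>i + j + 4\<^sup>n\<close>, \<open>\<dots>\<close> of one progression.\<close>

definition chain :: "nat \<Rightarrow> nat \<Rightarrow> nat \<Rightarrow> nat \<Rightarrow> real" where
  "chain n i j k = (case k of 0 \<Rightarrow> real i / 16 ^ n | Suc l \<Rightarrow> real (i + j + l * 4 ^ n) / 16 ^ n)"

lemma chain_simps [simp]:
  "chain n i j 0 = real i / 16 ^ n" "chain n i j (Suc l) = real (i + j + l * 4 ^ n) / 16 ^ n"
  by (simp_all add: chain_def)

lemma power_16_4: "(4::real) ^ n / 16 ^ n = (1 / 2 ^ n)\<^sup>2"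
proof -
  have "(4::real) ^ n / 16 ^ n = (4 / 16) ^ n" by (rule power_divide[symmetric])
  also have "(4 / 16 :: real) = (1 / 2)\<^sup>2" by (simp add: power2_eq_square)
  also have "((1 / 2 :: real)\<^sup>2) ^ n = ((1 / 2) ^ n)\<^sup>2" by (simp only: power_mult[symmetric] mult.commute)
  finally show ?thesis by (simp add: power_one_over)
qed

text \<open>Along each of the \<open>4\<^sup>n\<close> progressions there are at most \<open>visit_rate * n\<close> visits, for all
  starting points at once, by Borel-Cantelli.\<close>

lemma AE_near_grid_count:
  assumes G: "gaussian_increments P Y (real N)"
  shows "AE \<omega> in P. \<exists>n0. \<forall>n\<ge>n0. \<forall>i. card {g\<in>{i..N * 16 ^ n}. near_grid n (\<lambda>u. Y u \<omega>) i g} \<le> visit_rate * n * 4 ^ n"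
proof -
  interpret prob_space P using G unfolding gaussian_increments_def by blast
  \<comment> \<open>\<open>E n (i, j, l)\<close>: the chain visits at its index \<open>Suc l\<close> after too many earlier visits.\<close>
  define E where "E = (\<lambda>n (i, j, l). {\<omega>\<in>space P. visit (1 / 2 ^ n) (chain n i j) (Suc l) (\<lambda>u. Y u \<omega>) \<and>
      visit_rate * n \<le> card {k. k < Suc l \<and> visit (1 / 2 ^ n) (chain n i j) k (\<lambda>u. Y u \<omega>)}})"
  define I where "I = (\<lambda>n. {(i, j, l) \<in> {..N * 16 ^ n} \<times> {..<4 ^ n} \<times> {..N * 4 ^ n}. i + j + l * 4 ^ n \<le> N * 16 ^ n})"
  define A where "A = (\<lambda>n. \<Union>x\<in>I n. E n x)"
  have I_sub: "I n \<subseteq> {..N * 16 ^ n} \<times> {..<4 ^ n} \<times> {..N * 4 ^ n}" for n by (auto simp: I_def)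
  have I_fin: "finite (I n)" for n by (rule finite_subset[OF I_sub]) auto
  have E: "E n x \<in> events" "prob (E n x) \<le> 1 / (1 + escape_prob) ^ (visit_rate * n)" if "x \<in> I n" for n x
  proof -
    obtain i j l where x: "x = (i, j, l)" by (cases x) auto
    have le: "i + j + l * 4 ^ n \<le> N * 16 ^ n" using that by (simp add: I_def x)
    have 1: "0 \<le> chain n i j 0" by simp
    have 2: "chain n i j 0 \<le> chain n i j 1"
      using chain_simps(2)[of n i j 0] by (simp add: divide_right_mono)
    have 3: "chain n i j (Suc a) = chain n i j a + (1 / 2 ^ n)\<^sup>2" if "1 \<le> a" for a
    proof -
      obtain b where "a = Suc b" using \<open>1 \<le> a\<close> by (cases a) auto
      then show ?thesis by (simp add: power_16_4[symmetric] add_divide_distrib algebra_simps)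
    qed
    have "real (i + j + l * 4 ^ n) \<le> real (N * 16 ^ n)" using le by (rule of_nat_mono)
    then have 4: "chain n i j (Suc l) \<le> real N" by (simp add: pos_divide_le_eq)
    have r: "0 < (1 / 2 ^ n :: real)" by simp
    show "E n x \<in> events" unfolding E_def x prod.case
      by (rule gaussian_visits(2)[OF G r 1 2 3 4]) auto
    show "prob (E n x) \<le> 1 / (1 + escape_prob) ^ (visit_rate * n)" unfolding E_def x prod.case
      by (rule gaussian_visits(1)[OF G r 1 2 3 4]) auto
  qed
  have Am: "A n \<in> events" for n unfolding A_def using I_fin E(1) by (intro sets.finite_UN) auto
  have Ap: "prob (A n) \<le> (real N + 1)\<^sup>2 * (1 / 2) ^ n" for n
  proof -
    have "prob (A n) \<le> (\<Sum>x\<in>I n. prob (E n x))" unfolding A_def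
      using I_fin E(1) by (intro finite_measure_subadditive_finite) auto
    also have "\<dots> \<le> (\<Sum>x\<in>I n. 1 / (1 + escape_prob) ^ (visit_rate * n))" by (rule sum_mono) (rule E(2))
    also have "\<dots> = real (card (I n)) * (1 / ((1 + escape_prob) ^ visit_rate) ^ n)" by (simp add: power_mult)
    also have "\<dots> \<le> ((real N + 1)\<^sup>2 * 256 ^ n) * (1 / 512 ^ n)"
    proof (rule mult_mono)
      have "card (I n) \<le> card ({..N * 16 ^ n} \<times> {..<4 ^ n::nat} \<times> {..N * 4 ^ n})"
        by (rule card_mono[OF _ I_sub]) auto
      also have "\<dots> = Suc (N * 16 ^ n) * (4 ^ n * Suc (N * 4 ^ n))" by (simp add: card_cartesian_product)
      also have "\<dots> \<le> ((N + 1) * 16 ^ n) * (4 ^ n * ((N + 1) * 4 ^ n))"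
        by (intro mult_mono) auto
      also have "\<dots> = (N + 1) * (N + 1) * (16 ^ n * (4 ^ n * 4 ^ n))" by (simp only: mult_ac)
      also have "(16::nat) ^ n * (4 ^ n * 4 ^ n) = 256 ^ n" by (simp add: power_mult_distrib[symmetric])
      finally have "real (card (I n)) \<le> real ((N + 1) * (N + 1) * 256 ^ n)" by (rule of_nat_mono)
      then show "real (card (I n)) \<le> (real N + 1)\<^sup>2 * 256 ^ n" by (simp add: power2_eq_square algebra_simps)
      show "1 / ((1 + escape_prob) ^ visit_rate) ^ n \<le> 1 / 512 ^ n"
        using visit_rate by (intro divide_left_mono power_mono) auto
    qed (use escape_prob_pos in auto)
    also have "\<dots> = (real N + 1)\<^sup>2 * (256 / 512) ^ n" unfolding power_divide by simp
    finally show ?thesis by simp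
  qed
  have "summable (\<lambda>n. prob (A n))"
    by (rule summable_comparison_test'[where g="\<lambda>n. (real N + 1)\<^sup>2 * (1/2) ^ n" and N=0])
       (use Ap in \<open>auto intro!: summable_mult summable_geometric\<close>)
  from borel_cantelli_AE1[OF Am _ this]
  have "AE \<omega> in P. eventually (\<lambda>n. \<omega> \<in> space P - A n) sequentially" by (simp add: emeasure_eq_measure)
  then show ?thesis
  proof eventually_elim
    case (elim \<omega>)
    then obtain n0 where n0: "\<And>n. n0 \<le> n \<Longrightarrow> \<omega> \<in> space P - A n" by (auto simp: eventually_sequentially)
    show ?case
    proof (intro exI[of _ n0] allI impI)
      fix n i assume "n0 \<le> n"
      then have \<omega>: "\<omega> \<in> space P" "\<omega> \<notin> A n" using n0 by auto
      let ?f = "\<lambda>u. Y u \<omega>"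
      define L where "L = (\<lambda>j. {l. i + j + l * 4 ^ n \<le> N * 16 ^ n \<and> near_grid n ?f i (i + j + l * 4 ^ n)})"
      have lle: "l \<le> N * 4 ^ n" if "i + j + l * 4 ^ n \<le> N * 16 ^ n" for j l
      proof -
        have "(16::nat) ^ n = 4 ^ n * 4 ^ n" by (simp add: power_mult_distrib[symmetric])
        then have "l * 4 ^ n \<le> (N * 4 ^ n) * 4 ^ n" using that by (simp only: mult.assoc)
        then show ?thesis by simp
      qed
      have Lf: "finite (L j)" for j
        by (rule finite_subset[of _ "{..N * 4 ^ n}"]) (use lle in \<open>auto simp: L_def\<close>)
      have vis: "visit (1 / 2 ^ n) (chain n i j) (Suc l) ?f" if "l \<in> L j" for l j
      proof -
        have ng: "near_grid n ?f i (i + j + l * 4 ^ n)" using that by (simp add: L_def)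
        have "?f (chain n i j 0) - 3 * (1 / 2 ^ n) \<le> ?f (chain n i j k)" if "k \<in> {1..Suc l}" for k
        proof -
          obtain b where b: "k = Suc b" "b \<le> l" using \<open>k \<in> {1..Suc l}\<close> by (cases k) auto
          then have "i + j + b * 4 ^ n \<in> {i..i + j + l * 4 ^ n}" by simp
          then show ?thesis using ng unfolding near_grid_def b(1) chain_simps by blast
        qed
        then show ?thesis using ng unfolding visit_def near_grid_def chain_simps by auto
      qed
      have cardL: "card (L j) \<le> visit_rate * n" if j: "j < 4 ^ n" for j
      proof (cases "L j = {}")
        case False
        \<comment> \<open>Apply the exclusion of \<open>E\<close> to the last visit; all other visits of the progression precede it.\<close>
        define x where "x = Max (L j)"
        have x: "x \<in> L j" "\<And>l. l \<in> L j \<Longrightarrow> l \<le> x" using False Lf by (auto simp: x_def)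
        have xI: "(i, j, x) \<in> I n" using x(1) j lle by (auto simp: I_def L_def)
        let ?K = "{k. k < Suc x \<and> visit (1 / 2 ^ n) (chain n i j) k ?f}"
        have "\<not> visit_rate * n \<le> card ?K"
        proof -
          have "\<omega> \<notin> E n (i, j, x)" using \<omega>(2) xI unfolding A_def by blast
          then show ?thesis using \<omega>(1) vis[OF x(1)] unfolding E_def by blast
        qed
        moreover have "card (Suc ` (L j - {x})) \<le> card ?K"
        proof (rule card_mono)
          show "Suc ` (L j - {x}) \<subseteq> ?K"
          proof
            fix k assume "k \<in> Suc ` (L j - {x})"
            then obtain l where l: "k = Suc l" "l \<in> L j" "l \<noteq> x" by blast
            then have "l < x" using x(2)[of l] by simp
            then show "k \<in> ?K" unfolding l(1) using vis[OF l(2)] by simp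
          qed
        qed simp
        moreover have "card (Suc ` (L j - {x})) = card (L j) - 1"
          using x(1) Lf by (simp add: card_image)
        ultimately show ?thesis by linarith
      qed simp
      have "{g\<in>{i..N * 16 ^ n}. near_grid n ?f i g} \<subseteq> (\<Union>j<4 ^ n. (\<lambda>l. i + j + l * 4 ^ n) ` L j)"
      proof
        fix g assume g: "g \<in> {g\<in>{i..N * 16 ^ n}. near_grid n ?f i g}"
        define j l where "j = (g - i) mod 4 ^ n" and "l = (g - i) div 4 ^ n"
        have "g = i + (g - i)" using g by simp
        also have "g - i = j + l * 4 ^ n" unfolding j_def l_def by (rule mod_div_mult_eq[symmetric])
        finally have eq: "g = i + j + l * 4 ^ n" by (simp only: add.assoc)
        then have "l \<in> L j" using g by (simp add: L_def)
        moreover have "j < 4 ^ n" by (simp add: j_def)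
        ultimately show "g \<in> (\<Union>j<4 ^ n. (\<lambda>l. i + j + l * 4 ^ n) ` L j)" using eq by blast
      qed
      then have "card {g\<in>{i..N * 16 ^ n}. near_grid n ?f i g} \<le> card (\<Union>j<4 ^ n. (\<lambda>l. i + j + l * 4 ^ n) ` L j)"
        using Lf by (intro card_mono) auto
      also have "\<dots> \<le> (\<Sum>j<4 ^ n. card ((\<lambda>l. i + j + l * 4 ^ n) ` L j))" by (rule card_UN_le) simp
      also have "\<dots> \<le> (\<Sum>j<(4::nat) ^ n. visit_rate * n)"
      proof (rule sum_mono)
        fix j assume "j \<in> {..<(4::nat) ^ n}"
        then show "card ((\<lambda>l. i + j + l * 4 ^ n) ` L j) \<le> visit_rate * n"
          using cardL[of j] card_image_le[OF Lf, of "\<lambda>l. i + j + l * 4 ^ n" j] by simp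
      qed
      finally show "card {g\<in>{i..N * 16 ^ n}. near_grid n ?f i g} \<le> visit_rate * n * 4 ^ n"
        by (simp add: mult.commute)
    qed
  qed
qed

section \<open>Covering the times that are close in the tree distance\<close>

text \<open>The tree distance of \<open>s\<close> and \<open>t\<close> is at most \<open>r\<close>.\<close>

definition near :: "(real \<Rightarrow> real) \<Rightarrow> real \<Rightarrow> real \<Rightarrow> real \<Rightarrow> bool" where
  "near f r s t \<longleftrightarrow> (\<forall>q\<in>{min s t..max s t}. f s + f t - r \<le> 2 * f q)"

text \<open>With \<open>m = 4 n\<close> the modulus is \<open>76 sqrt (4 n / 16\<^sup>n)\<close>, and \<open>76\<^sup>2 * 4 n = 23104 n \<le> 4\<^sup>n\<close>.\<close>

lemma levy_modulus_mesh:
  assumes "levy_modulus m0 N f" "m0 \<le> 4 * n" "10 \<le> n" "x \<in> {0..N}" "y \<in> {0..N}" "\<bar>x - y\<bar> \<le> 1 / 16 ^ n"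
  shows "\<bar>f x - f y\<bar> \<le> 1 / 2 ^ n"
proof -
  have pw: "(2::real) ^ (4 * n) = 16 ^ n" by (simp add: power_mult)
  have "23104 * n \<le> 4 ^ n" using assms(3)
    by (induction n rule: dec_induct) auto
  then have "real (23104 * n) \<le> real (4 ^ n)" by (rule of_nat_mono)
  then have le: "23104 * real n \<le> 4 ^ n" by simp
  have "5776 * (real (4 * n) / 16 ^ n) = 23104 * real n / 16 ^ n" by simp
  also have "\<dots> \<le> 4 ^ n / 16 ^ n" by (rule divide_right_mono[OF le]) simp
  also have "\<dots> = (1 / 2 ^ n)\<^sup>2" by (rule power_16_4)
  finally have "sqrt (5776 * (real (4 * n) / 16 ^ n)) \<le> sqrt ((1 / 2 ^ n)\<^sup>2)" by (rule real_sqrt_le_mono)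
  moreover have "sqrt (5776 * (real (4 * n) / 16 ^ n)) = 76 * sqrt (real (4 * n) / 16 ^ n)"
    unfolding real_sqrt_mult[of 5776] using real_sqrt_abs[of 76] by simp
  moreover have "\<bar>f x - f y\<bar> \<le> 76 * sqrt (real (4 * n) / 16 ^ n)"
  proof -
    have "\<bar>x - y\<bar> \<le> 1 / 2 ^ (4 * n)" unfolding pw by (rule assms(6))
    from assms(1)[unfolded levy_modulus_def, rule_format, OF assms(2,4,5) this]
    show ?thesis unfolding pw .
  qed
  moreover have "sqrt ((1 / 2 ^ n)\<^sup>2) = 1 / 2 ^ n" by (rule real_sqrt_unique) auto
  ultimately show ?thesis by linarith
qed

text \<open>Round both times down to the grid.  If \<open>t\<close> is close to \<open>s\<close> then the rounded times satisfy
  \<open>near_grid\<close>, so \<open>t\<close> lies in one of the counted cells.\<close>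

lemma forward_cover:
  fixes N n m0 C :: nat
  assumes L: "levy_modulus m0 (real N) f" "m0 \<le> 4 * n" "10 \<le> n"
    and count: "\<And>i. card {g\<in>{i..N * 16 ^ n}. near_grid n f i g} \<le> C"
    and s: "s \<in> {0..real N}"
  shows "\<exists>A. finite A \<and> card A \<le> C \<and>
    {t\<in>{s..real N}. near f (1 / 2 ^ n) s t} \<subseteq> (\<Union>g\<in>A. {real g / 16 ^ n .. real (Suc g) / 16 ^ n})"
proof -
  define r :: real where "r = 1 / 2 ^ n"
  have "0 < r" by (simp add: r_def)
  define G where "G = (\<lambda>t::real. nat \<lfloor>t * 16 ^ n\<rfloor>)"
  have G1: "real (G t) \<le> t * 16 ^ n" "t * 16 ^ n < real (G t) + 1" if "0 \<le> t" for t
  proof -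
    have "0 \<le> t * 16 ^ n" using that by simp
    then have "real (G t) = of_int \<lfloor>t * 16 ^ n\<rfloor>" by (simp add: G_def)
    then show "real (G t) \<le> t * 16 ^ n" "t * 16 ^ n < real (G t) + 1" by linarith+
  qed
  have G2: "real (G t) / 16 ^ n \<le> t" "t < real (Suc (G t)) / 16 ^ n" "\<bar>real (G t) / 16 ^ n - t\<bar> \<le> 1 / 16 ^ n" if "0 \<le> t" for t
  proof -
    show a: "real (G t) / 16 ^ n \<le> t" using G1[OF that] by (simp add: pos_divide_le_eq)
    show b: "t < real (Suc (G t)) / 16 ^ n" using G1[OF that] by (simp add: pos_less_divide_eq)
    have "real (Suc (G t)) / 16 ^ n = real (G t) / 16 ^ n + 1 / 16 ^ n" by (simp add: add_divide_distrib)
    then show "\<bar>real (G t) / 16 ^ n - t\<bar> \<le> 1 / 16 ^ n" using a b by linarith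
  qed
  define A where "A = {g\<in>{G s..N * 16 ^ n}. near_grid n f (G s) g}"
  have "{t\<in>{s..real N}. near f r s t} \<subseteq> (\<Union>g\<in>A. {real g / 16 ^ n .. real (Suc g) / 16 ^ n})"
  proof
    fix t assume "t \<in> {t\<in>{s..real N}. near f r s t}"
    then have t: "s \<le> t" "t \<le> real N" and nr: "\<And>q. s \<le> q \<Longrightarrow> q \<le> t \<Longrightarrow> f s + f t - r \<le> 2 * f q"
      by (auto simp: near_def)
    have pos: "0 \<le> s" "0 \<le> t" "s \<le> real N" using s t by auto
    have st: "\<bar>f s - f t\<bar> \<le> r" using nr[of s] nr[of t] t by auto
    have lo: "f s - r \<le> f q" if "s \<le> q" "q \<le> t" for q using nr[OF that] st by linarith
    have mesh: "\<bar>f (real (G u) / 16 ^ n) - f u\<bar> \<le> r" if "0 \<le> u" "u \<le> real N" for u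
      unfolding r_def
      by (rule levy_modulus_mesh[OF L]) (use that G2[OF that(1)] in \<open>auto intro: order_trans\<close>)
    have Gst: "G s \<le> G t" unfolding G_def using t by (intro nat_mono floor_mono mult_right_mono) auto
    have "real (G t) \<le> real N * 16 ^ n"
      using G1(1)[OF pos(2)] t by (meson mult_right_mono order_trans zero_le_numeral zero_le_power)
    also have "\<dots> = real (N * 16 ^ n)" by simp
    finally have GN: "G t \<le> N * 16 ^ n" by (simp only: of_nat_le_iff)
    have "near_grid n f (G s) (G t)"
      unfolding near_grid_def r_def[symmetric]
    proof (intro conjI ballI)
      show "f (real (G t) / 16 ^ n) \<le> f (real (G s) / 16 ^ n) + 3 * r"
        using mesh[OF pos(2) t(2)] mesh[OF pos(1) pos(3)] st by linarith
      fix q assume q: "q \<in> {G s..G t}"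
      show "f (real (G s) / 16 ^ n) - 3 * r \<le> f (real q / 16 ^ n)"
      proof (cases "q = G s")
        case True
        then show ?thesis using \<open>0 < r\<close> by simp
      next
        case False
        then have "Suc (G s) \<le> q" using q by auto
        then have "real (Suc (G s)) / 16 ^ n \<le> real q / 16 ^ n" by (intro divide_right_mono of_nat_mono) auto
        then have 1: "s \<le> real q / 16 ^ n" using G2(2)[OF pos(1)] by linarith
        have "real q / 16 ^ n \<le> real (G t) / 16 ^ n" using q by (intro divide_right_mono of_nat_mono) auto
        then have 2: "real q / 16 ^ n \<le> t" using G2(1)[OF pos(2)] by linarith
        show ?thesis using lo[OF 1 2] mesh[OF pos(1) pos(3)] \<open>0 < r\<close> by linarith
      qed
    qed
    then have "G t \<in> A" using Gst GN by (simp add: A_def)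
    then show "t \<in> (\<Union>g\<in>A. {real g / 16 ^ n .. real (Suc g) / 16 ^ n})"
      using G2[OF pos(2)] by (intro UN_I[of "G t"]) auto
  qed
  moreover have "finite A" "card A \<le> C" using count[of "G s"] by (auto simp: A_def)
  ultimately show ?thesis unfolding r_def by blast
qed

text \<open>Times after \<open>s\<close> are covered by at most \<open>visit_rate * n * 4\<^sup>n\<close> cells of length \<open>16\<^sup>-\<^sup>n\<close>; times before
  \<open>s\<close> are handled in the same way by the time-reversed process.\<close>

lemma AE_near_measure:
  assumes G: "gaussian_increments P Y (real N)"
    and rc: "\<And>\<omega> s. \<omega> \<in> space P \<Longrightarrow> 0 \<le> s \<Longrightarrow> continuous (at_right s) (\<lambda>u. Y u \<omega>)"
  shows "AE \<omega> in P. \<exists>n0. \<forall>n\<ge>n0. \<forall>s\<in>{0..real N}. \<exists>B\<in>sets lborel.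
     {t\<in>{0..real N}. near (\<lambda>u. Y u \<omega>) (1 / 2 ^ n) s t} \<subseteq> B \<and>
     emeasure lborel B \<le> ennreal (2 * visit_rate * n / 4 ^ n)"
proof -
  have "AE \<omega> in P. \<exists>m0. levy_modulus m0 (real N) (\<lambda>u. Y u \<omega>)"
    by (rule AE_levy_modulus[OF G]) (rule rc)
  then show ?thesis
  using AE_near_grid_count[OF G] AE_near_grid_count[OF gaussian_increments_reverse[OF G]]
proof eventually_elim
  case (elim \<omega>)
  let ?f = "\<lambda>u. Y u \<omega>" and ?g = "\<lambda>u. Y (real N - u) \<omega>"
  from elim obtain m0 n1 n2 where L: "levy_modulus m0 (real N) ?f"
    and c1: "\<And>n i. n1 \<le> n \<Longrightarrow> card {g\<in>{i..N * 16 ^ n}. near_grid n ?f i g} \<le> visit_rate * n * 4 ^ n"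
    and c2: "\<And>n i. n2 \<le> n \<Longrightarrow> card {g\<in>{i..N * 16 ^ n}. near_grid n ?g i g} \<le> visit_rate * n * 4 ^ n"
    by blast
  have L': "levy_modulus m0 (real N) ?g"
    unfolding levy_modulus_def
  proof (intro allI ballI impI)
    fix m s t assume a: "m0 \<le> m" "s \<in> {0..real N}" "t \<in> {0..real N}" "\<bar>s - t\<bar> \<le> 1 / 2 ^ m"
    have b: "\<bar>(real N - s) - (real N - t)\<bar> \<le> 1 / 2 ^ m" using a by (simp add: abs_minus_commute)
    show "\<bar>?g s - ?g t\<bar> \<le> 76 * sqrt (real m / 2 ^ m)"
      using L[unfolded levy_modulus_def, rule_format, OF a(1) _ _ b] a by simp
  qed
  show ?case
  proof (intro exI[of _ "max (max n1 n2) (max 10 m0)"] allI impI ballI)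
    fix n s assume n: "max (max n1 n2) (max 10 m0) \<le> n" and s: "s \<in> {0..real N}"
    let ?C = "visit_rate * n * 4 ^ n"
    have nn: "m0 \<le> 4 * n" "10 \<le> n" using n by auto
    obtain A where A: "finite A" "card A \<le> ?C"
      "{t\<in>{s..real N}. near ?f (1 / 2 ^ n) s t} \<subseteq> (\<Union>g\<in>A. {real g / 16 ^ n .. real (Suc g) / 16 ^ n})"
      using forward_cover[OF L nn c1 s] n by auto
    have s': "real N - s \<in> {0..real N}" using s by auto
    obtain A' where A': "finite A'" "card A' \<le> ?C"
      "{t\<in>{real N - s..real N}. near ?g (1 / 2 ^ n) (real N - s) t} \<subseteq> (\<Union>g\<in>A'. {real g / 16 ^ n .. real (Suc g) / 16 ^ n})"
      using forward_cover[OF L' nn c2 s'] n by auto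
    define B1 where "B1 = (\<Union>g\<in>A. {real g / 16 ^ n .. real (Suc g) / 16 ^ n})"
    define B2 where "B2 = (\<Union>g\<in>A'. {real N - real (Suc g) / 16 ^ n .. real N - real g / 16 ^ n})"
    have len: "real (Suc g) / 16 ^ n - real g / 16 ^ n = 1 / 16 ^ n" for g by (simp add: diff_divide_distrib[symmetric])
    have le: "real g / 16 ^ n \<le> real (Suc g) / 16 ^ n" for g by (intro divide_right_mono) auto
    have e: "real ?C * (1 / 16 ^ n) = visit_rate * n / 4 ^ n"
      using power_mult_distrib[of "4::real" 4 n] by simp
    have bound: "(\<Sum>g\<in>D. ennreal (1 / 16 ^ n)) \<le> ennreal (visit_rate * n / 4 ^ n)"
      if "finite D" "card D \<le> ?C" for D :: "nat set"
    proof -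
      have "(\<Sum>g\<in>D. ennreal (1 / 16 ^ n)) = ennreal (real (card D) * (1 / 16 ^ n))" by (subst sum_ennreal) auto
      also have "\<dots> \<le> ennreal (real ?C * (1 / 16 ^ n))"
        using that(2) by (intro ennreal_leI mult_right_mono of_nat_mono) auto
      finally show ?thesis unfolding e .
    qed
    have "emeasure lborel B1 \<le> (\<Sum>g\<in>A. emeasure lborel {real g / 16 ^ n .. real (Suc g) / 16 ^ n})"
      unfolding B1_def using A by (intro emeasure_subadditive_finite) auto
    also have "\<dots> = (\<Sum>g\<in>A. ennreal (1 / 16 ^ n))"
      by (intro sum.cong refl) (simp only: emeasure_lborel_Icc[OF le] len)
    finally have m1: "emeasure lborel B1 \<le> ennreal (visit_rate * n / 4 ^ n)" using bound[OF A(1,2)] by (rule order_trans)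
    have "emeasure lborel B2 \<le> (\<Sum>g\<in>A'. emeasure lborel {real N - real (Suc g) / 16 ^ n .. real N - real g / 16 ^ n})"
      unfolding B2_def using A' by (intro emeasure_subadditive_finite) auto
    also have "\<dots> = (\<Sum>g\<in>A'. ennreal (1 / 16 ^ n))"
    proof (intro sum.cong refl)
      fix g
      have "(real N - real g / 16 ^ n) - (real N - real (Suc g) / 16 ^ n) = 1 / 16 ^ n" using len[of g] by linarith
      then show "emeasure lborel {real N - real (Suc g) / 16 ^ n .. real N - real g / 16 ^ n} = ennreal (1 / 16 ^ n)"
        using le[of g] by (subst emeasure_lborel_Icc) auto
    qed
    finally have m2: "emeasure lborel B2 \<le> ennreal (visit_rate * n / 4 ^ n)" using bound[OF A'(1,2)] by (rule order_trans)
    have Bs: "B1 \<in> sets lborel" "B2 \<in> sets lborel" unfolding B1_def B2_def using A A' by auto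
    have "emeasure lborel (B1 \<union> B2) \<le> emeasure lborel B1 + emeasure lborel B2"
      using Bs by (rule emeasure_subadditive)
    also have "\<dots> \<le> ennreal (visit_rate * n / 4 ^ n) + ennreal (visit_rate * n / 4 ^ n)"
      by (rule add_mono[OF m1 m2])
    also have "\<dots> = ennreal (2 * visit_rate * n / 4 ^ n)" by (subst ennreal_plus[symmetric]) auto
    finally have m: "emeasure lborel (B1 \<union> B2) \<le> ennreal (2 * visit_rate * n / 4 ^ n)" .
    have "{t\<in>{0..real N}. near ?f (1 / 2 ^ n) s t} \<subseteq> B1 \<union> B2"
    proof
      fix t assume t: "t \<in> {t\<in>{0..real N}. near ?f (1 / 2 ^ n) s t}"
      show "t \<in> B1 \<union> B2"
      proof (cases "s \<le> t")
        case True
        then have "t \<in> {t\<in>{s..real N}. near ?f (1 / 2 ^ n) s t}" using t by simp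
        then show ?thesis using A(3) unfolding B1_def by blast
      next
        case False
        have "near ?g (1 / 2 ^ n) (real N - s) (real N - t)"
          unfolding near_def
        proof
          fix q assume "q \<in> {min (real N - s) (real N - t)..max (real N - s) (real N - t)}"
          then have "real N - q \<in> {min s t..max s t}" by auto
          then show "?g (real N - s) + ?g (real N - t) - 1 / 2 ^ n \<le> 2 * ?g q" using t by (simp add: near_def)
        qed
        then have "real N - t \<in> {t\<in>{real N - s..real N}. near ?g (1 / 2 ^ n) (real N - s) t}"
          using t False by simp
        then have "real N - t \<in> (\<Union>g\<in>A'. {real g / 16 ^ n .. real (Suc g) / 16 ^ n})"
          using A'(3) by blast
        then obtain g where "g \<in> A'" "real g / 16 ^ n \<le> real N - t" "real N - t \<le> real (Suc g) / 16 ^ n" by (auto simp del: of_nat_Suc)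
        then have "t \<in> B2" unfolding B2_def by (intro UN_I[of g]) (auto simp del: of_nat_Suc)
        then show ?thesis by simp
      qed
    qed
    then show "\<exists>B\<in>sets lborel. {t\<in>{0..real N}. near ?f (1 / 2 ^ n) s t} \<subseteq> B \<and>
       emeasure lborel B \<le> ennreal (2 * visit_rate * n / 4 ^ n)"
      using m Bs by (intro bexI[of _ "B1 \<union> B2"]) auto
  qed
qed
qed

section \<open>The walk reflected at its running maximum\<close>

text \<open>Lindley's recursion.  With \<open>x\<close> the steps of a walk it gives the distance of the walk
  from its running maximum.\<close>

primrec reflect :: "(nat \<Rightarrow> real) \<Rightarrow> nat \<Rightarrow> real" where
  "reflect x 0 = 0"
| "reflect x (Suc k) = max (reflect x k - x k) 0"

lemma reflect_nonneg: "0 \<le> reflect x k"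
  by (cases k) auto

lemma reflect_eq_Max:
  "reflect (\<lambda>k. y (Suc k) - y k) k = Max (y ` {..k}) - (y k :: real)"
proof (induction k)
  case (Suc k)
  have "Max (y ` {..Suc k}) = max (y (Suc k)) (Max (y ` {..k}))"
    unfolding atMost_Suc image_insert by (rule Max_insert) auto
  moreover have "max (m - y k - (y (Suc k) - y k)) 0 = max (y (Suc k)) m - y (Suc k)" for m
    by (simp add: max_def)
  ultimately show ?case unfolding reflect.simps Suc by (simp only:)
qed simp

text \<open>The recursion alters the walk only where \<open>f\<close> is linear with slope \<open>- c\<close>; setting a negative
  value to \<open>0\<close> therefore lowers \<open>f\<close> by \<open>c\<close> times the amount by which the maximum
  increases, and these amounts sum to the running maximum
  \<open>reflect x n + (\<Sum>k<n. x k)\<close>.\<close>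

lemma reflect_discrete_ito:
  fixes f :: "real \<Rightarrow> real"
  assumes f: "\<And>y. y \<le> 0 \<Longrightarrow> f y = - c * y"
  shows "c * (reflect x n + (\<Sum>k<n. x k)) + f (reflect x n) = (\<Sum>k<n. f (reflect x k - x k) - f (reflect x k))"
proof (induction n)
  case (Suc n)
  have "c * (reflect x (Suc n) + x n - reflect x n) + f (reflect x (Suc n)) = f (reflect x n - x n)"
  proof (cases "reflect x n - x n \<ge> 0")
    case False
    then show ?thesis using f[of "reflect x n - x n"] f[of 0] by (simp add: algebra_simps)
  qed simp
  then show ?case using Suc by (simp add: algebra_simps)
qed (use f[of 0] in simp)

text \<open>A convex function, quadratic on \<open>[0, 2 a]\<close> and linear beyond.  Its mean along the reflected walk
  never decreases, and increases by a fixed multiple of the time step while the walk is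
  below \<open>a\<close>, although it grows only linearly; so the walk spends little time near \<open>0\<close>.\<close>

definition huber :: "real \<Rightarrow> real \<Rightarrow> real" where
  "huber a y = (if y \<le> 0 then 0 else if y \<le> 2 * a then y\<^sup>2 / 2 else 2 * a * y - 2 * a\<^sup>2)"

definition huber' :: "real \<Rightarrow> real \<Rightarrow> real" where
  "huber' a y = max 0 (min y (2 * a))"

lemma huber_tangent:
  assumes a: "0 < a"
  shows "huber a x + huber' a x * (u - x) \<le> huber a u"
proof -
  have sq: "0 \<le> (u - x)\<^sup>2" "0 \<le> (u - 2 * a)\<^sup>2" "0 \<le> (x - 2 * a)\<^sup>2" "0 \<le> u\<^sup>2" "0 \<le> x\<^sup>2" "0 < a\<^sup>2" using a by auto
  consider "x \<le> 0" | "0 < x" "x \<le> 2 * a" | "2 * a < x" by linarith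
  then show ?thesis
  proof cases
    case 1
    have "0 \<le> huber a u"
    proof (cases "u \<le> 2 * a")
      case False
      then have "a * (2 * a) \<le> a * u" using a by (intro mult_left_mono) auto
      then show ?thesis using False a by (simp add: huber_def power2_eq_square)
    qed (auto simp: huber_def)
    then show ?thesis using 1 a by (auto simp: huber_def huber'_def)
  next
    case 2
    then have l: "huber a x = x\<^sup>2 / 2" "huber' a x = x" by (auto simp: huber_def huber'_def)
    consider "u \<le> 0" | "0 < u" "u \<le> 2 * a" | "2 * a < u" by linarith
    then show ?thesis
    proof cases
      case 1
      have "x * u \<le> 0" using 2 1 by (simp add: mult_nonneg_nonpos)
      moreover have "x * (u - x) = x * u - x\<^sup>2" by (simp add: power2_eq_square algebra_simps)
      moreover have "huber a u = 0" using 1 by (simp add: huber_def)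
      ultimately show ?thesis using sq(5) unfolding l by linarith
    next
      case 2
      then show ?thesis using sq(1) unfolding l by (simp add: huber_def power2_eq_square algebra_simps)
    next
      case 3
      have "(2 * a - x) * (2 * a) \<le> (2 * a - x) * u" using 2 3 by (intro mult_left_mono) auto
      then show ?thesis using 3 a sq(3) unfolding l by (simp add: huber_def power2_eq_square algebra_simps)
    qed
  next
    case 3
    then have l: "huber a x = 2 * a * x - 2 * a\<^sup>2" "huber' a x = 2 * a" using a by (auto simp: huber_def huber'_def)
    consider "u \<le> 0" | "0 < u" "u \<le> 2 * a" | "2 * a < u" by linarith
    then show ?thesis
    proof cases
      case 1
      have "a * u \<le> 0" using a 1 by (simp add: mult_nonneg_nonpos)
      then show ?thesis using 1 sq unfolding l by (simp add: huber_def power2_eq_square algebra_simps)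
    next
      case 2
      then show ?thesis using sq(2) unfolding l by (simp add: huber_def power2_eq_square algebra_simps)
    next
      case 3
      then show ?thesis using a unfolding l by (simp add: huber_def power2_eq_square algebra_simps)
    qed
  qed
qed

text \<open>For \<open>x \<le> a\<close> and a step in \<open>[- a, 0]\<close> both points stay in the quadratic piece.\<close>

lemma huber_quadratic:
  assumes "0 \<le> x" "x \<le> a" "- a \<le> \<xi>" "\<xi> \<le> 0"
  shows "huber a (x - \<xi>) - huber a x + huber' a x * \<xi> = \<xi>\<^sup>2 / 2"
proof -
  have "huber a (x - \<xi>) = (x - \<xi>)\<^sup>2 / 2" using assms by (auto simp: huber_def)
  moreover have "huber a x = x\<^sup>2 / 2" "huber' a x = x" using assms by (auto simp: huber_def huber'_def)
  ultimately show ?thesis by (simp add: power2_eq_square algebra_simps)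
qed

lemma huber_bounds:
  assumes "0 < a" "0 \<le> y" shows "0 \<le> huber a y" "huber a y \<le> 2 * a * y" "\<bar>huber' a z\<bar> \<le> 2 * a"
proof -
  show "0 \<le> huber a y"
    using huber_tangent[OF assms(1), of 0 y] by (simp add: huber_def huber'_def)
  have "0 < y \<Longrightarrow> y \<le> 2 * a \<Longrightarrow> y * y \<le> 2 * a * y" by (intro mult_right_mono) auto
  moreover have "0 \<le> a * y" using assms by simp
  ultimately show "huber a y \<le> 2 * a * y"
    using assms by (auto simp: huber_def power2_eq_square)
  show "\<bar>huber' a z\<bar> \<le> 2 * a" using assms by (auto simp: huber'_def)
qed

lemma huber_max: "huber a (max y 0) = huber a y"
  by (auto simp: huber_def max_def)

lemma huber_measurable [measurable]: "huber a \<in> borel_measurable borel" "huber' a \<in> borel_measurable borel"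
  unfolding huber_def[abs_def] huber'_def[abs_def] by measurable

locale reflected_walk =
  fixes P :: "'w measure" and Y :: "real \<Rightarrow> 'w \<Rightarrow> real" and T :: real and n :: nat
  assumes G: "gaussian_increments P Y T" and T: "0 < T" and n: "0 < n"
begin

sublocale prob_space P using G unfolding gaussian_increments_def by blast

definition mesh where "mesh = T / n"
definition incr where "incr k \<omega> = Y (T * real (Suc k) / n) \<omega> - Y (T * real k / n) \<omega>"
definition R where "R k \<omega> = reflect (\<lambda>k. incr k \<omega>) k"

lemma mesh_pos: "0 < mesh" using T n by (simp add: mesh_def)

lemma times:
  assumes "k < n"
  shows "0 \<le> T * real k / n" "T * real k / n < T * real (Suc k) / n" "T * real (Suc k) / n \<le> T"
    "T * real (Suc k) / n - T * real k / n = mesh"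
proof -
  show d: "T * real (Suc k) / n - T * real k / n = mesh" by (simp add: mesh_def diff_divide_distrib[symmetric] algebra_simps)
  show "0 \<le> T * real k / n" using T by simp
  show "T * real k / n < T * real (Suc k) / n" using d mesh_pos by linarith
  have "T * real (Suc k) \<le> T * real n" using assms T by (intro mult_left_mono) auto
  then show "T * real (Suc k) / n \<le> T" using n by (subst pos_divide_le_eq) auto
qed

lemma indep: "indep_vars (\<lambda>_. borel) incr {..<n}"
proof -
  have "indep_vars (\<lambda>_. borel) (\<lambda>i \<omega>. Y (T * real (Suc i) / n) \<omega> - Y (T * real i / n) \<omega>) {..<n}"
    using gaussian_increments_indep[OF G, of "\<lambda>k. T * real k / n" n] times n by (auto simp: less_imp_le)
  then show ?thesis unfolding incr_def[abs_def] .
qed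

lemma incr_rv: "k < n \<Longrightarrow> incr k \<in> borel_measurable P"
  using indep unfolding indep_vars_def2 by auto

lemma incr_power_integrable: "k < n \<Longrightarrow> integrable P (\<lambda>\<omega>. incr k \<omega> ^ j)"
  unfolding incr_def by (rule increment_power_integrable[OF G times(1-3)])

lemma incr_moments:
  assumes "k < n"
  shows "expectation (incr k) = 0" "expectation (\<lambda>\<omega>. (incr k \<omega>)\<^sup>2) = 2 * mesh"
    "expectation (\<lambda>\<omega>. incr k \<omega> ^ 4) = 12 * mesh\<^sup>2" "expectation (\<lambda>\<omega>. \<bar>incr k \<omega>\<bar> ^ 3) \<le> 6 * (mesh * sqrt mesh)"
  using increment_mean[OF G times(1-3)[OF assms]] increment_square[OF G times(1-3)[OF assms]]
    increment_fourth[OF G times(1-3)[OF assms]] increment_abs_cube[OF G times(1-3)[OF assms]]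
  unfolding times(4)[OF assms] incr_def[abs_def] by auto

lemma incr_abs_cube_integrable: "k < n \<Longrightarrow> integrable P (\<lambda>\<omega>. \<bar>incr k \<omega>\<bar> ^ 3)"
  using integrable_norm[OF incr_power_integrable[of k 3]] by (simp add: power_abs)

lemma incr_integrable: "k < n \<Longrightarrow> integrable P (incr k)"
  using incr_power_integrable[of k 1] by simp

lemma incr_truncated:
  assumes "k < n" "0 < a" "12 * mesh \<le> a\<^sup>2"
  shows "mesh / 2 \<le> expectation (\<lambda>\<omega>. (incr k \<omega>)\<^sup>2 * indicator {-a..0} (incr k \<omega>))"
  using increment_truncated_square[OF G times(1-3)[OF assms(1)], of a] assms
  unfolding times(4)[OF assms(1)] incr_def[abs_def] by auto

lemma R_past: "k \<le> j \<Longrightarrow> R k \<in> borel_measurable (past P incr j)"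
proof (induction k)
  case (Suc k)
  have "R (Suc k) = (\<lambda>\<omega>. max (R k \<omega> - incr k \<omega>) 0)" by (auto simp: R_def)
  moreover have "R k \<in> borel_measurable (past P incr j)" "incr k \<in> borel_measurable (past P incr j)"
    using Suc past_component[of k j incr P] by auto
  ultimately show ?case by simp
qed (simp add: R_def[abs_def])

lemma R_rv: "k \<le> n \<Longrightarrow> R k \<in> borel_measurable P"
  by (rule past_measurable_rv[OF R_past[of k k]]) (use incr_rv in auto)

lemma R_nonneg: "0 \<le> R k \<omega>" by (simp add: R_def reflect_nonneg)

lemma R_Suc: "R (Suc k) \<omega> = max (R k \<omega> - incr k \<omega>) 0" by (simp add: R_def)

lemma fn_R_past: "g \<in> borel_measurable borel \<Longrightarrow> k \<le> j \<Longrightarrow> (\<lambda>\<omega>. g (R k \<omega>)) \<in> borel_measurable (past P incr j)"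
  using measurable_compose[OF R_past] by blast

lemma fn_R_rv: "g \<in> borel_measurable borel \<Longrightarrow> k \<le> n \<Longrightarrow> (\<lambda>\<omega>. g (R k \<omega>)) \<in> borel_measurable P"
  using measurable_compose[OF R_rv] by blast

text \<open>Reflection only decreases the square, and the increments are centred and independent of the past.\<close>

lemma R_square:
  assumes "k \<le> n"
  shows "integrable P (\<lambda>\<omega>. (R k \<omega>)\<^sup>2) \<and> integrable P (R k) \<and> expectation (\<lambda>\<omega>. (R k \<omega>)\<^sup>2) \<le> 2 * (real k * mesh)"
  using assms
proof (induction k)
  case 0
  then show ?case by (simp add: R_def[abs_def])
next
  case (Suc k)
  then have k: "k < n" "k \<le> n" and IH: "integrable P (\<lambda>\<omega>. (R k \<omega>)\<^sup>2)" "integrable P (R k)"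
      "expectation (\<lambda>\<omega>. (R k \<omega>)\<^sup>2) \<le> 2 * (real k * mesh)" by auto
  have c: "integrable P (\<lambda>\<omega>. R k \<omega> * incr k \<omega>)" "expectation (\<lambda>\<omega>. R k \<omega> * incr k \<omega>) = 0"
    using expectation_past_mult[OF indep k(1) R_past[OF order_refl] IH(2), of "\<lambda>x. x"] incr_integrable[OF k(1)] incr_moments(1)[OF k(1)]
    by auto
  have i2: "integrable P (\<lambda>\<omega>. (incr k \<omega>)\<^sup>2)" by (rule incr_power_integrable[OF k(1)])
  let ?Q = "\<lambda>\<omega>. (R k \<omega>)\<^sup>2 - 2 * (R k \<omega> * incr k \<omega>) + (incr k \<omega>)\<^sup>2"
  have Q: "integrable P ?Q" using IH(1) c(1) i2 by auto
  have [measurable]: "R (Suc k) \<in> borel_measurable P" using R_rv Suc by auto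
  have le: "(R (Suc k) \<omega>)\<^sup>2 \<le> ?Q \<omega>" for \<omega>
  proof -
    have "?Q \<omega> = (R k \<omega> - incr k \<omega>)\<^sup>2" by (simp add: power2_diff)
    then show ?thesis unfolding R_Suc by (auto simp: max_def)
  qed
  have sq: "integrable P (\<lambda>\<omega>. (R (Suc k) \<omega>)\<^sup>2)"
    by (rule Bochner_Integration.integrable_bound[OF Q]) (use le in \<open>auto intro!: AE_I2 intro: order_trans[OF _ abs_ge_self]\<close>)
  have "integrable P (\<lambda>\<omega>. 1 + (R (Suc k) \<omega>)\<^sup>2)" using sq by simp
  then have int: "integrable P (R (Suc k))"
  proof (rule Bochner_Integration.integrable_bound)
    have "x \<le> 1 + x\<^sup>2" for x :: real using zero_le_power2[of "x - 1/2"] by (simp add: power2_eq_square algebra_simps)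
    then show "AE \<omega> in P. norm (R (Suc k) \<omega>) \<le> norm (1 + (R (Suc k) \<omega>)\<^sup>2)"
      using R_nonneg[of "Suc k"] by (auto intro!: AE_I2)
  qed simp
  have "expectation (\<lambda>\<omega>. (R (Suc k) \<omega>)\<^sup>2) \<le> expectation ?Q"
    by (rule integral_mono[OF sq Q le])
  also have "\<dots> \<le> 2 * (real (Suc k) * mesh)"
    using IH c i2 incr_moments(2)[OF k(1)] by (simp add: algebra_simps)
  finally show ?case using sq int by blast
qed

lemma R_mean: "expectation (R n) \<le> 1 + 2 * T"
proof -
  have sq: "integrable P (\<lambda>\<omega>. (R n \<omega>)\<^sup>2)" "integrable P (R n)" "expectation (\<lambda>\<omega>. (R n \<omega>)\<^sup>2) \<le> 2 * (real n * mesh)"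
    using R_square[of n] by auto
  have "x \<le> 1 + x\<^sup>2" for x :: real using zero_le_power2[of "x - 1/2"] by (simp add: power2_eq_square algebra_simps)
  then have "expectation (R n) \<le> expectation (\<lambda>\<omega>. 1 + (R n \<omega>)\<^sup>2)"
    using sq by (intro integral_mono) auto
  also have "\<dots> = 1 + expectation (\<lambda>\<omega>. (R n \<omega>)\<^sup>2)" using sq by (simp add: prob_space)
  also have "\<dots> \<le> 1 + 2 * T" using sq(3) n by (simp add: mesh_def)
  finally show ?thesis .
qed

text \<open>The time below \<open>a\<close> is of order \<open>a\<close>: each step taken below \<open>a\<close> raises the mean of \<open>huber a\<close> by at
  least \<open>mesh / 4\<close>, and the final mean is at most \<open>2 a\<close> times the mean of the final value.\<close>

lemma occupation_near_zero:
  assumes a: "0 < a" "12 * mesh \<le> a\<^sup>2"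
  shows "mesh * (\<Sum>k<n. prob {\<omega>\<in>space P. R k \<omega> \<le> a}) \<le> 8 * a * (1 + 2 * T)"
proof -
  have hi: "integrable P (\<lambda>\<omega>. huber a (R k \<omega>))" if "k \<le> n" for k
  proof (rule Bochner_Integration.integrable_bound)
    show "integrable P (\<lambda>\<omega>. 2 * a * R k \<omega>)" using R_square[OF that] by simp
    show "AE \<omega> in P. norm (huber a (R k \<omega>)) \<le> norm (2 * a * R k \<omega>)"
      using huber_bounds[OF a(1) R_nonneg[of k]] R_nonneg[of k] a by (auto intro!: AE_I2)
  qed (use fn_R_rv[OF huber_measurable(1) that] in auto)
  have step: "mesh / 4 * prob {\<omega>\<in>space P. R k \<omega> \<le> a} \<le> expectation (\<lambda>\<omega>. huber a (R (Suc k) \<omega>)) - expectation (\<lambda>\<omega>. huber a (R k \<omega>))"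
    if k: "k < n" for k
  proof -
    have kn: "k \<le> n" "Suc k \<le> n" using k by auto
    have hb: "integrable P (\<lambda>\<omega>. huber' a (R k \<omega>))"
      by (rule integrable_const_bound[where B="2 * a"]) (use huber_bounds(3)[OF a(1) order_refl] fn_R_rv[OF huber_measurable(2) kn(1)] in auto)
    have c: "integrable P (\<lambda>\<omega>. huber' a (R k \<omega>) * incr k \<omega>)" "expectation (\<lambda>\<omega>. huber' a (R k \<omega>) * incr k \<omega>) = 0"
      using expectation_past_mult[where g="\<lambda>x. x", OF indep k fn_R_past[OF huber_measurable(2) order_refl] hb measurable_ident_sets[OF HOL.refl] incr_integrable[OF k]]
      by (simp_all add: incr_moments(1)[OF k])
    let ?I = "\<lambda>\<omega>. indicator {..a} (R k \<omega>) :: real"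
    let ?J = "\<lambda>x. x\<^sup>2 * indicator {-a..0} x :: real"
    have Ii: "integrable P ?I"
      by (rule integrable_const_bound[where B=1]) (use fn_R_rv[of "indicator {..a}" k] kn in \<open>auto simp: indicator_def\<close>)
    have Ji: "integrable P (\<lambda>\<omega>. ?J (incr k \<omega>))"
    proof (rule Bochner_Integration.integrable_bound[OF incr_power_integrable[OF k, of 2]])
      show "(\<lambda>\<omega>. ?J (incr k \<omega>)) \<in> borel_measurable P"
        by (rule measurable_compose[OF incr_rv[OF k]]) measurable
    qed (auto simp: indicator_def)
    have IJ: "integrable P (\<lambda>\<omega>. ?I \<omega> * ?J (incr k \<omega>))"
       "expectation (\<lambda>\<omega>. ?I \<omega> * ?J (incr k \<omega>)) = expectation ?I * expectation (\<lambda>\<omega>. ?J (incr k \<omega>))"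
      by (rule expectation_past_mult[OF indep k _ Ii _ Ji]; use fn_R_past[of "indicator {..a}" k k] in measurable)+
    have EI: "expectation ?I = prob {\<omega>\<in>space P. R k \<omega> \<le> a}"
    proof -
      have "expectation ?I = expectation (indicator {\<omega>\<in>space P. R k \<omega> \<le> a})"
        by (intro Bochner_Integration.integral_cong) (auto simp: indicator_def)
      then show ?thesis by (simp add: Int_absorb2)
    qed
    have pt: "?I \<omega> * ?J (incr k \<omega>) / 2 \<le> huber a (R (Suc k) \<omega>) - huber a (R k \<omega>) + huber' a (R k \<omega>) * incr k \<omega>" for \<omega>
    proof -
      have e: "huber a (R (Suc k) \<omega>) = huber a (R k \<omega> - incr k \<omega>)" unfolding R_Suc huber_max ..
      show ?thesis
      proof (cases "R k \<omega> \<le> a \<and> - a \<le> incr k \<omega> \<and> incr k \<omega> \<le> 0")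
        case True
        then show ?thesis unfolding e using huber_quadratic[OF R_nonneg, of k \<omega> a "incr k \<omega>"] by simp
      next
        case False
        then have z: "?I \<omega> * ?J (incr k \<omega>) / 2 = 0" by (auto simp: indicator_def)
        show ?thesis unfolding z e using huber_tangent[OF a(1), of "R k \<omega>" "R k \<omega> - incr k \<omega>"] by simp
      qed
    qed
    have "mesh / 2 * prob {\<omega>\<in>space P. R k \<omega> \<le> a} \<le> expectation (\<lambda>\<omega>. ?J (incr k \<omega>)) * prob {\<omega>\<in>space P. R k \<omega> \<le> a}"
      using incr_truncated[OF k a] by (intro mult_right_mono) auto
    also have "\<dots> = 2 * expectation (\<lambda>\<omega>. ?I \<omega> * ?J (incr k \<omega>) / 2)" using IJ EI by simp
    also have "\<dots> \<le> 2 * expectation (\<lambda>\<omega>. huber a (R (Suc k) \<omega>) - huber a (R k \<omega>) + huber' a (R k \<omega>) * incr k \<omega>)"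
      using IJ(1) c(1) hi kn pt by (intro mult_left_mono integral_mono) auto
    also have "\<dots> = 2 * (expectation (\<lambda>\<omega>. huber a (R (Suc k) \<omega>)) - expectation (\<lambda>\<omega>. huber a (R k \<omega>)))"
      using c hi kn by simp
    finally show ?thesis by simp
  qed
  have "mesh / 4 * (\<Sum>k<n. prob {\<omega>\<in>space P. R k \<omega> \<le> a}) = (\<Sum>k<n. mesh / 4 * prob {\<omega>\<in>space P. R k \<omega> \<le> a})"
    by (rule sum_distrib_left)
  also have "\<dots> \<le> (\<Sum>k<n. expectation (\<lambda>\<omega>. huber a (R (Suc k) \<omega>)) - expectation (\<lambda>\<omega>. huber a (R k \<omega>)))"
    using step by (intro sum_mono) auto
  also have "\<dots> = expectation (\<lambda>\<omega>. huber a (R n \<omega>)) - expectation (\<lambda>\<omega>. huber a (R 0 \<omega>))"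
    by (rule sum_lessThan_telescope)
  also have "\<dots> = expectation (\<lambda>\<omega>. huber a (R n \<omega>))" by (simp add: R_def huber_def)
  also have "\<dots> \<le> expectation (\<lambda>\<omega>. 2 * a * R n \<omega>)"
    using hi[of n] R_square[of n] huber_bounds(2)[OF a(1) R_nonneg] by (intro integral_mono) auto
  also have "\<dots> \<le> 2 * a * (1 + 2 * T)" using R_mean a by simp
  finally show ?thesis by simp
qed

text \<open>Orthogonality of the increments of a martingale transform.\<close>

lemma martingale_square:
  fixes Q :: "nat \<Rightarrow> 'w \<Rightarrow> real" and g :: "real \<Rightarrow> real"
  assumes Q: "\<And>k. k < n \<Longrightarrow> Q k \<in> borel_measurable (past P incr k)" "\<And>k \<omega>. k < n \<Longrightarrow> \<bar>Q k \<omega>\<bar> \<le> B"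
    and g: "g \<in> borel_measurable borel" "\<And>k. k < n \<Longrightarrow> integrable P (\<lambda>\<omega>. g (incr k \<omega>))"
      "\<And>k. k < n \<Longrightarrow> integrable P (\<lambda>\<omega>. (g (incr k \<omega>))\<^sup>2)"
      "\<And>k. k < n \<Longrightarrow> expectation (\<lambda>\<omega>. g (incr k \<omega>)) = 0"
      "\<And>k. k < n \<Longrightarrow> expectation (\<lambda>\<omega>. (g (incr k \<omega>))\<^sup>2) = v"
    and m: "m \<le> n"
  shows "(\<lambda>\<omega>. \<Sum>k<m. Q k \<omega> * g (incr k \<omega>)) \<in> borel_measurable (past P incr m) \<and>
    integrable P (\<lambda>\<omega>. (\<Sum>k<m. Q k \<omega> * g (incr k \<omega>))\<^sup>2) \<and>
    expectation (\<lambda>\<omega>. (\<Sum>k<m. Q k \<omega> * g (incr k \<omega>))\<^sup>2) = v * (\<Sum>k<m. expectation (\<lambda>\<omega>. (Q k \<omega>)\<^sup>2))"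
  using m
proof (induction m)
  case (Suc m)
  then have k: "m < n" "m \<le> n" by auto
  let ?S = "\<lambda>\<omega>. \<Sum>k<m. Q k \<omega> * g (incr k \<omega>)"
  have IH: "?S \<in> borel_measurable (past P incr m)" "integrable P (\<lambda>\<omega>. (?S \<omega>)\<^sup>2)"
    "expectation (\<lambda>\<omega>. (?S \<omega>)\<^sup>2) = v * (\<Sum>k<m. expectation (\<lambda>\<omega>. (Q k \<omega>)\<^sup>2))"
    using Suc.IH[OF k(2)] by blast+
  have Sm: "?S \<in> borel_measurable P" by (rule past_measurable_rv[OF IH(1)]) (use incr_rv k in auto)
  have Qm: "Q m \<in> borel_measurable P" by (rule past_measurable_rv[OF Q(1)[OF k(1)]]) (use incr_rv k in auto)
  have Bpos: "0 \<le> B" using Q(2)[OF k(1)] abs_ge_zero order_trans by blast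
  have SQ: "integrable P (\<lambda>\<omega>. ?S \<omega> * Q m \<omega>)"
  proof (rule Bochner_Integration.integrable_bound)
    show "integrable P (\<lambda>\<omega>. B * (1 + (?S \<omega>)\<^sup>2))" using IH(2) by auto
    have "\<bar>x\<bar> \<le> 1 + x\<^sup>2" for x :: real
      using zero_le_power2[of "\<bar>x\<bar> - 1/2"] by (simp add: power2_eq_square algebra_simps)
    then have "\<bar>?S \<omega>\<bar> * \<bar>Q m \<omega>\<bar> \<le> (1 + (?S \<omega>)\<^sup>2) * B" for \<omega>
      using Q(2)[OF k(1)] by (intro mult_mono) auto
    then show "AE \<omega> in P. norm (?S \<omega> * Q m \<omega>) \<le> norm (B * (1 + (?S \<omega>)\<^sup>2))"
      using Bpos by (auto intro!: AE_I2 simp: abs_mult mult.commute)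
  qed (use Sm Qm in auto)
  have SQp: "(\<lambda>\<omega>. ?S \<omega> * Q m \<omega>) \<in> borel_measurable (past P incr m)" using IH(1) Q(1)[OF k(1)] by (rule borel_measurable_times)
  have QQ: "integrable P (\<lambda>\<omega>. (Q m \<omega>)\<^sup>2)"
  proof (rule integrable_const_bound[where B="B\<^sup>2"])
    show "AE \<omega> in P. norm ((Q m \<omega>)\<^sup>2) \<le> B\<^sup>2"
      using Q(2)[OF k(1)] Bpos by (auto intro!: AE_I2 simp: abs_le_square_iff[symmetric])
  qed (use Qm in auto)
  have QQp: "(\<lambda>\<omega>. (Q m \<omega>)\<^sup>2) \<in> borel_measurable (past P incr m)" using Q(1)[OF k(1)] by (rule borel_measurable_power)
  have g2: "(\<lambda>x. (g x)\<^sup>2) \<in> borel_measurable borel" using g(1) by (rule borel_measurable_power)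
  note c = expectation_past_mult[OF indep k(1) SQp SQ g(1) g(2)[OF k(1)]]
  note d = expectation_past_mult[OF indep k(1) QQp QQ g2 g(3)[OF k(1)]]
  have eq: "(\<Sum>k<Suc m. Q k \<omega> * g (incr k \<omega>))\<^sup>2 = (?S \<omega>)\<^sup>2 + 2 * (?S \<omega> * Q m \<omega> * g (incr m \<omega>)) + (Q m \<omega>)\<^sup>2 * (g (incr m \<omega>))\<^sup>2" for \<omega>
    by (simp add: power2_eq_square algebra_simps)
  have p: "(\<lambda>\<omega>. \<Sum>k<Suc m. Q k \<omega> * g (incr k \<omega>)) \<in> borel_measurable (past P incr (Suc m))"
  proof (rule borel_measurable_sum)
    fix k assume "k \<in> {..<Suc m}"
    then show "(\<lambda>\<omega>. Q k \<omega> * g (incr k \<omega>)) \<in> borel_measurable (past P incr (Suc m))"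
      using past_measurable_mono[OF Q(1), of k "Suc m"] measurable_compose[OF past_component g(1), of k "Suc m"] Suc
      by (intro borel_measurable_times) auto
  qed
  show ?case
  proof (intro conjI p)
    show "integrable P (\<lambda>\<omega>. (\<Sum>k<Suc m. Q k \<omega> * g (incr k \<omega>))\<^sup>2)" unfolding eq using IH(2) c(1) d(1) by auto
    have "expectation (\<lambda>\<omega>. (\<Sum>k<Suc m. Q k \<omega> * g (incr k \<omega>))\<^sup>2)
       = expectation (\<lambda>\<omega>. (?S \<omega>)\<^sup>2) + 2 * expectation (\<lambda>\<omega>. ?S \<omega> * Q m \<omega> * g (incr m \<omega>)) + expectation (\<lambda>\<omega>. (Q m \<omega>)\<^sup>2 * (g (incr m \<omega>))\<^sup>2)"
      unfolding eq using IH(2) c(1) d(1) by simp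
    also have "\<dots> = v * (\<Sum>k<Suc m. expectation (\<lambda>\<omega>. (Q k \<omega>)\<^sup>2))"
      using c(2) d(2) g(4,5)[OF k(1)] IH(3) by (simp add: algebra_simps)
    finally show "expectation (\<lambda>\<omega>. (\<Sum>k<Suc m. Q k \<omega> * g (incr k \<omega>))\<^sup>2) = v * (\<Sum>k<Suc m. expectation (\<lambda>\<omega>. (Q k \<omega>)\<^sup>2))" .
  qed
qed simp

end

section \<open>A discrete Tanaka formula\<close>

text \<open>A nonnegative bump on \<open>[0, b]\<close> is the second derivative of a function that is constant to the
  right of \<open>b\<close> and linear to the left of \<open>0\<close>, where its slope is minus the integral \<open>c\<close> of the bump.\<close>

lemma second_antiderivative:
  fixes \<phi> :: "real \<Rightarrow> real"
  assumes lip: "\<And>x y. \<bar>\<phi> x - \<phi> y\<bar> \<le> L * \<bar>x - y\<bar>" and pos: "\<And>x. 0 \<le> \<phi> x"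
    and supp: "\<And>x. x \<le> 0 \<Longrightarrow> \<phi> x = 0" "\<And>x. b \<le> x \<Longrightarrow> \<phi> x = 0" and b: "0 < b"
  obtains f f' c where
    "\<And>x. (f has_real_derivative f' x) (at x)" "\<And>x. (f' has_real_derivative \<phi> x) (at x)"
    "\<And>x. x \<le> 0 \<Longrightarrow> f x = - c * x" "\<And>x. x \<le> 0 \<Longrightarrow> f' x = - c" "\<And>x. b \<le> x \<Longrightarrow> f' x = 0"
    "0 \<le> c" "\<And>x. \<bar>f' x\<bar> \<le> c" "\<And>x. 0 \<le> x \<Longrightarrow> \<bar>f x\<bar> \<le> c * b"
proof -
  have cont: "isCont \<phi> x" for x
  proof -
    have "L-lipschitz_on UNIV \<phi>" unfolding lipschitz_on_def
    proof (intro conjI ballI)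
      show "0 \<le> L" using lip[of 0 1] abs_ge_zero[of "\<phi> 0 - \<phi> 1"] by simp
    qed (use lip in \<open>simp add: dist_real_def\<close>)
    then have "continuous_on UNIV \<phi>" by (rule lipschitz_on_continuous_on)
    then show ?thesis by (simp add: continuous_on_eq_continuous_at)
  qed
  obtain \<Phi> where \<Phi>: "\<And>x. (\<Phi> has_real_derivative \<phi> x) (at x)"
    using einterval_antiderivative[of "-\<infinity>" \<infinity> \<phi>] cont
    unfolding has_real_derivative_iff_has_vector_derivative by auto
  define f' where "f' = (\<lambda>x. \<Phi> x - \<Phi> b)"
  define c where "c = - f' 0"
  have f': "(f' has_real_derivative \<phi> x) (at x)" for x
    unfolding f'_def using DERIV_diff[OF \<Phi> DERIV_const[of "\<Phi> b"]] by simp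
  have mono: "f' x \<le> f' y" if "x \<le> y" for x y
    using that by (rule DERIV_nonneg_imp_nondecreasing) (use f' pos in blast)
  have const: "f' x = f' y" if "x \<le> y" "\<And>z. x \<le> z \<Longrightarrow> z \<le> y \<Longrightarrow> \<phi> z = 0" for x y
  proof -
    have "f' y \<le> f' x"
      using that(1)
    proof (rule DERIV_nonpos_imp_nonincreasing)
      fix z assume "x \<le> z" "z \<le> y"
      then show "\<exists>d. (f' has_real_derivative d) (at z) \<and> d \<le> 0" using f'[of z] that(2) by auto
    qed
    with mono[OF that(1)] show ?thesis by simp
  qed
  have fb: "f' x = 0" if "b \<le> x" for x
  proof -
    have "f' b = f' x" by (rule const[OF that]) (use supp in auto)
    moreover have "f' b = 0" by (simp add: f'_def)
    ultimately show ?thesis by simp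
  qed
  have f0: "f' x = - c" if "x \<le> 0" for x
  proof -
    have "f' x = f' 0" by (rule const[OF that]) (use supp in auto)
    then show ?thesis by (simp add: c_def)
  qed
  have bd: "- c \<le> f' x" "f' x \<le> 0" for x
  proof -
    show "- c \<le> f' x" using f0[of x] mono[of 0 x] by (cases "x \<le> 0") (auto simp: c_def)
    show "f' x \<le> 0" using fb[of x] mono[of x b] fb[of b] by (cases "b \<le> x") auto
  qed
  have c: "0 \<le> c" using bd[of 0] by linarith
  have "isCont f' x" for x using f' by (rule DERIV_isCont)
  then obtain F where F: "\<And>x. (F has_real_derivative f' x) (at x)"
    using einterval_antiderivative[of "-\<infinity>" \<infinity> f']
    unfolding has_real_derivative_iff_has_vector_derivative by auto
  define f where "f = (\<lambda>x. F x - F 0)"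
  have f: "(f has_real_derivative f' x) (at x)" for x
    unfolding f_def using DERIV_diff[OF F DERIV_const[of "F 0"]] by simp
  have lin: "f x = - c * x" if "x \<le> 0" for x
  proof (cases "x = 0")
    case False
    then have x: "x < 0" using that by simp
    obtain z where z: "x < z" "z < 0" "f 0 - f x = (0 - x) * f' z"
      using MVT2[OF x, of f f'] f by blast
    have "f 0 = 0" by (simp add: f_def)
    moreover have "f 0 - f x = (0 - x) * (- c)" using z f0[of z] by simp
    moreover have "(0 - x) * (- c) = c * x" by simp
    ultimately show ?thesis by linarith
  qed (simp add: f_def)
  have fbd: "\<bar>f x\<bar> \<le> c * b" if "0 \<le> x" for x
  proof -
    have part: "\<bar>f y\<bar> \<le> c * b" if y: "0 \<le> y" "y \<le> b" for y
    proof (cases "y = 0")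
      case False
      then obtain z where z: "0 < z" "z < y" "f y - f 0 = (y - 0) * f' z"
        using MVT2[of 0 y f f'] f y by force
      have "\<bar>f y\<bar> = y * \<bar>f' z\<bar>" using z y by (simp add: f_def abs_mult)
      also have "\<dots> \<le> b * c" using bd[of z] y c by (intro mult_mono) auto
      finally show ?thesis by (simp add: mult.commute)
    qed (use c b in \<open>simp add: f_def\<close>)
    show ?thesis
    proof (cases "x \<le> b")
      case False
      then have "b < x" by simp
      then obtain z where z: "b < z" "z < x" "f x - f b = (x - b) * f' z"
        using MVT2[of b x f f'] f by blast
      then have "f x = f b" using fb[of z] by simp
      then show ?thesis using part[of b] b by simp
    qed (use part that in auto)
  qed
  have "\<bar>f' x\<bar> \<le> c" for x using bd[of x] by auto
  from that[OF f f' lin f0 fb c this fbd] show ?thesis by blast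
qed

text \<open>The second derivative is only Lipschitz, so the remainder is bounded through its oscillation.\<close>

lemma second_order_taylor:
  fixes \<phi> :: "real \<Rightarrow> real"
  assumes f: "\<And>x. (f has_real_derivative f' x) (at x)" and f': "\<And>x. (f' has_real_derivative \<phi> x) (at x)"
    and lip: "\<And>x y. \<bar>\<phi> x - \<phi> y\<bar> \<le> L * \<bar>x - y\<bar>"
  shows "\<bar>f (x + u) - f x - f' x * u - \<phi> x * u\<^sup>2 / 2\<bar> \<le> L * \<bar>u\<bar> ^ 3"
proof -
  have L: "0 \<le> L" using lip[of 0 1] abs_ge_zero[of "\<phi> 0 - \<phi> 1"] by simp
  have gmvt: "\<exists>z. \<bar>z\<bar> \<le> \<bar>v\<bar> \<and> h v - h 0 = v * h' z"
    if h: "\<And>w. (h has_real_derivative h' w) (at w)" for h h' :: "real \<Rightarrow> real" and v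
  proof -
    consider "v = 0" | "0 < v" | "v < 0" by linarith
    then show ?thesis
    proof cases
      case 2
      then obtain z where "0 < z" "z < v" "h v - h 0 = (v - 0) * h' z" using MVT2[of 0 v h h'] h by blast
      then show ?thesis by (intro exI[of _ z]) auto
    next
      case 3
      then obtain z where "v < z" "z < 0" "h 0 - h v = (0 - v) * h' z" using MVT2[of v 0 h h'] h by blast
      then show ?thesis by (intro exI[of _ z]) auto
    qed auto
  qed
  have d1: "((\<lambda>u. f' (x + u) - f' x - \<phi> x * u) has_real_derivative (\<phi> (x + w) - \<phi> x)) (at w)" for w
  proof -
    have "((\<lambda>u. f' (x + u)) has_real_derivative \<phi> (x + w)) (at w)"
      using DERIV_shift[of f' "\<phi> (x + w)" w x] f'[of "x + w"] by (simp add: add.commute)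
    then show ?thesis by (auto intro!: derivative_eq_intros)
  qed
  have d0: "((\<lambda>u. f (x + u) - f x - f' x * u - \<phi> x * u\<^sup>2 / 2) has_real_derivative (f' (x + w) - f' x - \<phi> x * w)) (at w)" for w
  proof -
    have "((\<lambda>u. f (x + u)) has_real_derivative f' (x + w)) (at w)"
      using DERIV_shift[of f "f' (x + w)" w x] f[of "x + w"] by (simp add: add.commute)
    then show ?thesis by (auto intro!: derivative_eq_intros)
  qed
  have b1: "\<bar>f' (x + w) - f' x - \<phi> x * w\<bar> \<le> \<bar>w\<bar> * (L * \<bar>w\<bar>)" for w
  proof -
    obtain z where z: "\<bar>z\<bar> \<le> \<bar>w\<bar>" "f' (x + w) - f' x - \<phi> x * w = w * (\<phi> (x + z) - \<phi> x)"
      using gmvt[OF d1, of w] by auto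
    have "\<bar>\<phi> (x + z) - \<phi> x\<bar> \<le> L * \<bar>z\<bar>" using lip[of "x + z" x] by simp
    also have "\<dots> \<le> L * \<bar>w\<bar>" using z L by (intro mult_left_mono) auto
    finally show ?thesis unfolding z(2) abs_mult by (intro mult_left_mono) auto
  qed
  obtain z where z: "\<bar>z\<bar> \<le> \<bar>u\<bar>" "f (x + u) - f x - f' x * u - \<phi> x * u\<^sup>2 / 2 = u * (f' (x + z) - f' x - \<phi> x * z)"
    using gmvt[OF d0, of u] by auto
  have "\<bar>f' (x + z) - f' x - \<phi> x * z\<bar> \<le> \<bar>z\<bar> * (L * \<bar>z\<bar>)" by (rule b1)
  also have "\<dots> \<le> \<bar>u\<bar> * (L * \<bar>u\<bar>)" using z L by (intro mult_mono) auto
  finally have "\<bar>u\<bar> * \<bar>f' (x + z) - f' x - \<phi> x * z\<bar> \<le> \<bar>u\<bar> * (\<bar>u\<bar> * (L * \<bar>u\<bar>))" by (intro mult_left_mono) auto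
  then show ?thesis unfolding z(2) abs_mult by (simp add: power3_eq_cube mult_ac)
qed

text \<open>Turns second-moment bounds into first-moment bounds; \<open>\<kappa>\<close> is chosen later to balance the terms.\<close>

lemma abs_le_square_div:
  fixes x :: real assumes "0 < \<kappa>" shows "\<bar>x\<bar> \<le> \<kappa> + x\<^sup>2 / \<kappa>"
proof -
  have "0 \<le> (\<bar>x\<bar> - \<kappa> / 2)\<^sup>2 + 3/4 * \<kappa>\<^sup>2" by simp
  also have "\<dots> = x\<^sup>2 + \<kappa>\<^sup>2 - \<kappa> * \<bar>x\<bar>" by (simp add: power2_eq_square algebra_simps)
  finally have "\<kappa> * \<bar>x\<bar> \<le> \<kappa> * (\<kappa> + x\<^sup>2 / \<kappa>)" using assms by (simp add: power2_eq_square algebra_simps)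
  then show ?thesis using assms by (simp add: mult_le_cancel_left_pos)
qed

context reflected_walk
begin

text \<open>The discrete occupation integral of \<open>\<phi>\<close> approximates \<open>c\<close> times the running maximum if \<open>c\<close> is the
  integral of \<open>\<phi>\<close>.\<close>

definition deviation where
  "deviation c \<phi> \<omega> = c * (R n \<omega> + (\<Sum>k<n. incr k \<omega>)) - mesh * (\<Sum>k<n. \<phi> (R k \<omega>))"

text \<open>Summing the Taylor expansion of \<open>f\<close> along the walk leaves the boundary value \<open>f (R n)\<close>, the
  martingale with integrand \<open>f'\<close>, the fluctuation of the squared increments around \<open>2 * mesh\<close>,
  and a cubic remainder.  The last two vanish with the mesh.  The martingale is small because \<open>f'\<close>
  vanishes outside a neighbourhood of \<open>0\<close> in which the walk spends a time of order \<open>b\<close>.\<close>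

lemma deviation_L1:
  fixes \<phi> :: "real \<Rightarrow> real"
  assumes f: "\<And>x. (f has_real_derivative f' x) (at x)" and f': "\<And>x. (f' has_real_derivative \<phi> x) (at x)"
    and lin: "\<And>x. x \<le> 0 \<Longrightarrow> f x = - c * x" and fb: "\<And>x. b \<le> x \<Longrightarrow> f' x = 0" and c: "0 \<le> c"
    and bd: "\<And>x. \<bar>f' x\<bar> \<le> c" "\<And>x. 0 \<le> x \<Longrightarrow> \<bar>f x\<bar> \<le> c * b"
    and lip: "\<And>x y. \<bar>\<phi> x - \<phi> y\<bar> \<le> L * \<bar>x - y\<bar>" and K: "\<And>x. 0 \<le> \<phi> x" "\<And>x. \<phi> x \<le> K"
    and b: "0 < b" "12 * mesh \<le> b\<^sup>2" and \<kappa>: "0 < \<kappa>"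
  shows "deviation c \<phi> \<in> borel_measurable P"
    and "(\<integral>\<^sup>+\<omega>. ennreal \<bar>deviation c \<phi> \<omega>\<bar> \<partial>P)
      \<le> ennreal (c * b + 2 * \<kappa> + 16 * c\<^sup>2 * b * (1 + 2 * T) / \<kappa> + 2 * K\<^sup>2 * T * mesh / \<kappa> + 6 * L * T * sqrt mesh)"
proof -
  have L: "0 \<le> L" using lip[of 0 1] abs_ge_zero[of "\<phi> 0 - \<phi> 1"] by simp
  have f'm: "f' \<in> borel_measurable borel"
    by (intro borel_measurable_continuous_onI continuous_at_imp_continuous_on ballI DERIV_isCont) (rule f')
  have \<phi>m: "\<phi> \<in> borel_measurable borel"
  proof -
    have "L-lipschitz_on UNIV \<phi>" unfolding lipschitz_on_def using L lip by (auto simp: dist_real_def)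
    then show ?thesis by (intro borel_measurable_continuous_onI lipschitz_on_continuous_on)
  qed
  define S1 where "S1 = (\<lambda>\<omega>. \<Sum>k<n. f' (R k \<omega>) * incr k \<omega>)"
  define S2 where "S2 = (\<lambda>\<omega>. \<Sum>k<n. \<phi> (R k \<omega>) / 2 * ((incr k \<omega>)\<^sup>2 - 2 * mesh))"
  have Vm: "deviation c \<phi> \<in> borel_measurable P"
    unfolding deviation_def[abs_def]
    by (intro borel_measurable_diff borel_measurable_times borel_measurable_add borel_measurable_sum borel_measurable_const
          R_rv incr_rv fn_R_rv \<phi>m) auto
  then show "deviation c \<phi> \<in> borel_measurable P" .
  have i1: "integrable P (\<lambda>\<omega>. (S1 \<omega>)\<^sup>2)" and e1: "expectation (\<lambda>\<omega>. (S1 \<omega>)\<^sup>2) = 2 * mesh * (\<Sum>k<n. expectation (\<lambda>\<omega>. (f' (R k \<omega>))\<^sup>2))"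
    using martingale_square[where Q="\<lambda>k \<omega>. f' (R k \<omega>)" and g="\<lambda>x. x" and B=c and v="2 * mesh" and m=n,
        OF fn_R_past[OF f'm order_refl] bd(1) measurable_ident_sets[OF HOL.refl] incr_integrable incr_power_integrable
          incr_moments(1) incr_moments(2) order_refl]
    unfolding S1_def by blast+
  have e1': "expectation (\<lambda>\<omega>. (S1 \<omega>)\<^sup>2) \<le> 16 * c\<^sup>2 * b * (1 + 2 * T)"
  proof -
    have "expectation (\<lambda>\<omega>. (f' (R k \<omega>))\<^sup>2) \<le> c\<^sup>2 * prob {\<omega>\<in>space P. R k \<omega> \<le> b}" if k: "k < n" for k
    proof -
      have [measurable]: "R k \<in> borel_measurable P" using R_rv k by simp
      have "expectation (\<lambda>\<omega>. (f' (R k \<omega>))\<^sup>2) \<le> expectation (\<lambda>\<omega>. c\<^sup>2 * indicator {\<omega>\<in>space P. R k \<omega> \<le> b} \<omega>)"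
      proof (rule integral_mono')
        have "{\<omega>\<in>space P. R k \<omega> \<le> b} \<in> events" by measurable
        then show "integrable P (\<lambda>\<omega>. c\<^sup>2 * indicator {\<omega>\<in>space P. R k \<omega> \<le> b} \<omega>)"
          by (intro integrable_mult_right integrable_real_indicator) (auto simp: emeasure_eq_measure)
      next
        fix \<omega> assume "\<omega> \<in> space P"
        have "(f' (R k \<omega>))\<^sup>2 \<le> c\<^sup>2" using bd(1)[of "R k \<omega>"] c by (simp add: abs_le_square_iff[symmetric])
        then show "(f' (R k \<omega>))\<^sup>2 \<le> c\<^sup>2 * indicator {\<omega>\<in>space P. R k \<omega> \<le> b} \<omega>"
          using fb[of "R k \<omega>"] \<open>\<omega> \<in> space P\<close> by (auto simp: indicator_def)
      qed auto
      then show ?thesis by (simp add: Int_absorb2)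
    qed
    then have "(\<Sum>k<n. expectation (\<lambda>\<omega>. (f' (R k \<omega>))\<^sup>2)) \<le> (\<Sum>k<n. c\<^sup>2 * prob {\<omega>\<in>space P. R k \<omega> \<le> b})"
      by (intro sum_mono) auto
    then have "2 * mesh * (\<Sum>k<n. expectation (\<lambda>\<omega>. (f' (R k \<omega>))\<^sup>2)) \<le> 2 * mesh * (\<Sum>k<n. c\<^sup>2 * prob {\<omega>\<in>space P. R k \<omega> \<le> b})"
      using mesh_pos by (intro mult_left_mono) auto
    also have "\<dots> = 2 * c\<^sup>2 * (mesh * (\<Sum>k<n. prob {\<omega>\<in>space P. R k \<omega> \<le> b}))" by (simp add: sum_distrib_left mult_ac)
    also have "\<dots> \<le> 2 * c\<^sup>2 * (8 * b * (1 + 2 * T))" by (intro mult_left_mono occupation_near_zero b) auto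
    also have "2 * c\<^sup>2 * (8 * b * (1 + 2 * T)) = 16 * c\<^sup>2 * b * (1 + 2 * T)" by simp
    finally show ?thesis unfolding e1 .
  qed
  have gm: "integrable P (\<lambda>\<omega>. (incr k \<omega>)\<^sup>2 - 2 * mesh)" "integrable P (\<lambda>\<omega>. ((incr k \<omega>)\<^sup>2 - 2 * mesh)\<^sup>2)"
    "expectation (\<lambda>\<omega>. (incr k \<omega>)\<^sup>2 - 2 * mesh) = 0" "expectation (\<lambda>\<omega>. ((incr k \<omega>)\<^sup>2 - 2 * mesh)\<^sup>2) = 8 * mesh\<^sup>2" if k: "k < n" for k
  proof -
    have eq: "((incr k \<omega>)\<^sup>2 - 2 * mesh)\<^sup>2 = incr k \<omega> ^ 4 - 4 * mesh * (incr k \<omega>)\<^sup>2 + 4 * mesh\<^sup>2" for \<omega>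
      by (simp add: power2_eq_square algebra_simps power4_eq_xxxx)
    have i: "integrable P (\<lambda>\<omega>. (incr k \<omega>)\<^sup>2)" "integrable P (\<lambda>\<omega>. incr k \<omega> ^ 4)" by (rule incr_power_integrable[OF k])+
    show "integrable P (\<lambda>\<omega>. (incr k \<omega>)\<^sup>2 - 2 * mesh)" "integrable P (\<lambda>\<omega>. ((incr k \<omega>)\<^sup>2 - 2 * mesh)\<^sup>2)"
      unfolding eq using i by auto
    show "expectation (\<lambda>\<omega>. (incr k \<omega>)\<^sup>2 - 2 * mesh) = 0" using i incr_moments(2)[OF k] by (simp add: prob_space)
    show "expectation (\<lambda>\<omega>. ((incr k \<omega>)\<^sup>2 - 2 * mesh)\<^sup>2) = 8 * mesh\<^sup>2"
      unfolding eq using i incr_moments(2,3)[OF k] by (simp add: prob_space power2_eq_square)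
  qed
  have Q2: "\<bar>\<phi> (R k \<omega>) / 2\<bar> \<le> K / 2" for k \<omega> using K[of "R k \<omega>"] by simp
  have Q2m: "(\<lambda>\<omega>. \<phi> (R k \<omega>) / 2) \<in> borel_measurable (past P incr k)" for k
    by (intro borel_measurable_divide fn_R_past[OF \<phi>m] borel_measurable_const) simp
  have g2m: "(\<lambda>x::real. x\<^sup>2 - 2 * mesh) \<in> borel_measurable borel" by measurable
  have i2: "integrable P (\<lambda>\<omega>. (S2 \<omega>)\<^sup>2)" and e2: "expectation (\<lambda>\<omega>. (S2 \<omega>)\<^sup>2) = 8 * mesh\<^sup>2 * (\<Sum>k<n. expectation (\<lambda>\<omega>. (\<phi> (R k \<omega>) / 2)\<^sup>2))"
    using martingale_square[where Q="\<lambda>k \<omega>. \<phi> (R k \<omega>) / 2" and g="\<lambda>x. x\<^sup>2 - 2 * mesh", OF Q2m Q2 g2m gm order_refl]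
    unfolding S2_def by blast+
  have e2': "expectation (\<lambda>\<omega>. (S2 \<omega>)\<^sup>2) \<le> 2 * K\<^sup>2 * T * mesh"
  proof -
    have "expectation (\<lambda>\<omega>. (\<phi> (R k \<omega>) / 2)\<^sup>2) \<le> (K / 2)\<^sup>2" for k
    proof -
      have "expectation (\<lambda>\<omega>. (\<phi> (R k \<omega>) / 2)\<^sup>2) \<le> expectation (\<lambda>\<omega>. (K / 2)\<^sup>2)"
      proof (rule integral_mono')
        show "(\<phi> (R k \<omega>) / 2)\<^sup>2 \<le> (K / 2)\<^sup>2" for \<omega>
          using K[of "R k \<omega>"] by (intro power_mono divide_right_mono) auto
      qed auto
      then show ?thesis by (simp add: prob_space)
    qed
    then have "(\<Sum>k<n. expectation (\<lambda>\<omega>. (\<phi> (R k \<omega>) / 2)\<^sup>2)) \<le> (\<Sum>k<n. (K / 2)\<^sup>2)" by (intro sum_mono)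
    then have "8 * mesh\<^sup>2 * (\<Sum>k<n. expectation (\<lambda>\<omega>. (\<phi> (R k \<omega>) / 2)\<^sup>2)) \<le> 8 * mesh\<^sup>2 * (\<Sum>k<n. (K / 2)\<^sup>2)"
      by (intro mult_left_mono) auto
    also have "\<dots> = 2 * K\<^sup>2 * (real n * mesh) * mesh" by (simp add: power2_eq_square)
    also have "real n * mesh = T" using n by (simp add: mesh_def)
    finally show ?thesis unfolding e2 .
  qed
  define W where "W = (\<lambda>\<omega>. c * b + (\<kappa> + (S1 \<omega>)\<^sup>2 / \<kappa>) + (\<kappa> + (S2 \<omega>)\<^sup>2 / \<kappa>) + (\<Sum>k<n. L * \<bar>incr k \<omega>\<bar> ^ 3))"
  have Wi: "integrable P W" unfolding W_def
    by (intro Bochner_Integration.integrable_add Bochner_Integration.integrable_sum Bochner_Integration.integrable_divide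
          integrable_mult_right integrable_const i1 i2 incr_abs_cube_integrable) auto
  have VW: "\<bar>deviation c \<phi> \<omega>\<bar> \<le> W \<omega>" for \<omega>
  proof -
    define err where "err = (\<lambda>k. f (R k \<omega> + - incr k \<omega>) - f (R k \<omega>) - f' (R k \<omega>) * (- incr k \<omega>) - \<phi> (R k \<omega>) * (- incr k \<omega>)\<^sup>2 / 2)"
    have err: "\<bar>err k\<bar> \<le> L * \<bar>incr k \<omega>\<bar> ^ 3" for k
      using second_order_taylor[OF f f' lip, of "R k \<omega>" "- incr k \<omega>"] unfolding err_def by simp
    have "c * (R n \<omega> + (\<Sum>k<n. incr k \<omega>)) + f (R n \<omega>) = (\<Sum>k<n. f (R k \<omega> - incr k \<omega>) - f (R k \<omega>))"
      unfolding R_def by (rule reflect_discrete_ito[OF lin])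
    also have "\<dots> = (\<Sum>k<n. err k - f' (R k \<omega>) * incr k \<omega> + \<phi> (R k \<omega>) / 2 * ((incr k \<omega>)\<^sup>2 - 2 * mesh) + mesh * \<phi> (R k \<omega>))"
      unfolding err_def by (intro sum.cong refl) (simp add: algebra_simps)
    also have "\<dots> = (\<Sum>k<n. err k) - S1 \<omega> + S2 \<omega> + mesh * (\<Sum>k<n. \<phi> (R k \<omega>))"
      unfolding S1_def S2_def by (simp add: sum.distrib sum_subtractf sum_distrib_left)
    finally have "deviation c \<phi> \<omega> = (\<Sum>k<n. err k) - S1 \<omega> + S2 \<omega> - f (R n \<omega>)"
      unfolding deviation_def by simp
    moreover have "\<bar>\<Sum>k<n. err k\<bar> \<le> (\<Sum>k<n. L * \<bar>incr k \<omega>\<bar> ^ 3)"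
      by (rule order_trans[OF sum_abs sum_mono]) (rule err)
    ultimately show ?thesis unfolding W_def
      using abs_le_square_div[OF \<kappa>, of "S1 \<omega>"] abs_le_square_div[OF \<kappa>, of "S2 \<omega>"] bd(2)[OF R_nonneg, of n \<omega>] by linarith
  qed
  have "(\<integral>\<^sup>+\<omega>. ennreal \<bar>deviation c \<phi> \<omega>\<bar> \<partial>P) \<le> (\<integral>\<^sup>+\<omega>. ennreal (W \<omega>) \<partial>P)"
    by (intro nn_integral_mono ennreal_leI VW)
  also have "\<dots> = ennreal (expectation W)"
    by (rule nn_integral_eq_integral[OF Wi]) (use VW abs_ge_zero order_trans in blast)
  also have "\<dots> \<le> ennreal (c * b + 2 * \<kappa> + 16 * c\<^sup>2 * b * (1 + 2 * T) / \<kappa> + 2 * K\<^sup>2 * T * mesh / \<kappa> + 6 * L * T * sqrt mesh)"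
  proof (rule ennreal_leI)
    have ci: "integrable P (\<lambda>\<omega>. L * \<bar>incr k \<omega>\<bar> ^ 3)" if "k < n" for k using incr_abs_cube_integrable[OF that] by simp
    have "expectation W = c * b + (\<kappa> + expectation (\<lambda>\<omega>. (S1 \<omega>)\<^sup>2) / \<kappa>) + (\<kappa> + expectation (\<lambda>\<omega>. (S2 \<omega>)\<^sup>2) / \<kappa>)
       + (\<Sum>k<n. L * expectation (\<lambda>\<omega>. \<bar>incr k \<omega>\<bar> ^ 3))"
    proof -
      have j1: "integrable P (\<lambda>\<omega>. (S1 \<omega>)\<^sup>2 / \<kappa>)" "integrable P (\<lambda>\<omega>. (S2 \<omega>)\<^sup>2 / \<kappa>)"
        using i1 i2 by auto
      have j3: "integrable P (\<lambda>\<omega>. \<Sum>k<n. L * \<bar>incr k \<omega>\<bar> ^ 3)"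
        using ci by (intro Bochner_Integration.integrable_sum) auto
      have "expectation (\<lambda>\<omega>. \<Sum>k<n. L * \<bar>incr k \<omega>\<bar> ^ 3) = (\<Sum>k<n. expectation (\<lambda>\<omega>. L * \<bar>incr k \<omega>\<bar> ^ 3))"
        using ci by (intro Bochner_Integration.integral_sum) auto
      then have e3: "expectation (\<lambda>\<omega>. \<Sum>k<n. L * \<bar>incr k \<omega>\<bar> ^ 3) = (\<Sum>k<n. L * expectation (\<lambda>\<omega>. \<bar>incr k \<omega>\<bar> ^ 3))"
        by simp
      have c1: "integrable P (\<lambda>\<omega>. \<kappa> + (S1 \<omega>)\<^sup>2 / \<kappa>)" "integrable P (\<lambda>\<omega>. \<kappa> + (S2 \<omega>)\<^sup>2 / \<kappa>)" using j1 by auto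
      have "expectation W = expectation (\<lambda>\<omega>. c * b + (\<kappa> + (S1 \<omega>)\<^sup>2 / \<kappa>) + (\<kappa> + (S2 \<omega>)\<^sup>2 / \<kappa>)) + expectation (\<lambda>\<omega>. \<Sum>k<n. L * \<bar>incr k \<omega>\<bar> ^ 3)"
        unfolding W_def by (intro Bochner_Integration.integral_add j3 Bochner_Integration.integrable_add c1 integrable_const)
      also have "expectation (\<lambda>\<omega>. c * b + (\<kappa> + (S1 \<omega>)\<^sup>2 / \<kappa>) + (\<kappa> + (S2 \<omega>)\<^sup>2 / \<kappa>))
          = expectation (\<lambda>\<omega>. c * b + (\<kappa> + (S1 \<omega>)\<^sup>2 / \<kappa>)) + expectation (\<lambda>\<omega>. \<kappa> + (S2 \<omega>)\<^sup>2 / \<kappa>)"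
        by (intro Bochner_Integration.integral_add Bochner_Integration.integrable_add c1 integrable_const)
      also have "expectation (\<lambda>\<omega>. c * b + (\<kappa> + (S1 \<omega>)\<^sup>2 / \<kappa>)) = c * b + (\<kappa> + expectation (\<lambda>\<omega>. (S1 \<omega>)\<^sup>2) / \<kappa>)"
        using c1 j1 by (simp add: prob_space)
      also have "expectation (\<lambda>\<omega>. \<kappa> + (S2 \<omega>)\<^sup>2 / \<kappa>) = \<kappa> + expectation (\<lambda>\<omega>. (S2 \<omega>)\<^sup>2) / \<kappa>"
        using j1 by (simp add: prob_space)
      finally show ?thesis unfolding e3 .
    qed
    moreover have "(\<Sum>k<n. L * expectation (\<lambda>\<omega>. \<bar>incr k \<omega>\<bar> ^ 3)) \<le> (\<Sum>k<n. L * (6 * (mesh * sqrt mesh)))"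
      using incr_moments(4) L by (intro sum_mono mult_left_mono) auto
    moreover have "(\<Sum>k<n. L * (6 * (mesh * sqrt mesh))) = 6 * L * T * sqrt mesh"
    proof -
      have "(\<Sum>k<n. L * (6 * (mesh * sqrt mesh))) = 6 * L * (real n * mesh) * sqrt mesh" by simp
      also have "real n * mesh = T" using n by (simp add: mesh_def)
      finally show ?thesis .
    qed
    moreover have "expectation (\<lambda>\<omega>. (S1 \<omega>)\<^sup>2) / \<kappa> \<le> 16 * c\<^sup>2 * b * (1 + 2 * T) / \<kappa>"
      using e1' \<kappa> by (intro divide_right_mono) auto
    moreover have "expectation (\<lambda>\<omega>. (S2 \<omega>)\<^sup>2) / \<kappa> \<le> 2 * K\<^sup>2 * T * mesh / \<kappa>"
      using e2' \<kappa> by (intro divide_right_mono) auto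
    ultimately show "expectation W \<le> c * b + 2 * \<kappa> + 16 * c\<^sup>2 * b * (1 + 2 * T) / \<kappa> + 2 * K\<^sup>2 * T * mesh / \<kappa> + 6 * L * T * sqrt mesh"
      by linarith
  qed
  finally show "(\<integral>\<^sup>+\<omega>. ennreal \<bar>deviation c \<phi> \<omega>\<bar> \<partial>P)
      \<le> ennreal (c * b + 2 * \<kappa> + 16 * c\<^sup>2 * b * (1 + 2 * T) / \<kappa> + 2 * K\<^sup>2 * T * mesh / \<kappa> + 6 * L * T * sqrt mesh)" .
qed

end

section \<open>Discretising the height of a continuous path\<close>

text \<open>The sign makes minima of \<open>x\<close> on \<open>[s, t]\<close> into maxima of the walk, whose time runs backwards
  from \<open>t\<close>.\<close>

definition backward_walk :: "(real \<Rightarrow> real) \<Rightarrow> real \<Rightarrow> nat \<Rightarrow> nat \<Rightarrow> real" where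
  "backward_walk x t n k = - x (t - t * real k / real n)"

definition discrete_height :: "(real \<Rightarrow> real) \<Rightarrow> real \<Rightarrow> nat \<Rightarrow> nat \<Rightarrow> real" where
  "discrete_height x t n k = reflect (\<lambda>k. backward_walk x t n (Suc k) - backward_walk x t n k) k"

lemma discrete_height_Max:
  "discrete_height x t n k = Max (backward_walk x t n ` {..k}) - backward_walk x t n k"
  unfolding discrete_height_def by (rule reflect_eq_Max)

definition height_at :: "(real \<Rightarrow> real) \<Rightarrow> real \<Rightarrow> real \<Rightarrow> real" where
  "height_at x t s = x s - low x s t"

context
  fixes x :: "real \<Rightarrow> real" and t :: real
  assumes cont: "continuous_on {0..} x" and t: "0 < t"
begin

text \<open>The index of the backward grid time just after \<open>s\<close>.\<close>

definition cell :: "nat \<Rightarrow> real \<Rightarrow> nat" where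
  "cell n s = nat \<lfloor>(t - s) * real n / t\<rfloor>"

lemma cell_bounds:
  assumes "s \<le> t" "0 < n"
  shows "s \<le> t - t * real (cell n s) / n" "t - t * real (cell n s) / n < s + t / n"
proof -
  have "0 \<le> (t - s) * real n / t" using assms t by simp
  then have "real (cell n s) = of_int \<lfloor>(t - s) * real n / t\<rfloor>" by (simp add: cell_def)
  then have "real (cell n s) \<le> (t - s) * real n / t" "(t - s) * real n / t < real (cell n s) + 1" by linarith+
  then have a: "t * real (cell n s) \<le> (t - s) * real n" "(t - s) * real n < t * real (cell n s) + t"
    using t by (simp_all add: pos_le_divide_eq pos_divide_less_eq algebra_simps)
  then have "t * real (cell n s) / n \<le> t - s" "t - s < (t * real (cell n s) + t) / n"
    using assms(2) by (simp_all add: pos_divide_le_eq pos_less_divide_eq)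
  then show "s \<le> t - t * real (cell n s) / n" "t - t * real (cell n s) / n < s + t / n"
    by (simp_all add: add_divide_distrib)
qed

lemma cell_unique:
  assumes "s \<le> t" "0 < n" "t - t * real (Suc k) / n < s" "s \<le> t - t * real k / n"
  shows "cell n s = k"
proof -
  have "t * real k / n \<le> t - s" "t - s < t * real (Suc k) / n" using assms by auto
  then have "t * real k \<le> (t - s) * n" "(t - s) * n < t * real (Suc k)"
    using assms(2) by (simp_all add: pos_divide_le_eq pos_less_divide_eq)
  then have "real k \<le> (t - s) * n / t" "(t - s) * n / t < real k + 1"
    using t by (simp_all add: pos_le_divide_eq pos_divide_less_eq algebra_simps)
  then have "\<lfloor>(t - s) * n / t\<rfloor> = int k" by (intro floor_unique) auto
  then show ?thesis by (simp add: cell_def)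
qed

lemma cell_tendsto:
  assumes "s \<le> t"
  shows "(\<lambda>n. t - t * real (cell n s) / n) \<longlonglongrightarrow> s"
proof (rule tendsto_sandwich)
  show "eventually (\<lambda>n. s \<le> t - t * real (cell n s) / n) sequentially"
    using cell_bounds(1)[OF assms] by (auto simp: eventually_sequentially intro!: exI[of _ 1])
  show "eventually (\<lambda>n. t - t * real (cell n s) / n \<le> s + t / n) sequentially"
    using cell_bounds(2)[OF assms] by (auto simp: eventually_sequentially less_imp_le intro!: exI[of _ 1])
  have "(\<lambda>n. s + t / real n) \<longlonglongrightarrow> s + 0" by (intro tendsto_intros lim_const_over_n)
  then show "(\<lambda>n. s + t / real n) \<longlonglongrightarrow> s" by simp
qed simp

lemma backward_walk_tendsto:
  assumes "0 \<le> s" "s \<le> t"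
  shows "(\<lambda>n. backward_walk x t n (cell n s)) \<longlonglongrightarrow> - x s"
  unfolding backward_walk_def
proof (rule tendsto_minus, rule continuous_on_tendsto_compose[OF cont cell_tendsto[OF assms(2)]])
  show "eventually (\<lambda>n. t - t * real (cell n s) / real n \<in> {0..}) sequentially"
  proof -
    have "t - t * real (cell n s) / real n \<in> {0..}" if "0 < n" for n
      using cell_bounds(1)[OF assms(2) that] assms(1) by simp
    then show ?thesis by (auto simp: eventually_sequentially intro!: exI[of _ 1])
  qed
qed (use assms in auto)

text \<open>Minima of a continuous path over the points of a grid converge to the minimum over the interval.\<close>

lemma discrete_height_tendsto:
  assumes s: "0 \<le> s" "s \<le> t"
  shows "(\<lambda>n. discrete_height x t n (cell n s)) \<longlonglongrightarrow> height_at x t s"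
proof -
  have mm: "{min s t..max s t} = {s..t}" using s by auto
  obtain m where m: "m \<in> {s..t}" "low x s t = x m" "\<And>q. q \<in> {s..t} \<Longrightarrow> x m \<le> x q"
    using low_attained[OF cont s(1), of t] t unfolding mm by auto
  have "(\<lambda>n. Max (backward_walk x t n ` {..cell n s})) \<longlonglongrightarrow> - x m"
  proof (rule tendsto_sandwich)
    show "(\<lambda>n. backward_walk x t n (cell n m)) \<longlonglongrightarrow> - x m"
      by (rule backward_walk_tendsto) (use m s in auto)
    have "cell n m \<le> cell n s" for n unfolding cell_def
      using m t by (intro nat_mono floor_mono divide_right_mono mult_right_mono) auto
    then have "backward_walk x t n (cell n m) \<le> Max (backward_walk x t n ` {..cell n s})" for n
      by (intro Max_ge) auto
    then show "eventually (\<lambda>n. backward_walk x t n (cell n m) \<le> Max (backward_walk x t n ` {..cell n s})) sequentially"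
      by simp
    have "Max (backward_walk x t n ` {..cell n s}) \<le> - x m" if n: "0 < n" for n
    proof (rule Max.boundedI)
      fix a assume "a \<in> backward_walk x t n ` {..cell n s}"
      then obtain k where k: "a = - x (t - t * real k / real n)" "k \<le> cell n s" by (auto simp: backward_walk_def)
      have "t * real k / real n \<le> t * real (cell n s) / real n"
        using k t by (intro divide_right_mono mult_left_mono) auto
      then have "t - t * real k / real n \<in> {s..t}" using cell_bounds(1)[OF s(2) n] t by auto
      from m(3)[OF this] show "a \<le> - x m" unfolding k(1) by simp
    qed auto
    then show "eventually (\<lambda>n. Max (backward_walk x t n ` {..cell n s}) \<le> - x m) sequentially"
      by (auto simp: eventually_sequentially intro!: exI[of _ 1])
  qed simp
  from tendsto_diff[OF this backward_walk_tendsto[OF s]]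
  show ?thesis unfolding discrete_height_Max height_at_def m(2) by simp
qed

definition step_height :: "(real \<Rightarrow> real) \<Rightarrow> nat \<Rightarrow> real \<Rightarrow> real" where
  "step_height \<phi> n s = (\<Sum>k<n. \<phi> (discrete_height x t n k) * indicator {t - t * real (Suc k) / n <.. t - t * real k / n} s)"

lemma step_height_eq:
  assumes n: "0 < n"
  shows "step_height \<phi> n s = indicator {0<..t} s * \<phi> (discrete_height x t n (cell n s))"
proof (cases "s \<in> {0<..t}")
  case True
  then have s: "0 < s" "s \<le> t" by auto
  let ?k = "cell n s"
  have "t * real ?k / n < t" using cell_bounds(1)[OF s(2) n] s by linarith
  then have "t * real ?k < t * real n" using n by (simp add: pos_divide_less_eq)
  then have "real ?k < real n" using t by (simp only: mult_less_cancel_left_pos)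
  then have kn: "?k < n" by (simp only: of_nat_less_iff)
  have in_k: "s \<in> {t - t * real (Suc ?k) / n <.. t - t * real ?k / n}"
  proof -
    have "t * real (Suc ?k) / n = t * real ?k / n + t / n" by (simp add: algebra_simps add_divide_distrib)
    then show ?thesis using cell_bounds[OF s(2) n] by auto
  qed
  have "step_height \<phi> n s = (\<Sum>k<n. if k = ?k then \<phi> (discrete_height x t n k) else 0)"
    unfolding step_height_def
  proof (rule sum.cong[OF HOL.refl])
    fix k
    show "\<phi> (discrete_height x t n k) * indicator {t - t * real (Suc k) / n <.. t - t * real k / n} s
       = (if k = ?k then \<phi> (discrete_height x t n k) else 0)"
    proof (cases "k = ?k")
      case True
      have "s \<in> {t - t * real (Suc k) / n <.. t - t * real k / n}" unfolding True by (rule in_k)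
      then show ?thesis using True by (simp only: indicator_simps simp_thms if_True mult_1_right)
    next
      case False
      then have "s \<notin> {t - t * real (Suc k) / n <.. t - t * real k / n}"
        using cell_unique[OF s(2) n, of k] by (simp only: greaterThanAtMost_iff) blast
      then show ?thesis using False by (simp only: indicator_simps simp_thms if_False mult_zero_right)
    qed
  qed
  also have "\<dots> = \<phi> (discrete_height x t n ?k)" using kn by simp
  finally show ?thesis using True by simp
next
  case False
  have "s \<notin> {t - t * real (Suc k) / n <.. t - t * real k / n}" if "k < n" for k
  proof -
    have "t * real (Suc k) \<le> t * real n" using that t by (intro mult_left_mono) auto
    then have "t * real (Suc k) / n \<le> t" using n by (simp add: pos_divide_le_eq)
    moreover have "0 \<le> t * real k / n" using t by simp
    ultimately have "{t - t * real (Suc k) / n <.. t - t * real k / n} \<subseteq> {0<..t}" by (intro subsetI) (simp only: greaterThanAtMost_iff, linarith)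
    then show ?thesis using False by blast
  qed
  then have "step_height \<phi> n s = (\<Sum>k<n. 0)"
    unfolding step_height_def by (intro sum.cong HOL.refl) (simp only: lessThan_iff indicator_simps simp_thms mult_zero_right)
  then show ?thesis using False by simp
qed

lemma step_height_measurable [measurable]: "step_height \<phi> n \<in> borel_measurable borel"
  unfolding step_height_def[abs_def] by measurable

lemma step_height_tendsto:
  assumes \<phi>: "\<And>y. isCont \<phi> y"
  shows "(\<lambda>n. step_height \<phi> n s) \<longlonglongrightarrow> indicator {0<..t} s * \<phi> (height_at x t s)"
proof (cases "s \<in> {0<..t}")
  case True
  have "(\<lambda>n. \<phi> (discrete_height x t n (cell n s))) \<longlonglongrightarrow> \<phi> (height_at x t s)"
    by (rule isCont_tendsto_compose[OF \<phi> discrete_height_tendsto]) (use True in auto)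
  moreover have "eventually (\<lambda>n. \<phi> (discrete_height x t n (cell n s)) = step_height \<phi> n s) sequentially"
    using step_height_eq[of _ \<phi> s] True by (auto simp: eventually_sequentially intro!: exI[of _ 1])
  ultimately show ?thesis using True by (simp add: tendsto_cong)
next
  case False
  then have "eventually (\<lambda>n. step_height \<phi> n s = 0) sequentially"
    using step_height_eq[of _ \<phi> s] by (auto simp: eventually_sequentially intro!: exI[of _ 1])
  then have "(\<lambda>n. step_height \<phi> n s) \<longlonglongrightarrow> 0" by (rule tendsto_eventually)
  then show ?thesis using False by simp
qed

lemma height_at_measurable: "(\<lambda>s. indicator {0<..t} s * height_at x t s) \<in> borel_measurable borel"
  using step_height_tendsto[of "\<lambda>y. y"] by (intro borel_measurable_LIMSEQ_real[OF _ step_height_measurable[of "\<lambda>y. y"]]) auto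

lemma riemann_sum_tendsto:
  assumes \<phi>: "\<And>y. isCont \<phi> y" "\<And>y. 0 \<le> \<phi> y" "\<And>y. \<phi> y \<le> K"
  shows "(\<lambda>n. t / n * (\<Sum>k<n. \<phi> (discrete_height x t n k))) \<longlonglongrightarrow> (\<integral>s. indicator {0<..t} s * \<phi> (height_at x t s) \<partial>lborel)"
    and "integrable lborel (\<lambda>s. indicator {0<..t} s * \<phi> (height_at x t s))"
proof -
  have hm: "(\<lambda>s. indicator {0<..t} s * \<phi> (height_at x t s)) \<in> borel_measurable borel"
    using step_height_tendsto[OF \<phi>(1)] by (intro borel_measurable_LIMSEQ_real[OF _ step_height_measurable]) auto
  have w: "integrable lborel (\<lambda>s. K * indicator {0<..t} s :: real)" using t by simp
  show "integrable lborel (\<lambda>s. indicator {0<..t} s * \<phi> (height_at x t s))"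
  proof (rule Bochner_Integration.integrable_bound[OF w])
    show "AE s in lborel. norm (indicator {0<..t} s * \<phi> (height_at x t s)) \<le> norm (K * indicator {0<..t} s :: real)"
      using \<phi>(2,3) by (auto intro!: AE_I2 simp: indicator_def intro: order_trans[OF _ abs_ge_self])
  qed (use hm in simp)
  have lim: "(\<lambda>n. \<integral>s. step_height \<phi> (Suc n) s \<partial>lborel) \<longlonglongrightarrow> (\<integral>s. indicator {0<..t} s * \<phi> (height_at x t s) \<partial>lborel)"
  proof (rule integral_dominated_convergence[OF _ _ w])
    show "AE s in lborel. (\<lambda>n. step_height \<phi> (Suc n) s) \<longlonglongrightarrow> indicator {0<..t} s * \<phi> (height_at x t s)"
      using LIMSEQ_Suc[OF step_height_tendsto[OF \<phi>(1)]] by auto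
    show "AE s in lborel. norm (step_height \<phi> (Suc n) s) \<le> K * indicator {0<..t} s" for n
      unfolding step_height_eq[OF zero_less_Suc] using \<phi>(2,3) by (auto intro!: AE_I2 simp: indicator_def)
  qed (use hm in auto)
  have int: "(\<integral>s. step_height \<phi> n s \<partial>lborel) = t / n * (\<Sum>k<n. \<phi> (discrete_height x t n k))" if n: "0 < n" for n
  proof -
    have le: "t - t * real (Suc k) / n \<le> t - t * real k / n" for k
      using t by (intro diff_mono divide_right_mono mult_left_mono) auto
    have len: "(t - t * real k / n) - (t - t * real (Suc k) / n) = t / n" for k
      by (simp add: algebra_simps add_divide_distrib)
    have I: "(\<integral>s. indicator {t - t * real (Suc k) / n <.. t - t * real k / n} s \<partial>lborel) = t / n"
       "integrable lborel (indicator {t - t * real (Suc k) / n <.. t - t * real k / n} :: real \<Rightarrow> real)" for k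
    proof -
      have e: "emeasure lborel {t - t * real (Suc k) / n <.. t - t * real k / n} = ennreal (t / n)"
        by (simp only: emeasure_lborel_Ioc[OF le] len)
      then show "(\<integral>s. indicator {t - t * real (Suc k) / n <.. t - t * real k / n} s \<partial>lborel) = t / n"
        using t by (simp add: measure_def)
      show "integrable lborel (indicator {t - t * real (Suc k) / n <.. t - t * real k / n} :: real \<Rightarrow> real)"
        by (rule integrable_real_indicator) (auto simp: e simp del: of_nat_Suc)
    qed
    have "(\<integral>s. step_height \<phi> n s \<partial>lborel) = (\<Sum>k<n. \<phi> (discrete_height x t n k) * (t / n))"
      unfolding step_height_def
      by (subst Bochner_Integration.integral_sum) (use I in \<open>auto simp del: of_nat_Suc\<close>)
    then show ?thesis unfolding sum_distrib_left by (simp only: mult.commute)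
  qed
  have "(\<lambda>n. t / Suc n * (\<Sum>k<Suc n. \<phi> (discrete_height x t (Suc n) k))) \<longlonglongrightarrow> (\<integral>s. indicator {0<..t} s * \<phi> (height_at x t s) \<partial>lborel)"
    using lim unfolding int[OF zero_less_Suc] .
  then show "(\<lambda>n. t / n * (\<Sum>k<n. \<phi> (discrete_height x t n k))) \<longlonglongrightarrow> (\<integral>s. indicator {0<..t} s * \<phi> (height_at x t s) \<partial>lborel)"
    by (rule LIMSEQ_imp_Suc)
qed

text \<open>The sum telescopes, and what remains is the maximum of the backward walk minus its first value.\<close>

lemma discrete_local_time_tendsto:
  "(\<lambda>n. discrete_height x t n n + (\<Sum>k<n. backward_walk x t n (Suc k) - backward_walk x t n k)) \<longlonglongrightarrow> height_at x t t + (x t - low x 0 t)"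
proof -
  have c: "cell n 0 = n" for n using t by (simp add: cell_def)
  have "(\<lambda>n. discrete_height x t n n) \<longlonglongrightarrow> height_at x t 0"
    using discrete_height_tendsto[of 0] t by (simp add: c)
  then have lim: "(\<lambda>n. discrete_height x t n n + (x t - x 0)) \<longlonglongrightarrow> height_at x t 0 + (x t - x 0)"
    by (intro tendsto_intros)
  have "eventually (\<lambda>n. discrete_height x t n n + (x t - x 0) =
     discrete_height x t n n + (\<Sum>k<n. backward_walk x t n (Suc k) - backward_walk x t n k)) sequentially"
    unfolding sum_lessThan_telescope by (auto simp: backward_walk_def eventually_sequentially intro!: exI[of _ 1])
  from Lim_transform_eventually[OF lim this] show ?thesis by (simp add: height_at_def)
qed

end

section \<open>Trapezoidal test functions\<close>

text \<open>A Lipschitz approximation of the indicator of \<open>[lo, hi]\<close>, with slopes of width \<open>h\<close> at both ends.\<close>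

definition trapezoid :: "real \<Rightarrow> real \<Rightarrow> real \<Rightarrow> real \<Rightarrow> real" where
  "trapezoid lo hi h x = max 0 (min 1 (min ((x - lo) / h) ((hi - x) / h)))"

lemma trapezoid:
  assumes "0 < h"
  shows "0 \<le> trapezoid lo hi h x" "trapezoid lo hi h x \<le> 1"
    "x \<le> lo \<Longrightarrow> trapezoid lo hi h x = 0" "hi \<le> x \<Longrightarrow> trapezoid lo hi h x = 0"
    "lo + h \<le> x \<Longrightarrow> x \<le> hi - h \<Longrightarrow> trapezoid lo hi h x = 1"
    "\<bar>trapezoid lo hi h x - trapezoid lo hi h y\<bar> \<le> \<bar>x - y\<bar> / h"
proof -
  show "0 \<le> trapezoid lo hi h x" "trapezoid lo hi h x \<le> 1" by (auto simp: trapezoid_def)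
  show "trapezoid lo hi h x = 0" if "x \<le> lo"
  proof -
    have "(x - lo) / h \<le> 0" using that assms by (simp add: divide_nonpos_pos)
    then show ?thesis by (simp add: trapezoid_def)
  qed
  show "trapezoid lo hi h x = 0" if "hi \<le> x"
  proof -
    have "(hi - x) / h \<le> 0" using that assms by (simp add: divide_nonpos_pos)
    then show ?thesis by (simp add: trapezoid_def)
  qed
  show "trapezoid lo hi h x = 1" if "lo + h \<le> x" "x \<le> hi - h"
  proof -
    have "1 \<le> (x - lo) / h" "1 \<le> (hi - x) / h" using that assms by (simp_all add: pos_le_divide_eq)
    then show ?thesis by (simp add: trapezoid_def)
  qed
  have "\<bar>max 0 (min 1 (min a b)) - max 0 (min 1 (min c d))\<bar> \<le> max \<bar>a - c\<bar> \<bar>b - d\<bar>" for a b c d :: real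
    by (simp add: max_def min_def abs_if)
  then have "\<bar>trapezoid lo hi h x - trapezoid lo hi h y\<bar> \<le>
      max \<bar>(x - lo) / h - (y - lo) / h\<bar> \<bar>(hi - x) / h - (hi - y) / h\<bar>" unfolding trapezoid_def .
  moreover have "(x - lo) / h - (y - lo) / h = (x - y) / h" "(hi - x) / h - (hi - y) / h = - ((x - y) / h)"
    by (simp_all add: diff_divide_distrib)
  ultimately show "\<bar>trapezoid lo hi h x - trapezoid lo hi h y\<bar> \<le> \<bar>x - y\<bar> / h"
    using assms by (simp add: abs_divide)
qed

lemma trapezoid_isCont: "isCont (trapezoid lo hi h) x" if "0 < h"
proof -
  have "(1/h)-lipschitz_on UNIV (trapezoid lo hi h)"
    unfolding lipschitz_on_def using trapezoid(6)[OF that] that by (auto simp: dist_real_def)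
  then have "continuous_on UNIV (trapezoid lo hi h)" by (rule lipschitz_on_continuous_on)
  then show ?thesis by (simp add: continuous_on_eq_continuous_at)
qed

lemma trapezoid_le_indicator:
  assumes "0 < h" shows "trapezoid lo hi h x \<le> indicator {lo..<hi} x"
  using trapezoid(2,3,4)[OF assms, where lo=lo and hi=hi and x=x] by (auto simp: indicator_def not_le not_less)

lemma indicator_le_trapezoid:
  assumes "0 < h" shows "indicator {lo + h..<hi - h} x \<le> trapezoid lo hi h x"
  using trapezoid(1,5)[OF assms, where lo=lo and hi=hi and x=x] by (auto simp: indicator_def)

section \<open>Measurability for cadlag paths\<close>

lemma cadlag_bdd_below:
  fixes x :: "real \<Rightarrow> real"
  assumes rc: "\<And>s. 0 \<le> s \<Longrightarrow> continuous (at_right s) x" and ll: "\<And>s. 0 < s \<Longrightarrow> \<exists>l. (x \<longlongrightarrow> l) (at_left s)"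
    and a: "0 \<le> a"
  shows "bdd_below (x ` {a..b})"
proof (cases "a \<le> b")
  case True
  define Q where "Q u v \<longleftrightarrow> bdd_below (x ` ({u..v} \<inter> {a..}))" for u v
  from True have "Q a b"
  proof (induction rule: Bolzano)
    case (trans u v w)
    then have "{u..w} \<inter> {a..} = ({u..v} \<inter> {a..}) \<union> ({v..w} \<inter> {a..})" by auto
    with trans show ?case unfolding Q_def by (simp only: image_Un bdd_below_Un)
  next
    case (local r)
    then have r: "0 \<le> r" using a by simp
    obtain d1 where d1: "0 < d1" "\<And>y. r < y \<Longrightarrow> dist y r < d1 \<Longrightarrow> dist (x y) (x r) < 1"
      using rc[OF r] unfolding continuous_within Lim_within by (metis dist_nz greaterThan_iff less_irrefl zero_less_one)
    obtain d2 l where d2: "0 < d2" "\<And>y. 0 \<le> y \<Longrightarrow> y < r \<Longrightarrow> dist y r < d2 \<Longrightarrow> dist (x y) l < 1"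
    proof (cases "r = 0")
      case True
      then show ?thesis using that[of 1 0] by auto
    next
      case False
      then obtain l where "(x \<longlongrightarrow> l) (at_left r)" using ll[of r] r by auto
      then obtain d where "0 < d" "\<And>y. y < r \<Longrightarrow> dist y r < d \<Longrightarrow> dist (x y) l < 1"
        unfolding Lim_within by (metis dist_nz lessThan_iff less_irrefl zero_less_one)
      then show ?thesis using that by blast
    qed
    show ?case
    proof (intro exI[of _ "min d1 d2"] conjI allI impI)
      fix u v assume uv: "u \<le> r \<and> r \<le> v \<and> v - u < min d1 d2"
      show "Q u v" unfolding Q_def
      proof (rule bdd_belowI2[where m="min (x r - 1) (l - 1)"])
        fix y assume y: "y \<in> {u..v} \<inter> {a..}"
        then show "min (x r - 1) (l - 1) \<le> x y"
          using d1(2)[of y] d2(2)[of y] uv a by (cases y r rule: linorder_cases) (auto simp: dist_real_def)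
      qed
    qed (use d1 d2 in auto)
  qed
  moreover have "{a..b} \<inter> {a..} = {a..b}" by auto
  ultimately show ?thesis unfolding Q_def by simp
qed simp

lemma right_limit_sequence:
  fixes x :: "real \<Rightarrow> real"
  assumes rc: "continuous (at_right s) x" and a: "a \<longlonglongrightarrow> s" "\<And>n. s < a n"
  shows "(\<lambda>n. x (a n)) \<longlonglongrightarrow> x s"
proof -
  have "filterlim a (at_right s) sequentially"
    unfolding filterlim_at using a by (auto simp: eventually_sequentially)
  moreover have "(x \<longlongrightarrow> x s) (at_right s)" using rc by (simp add: continuous_within)
  ultimately show ?thesis by (rule filterlim_compose[rotated])
qed

lemma rational_right_sequence:
  shows "\<exists>q :: nat \<Rightarrow> rat. (\<forall>n. s < real_of_rat (q n)) \<and> (\<lambda>n. real_of_rat (q n)) \<longlonglongrightarrow> s"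
proof -
  have "\<exists>q. s < real_of_rat q \<and> real_of_rat q < s + 1 / Suc n" for n
    using of_rat_dense[of s "s + 1 / Suc n"] by auto
  then obtain q where q: "\<And>n. s < real_of_rat (q n) \<and> real_of_rat (q n) < s + 1 / Suc n" by metis
  have "(\<lambda>n. real_of_rat (q n)) \<longlonglongrightarrow> s"
  proof (rule tendsto_sandwich)
    show "(\<lambda>n. s) \<longlonglongrightarrow> s" by simp
    have "(\<lambda>n. s + 1 / real (Suc n)) \<longlonglongrightarrow> s + 0" by (intro tendsto_intros LIMSEQ_Suc[OF lim_const_over_n])
    then show "(\<lambda>n. s + 1 / real (Suc n)) \<longlonglongrightarrow> s" by simp
  qed (use q in \<open>auto intro!: always_eventually less_imp_le\<close>)
  then have "(\<forall>n. s < real_of_rat (q n)) \<and> (\<lambda>n. real_of_rat (q n)) \<longlonglongrightarrow> s"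
    using q by (intro conjI allI) (simp_all only:)
  then show ?thesis by (rule exI[of _ q])
qed

text \<open>The end point \<open>t\<close> must be tested separately, since the path may jump at \<open>t\<close>; everywhere else
  rational times suffice by right-continuity.\<close>

lemma le_inf_iff_rational:
  fixes x :: "real \<Rightarrow> real"
  assumes rc: "\<And>s. 0 \<le> s \<Longrightarrow> continuous (at_right s) x" and ll: "\<And>s. 0 < s \<Longrightarrow> \<exists>l. (x \<longlongrightarrow> l) (at_left s)"
    and s: "0 \<le> s" "s \<le> t"
  shows "y \<le> (INF r\<in>{s..t}. x r) \<longleftrightarrow> y \<le> x t \<and> (\<forall>q. s < real_of_rat q \<and> real_of_rat q < t \<longrightarrow> y \<le> x (real_of_rat q))"
proof -
  have "y \<le> (INF r\<in>{s..t}. x r) \<longleftrightarrow> (\<forall>r\<in>{s..t}. y \<le> x r)"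
    using s by (intro le_cINF_iff cadlag_bdd_below rc ll) auto
  also have "\<dots> \<longleftrightarrow> y \<le> x t \<and> (\<forall>q. s < real_of_rat q \<and> real_of_rat q < t \<longrightarrow> y \<le> x (real_of_rat q))"
  proof (intro iffI conjI allI impI ballI)
    fix r assume H: "y \<le> x t \<and> (\<forall>q. s < real_of_rat q \<and> real_of_rat q < t \<longrightarrow> y \<le> x (real_of_rat q))" and r: "r \<in> {s..t}"
    show "y \<le> x r"
    proof (cases "r = t")
      case False
      then have rt: "r < t" using r by simp
      obtain q :: "nat \<Rightarrow> rat" where "(\<forall>n. r < real_of_rat (q n)) \<and> (\<lambda>n. real_of_rat (q n)) \<longlonglongrightarrow> r"
        using rational_right_sequence[of r] ..
      then have q: "\<And>n. r < real_of_rat (q n)" "(\<lambda>n. real_of_rat (q n)) \<longlonglongrightarrow> r" by simp_all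
      have "eventually (\<lambda>n. real_of_rat (q n) < t) sequentially" using order_tendstoD(2)[OF q(2) rt] .
      then have ev: "eventually (\<lambda>n. y \<le> x (real_of_rat (q n))) sequentially"
      proof eventually_elim
        case (elim n)
        have "s < real_of_rat (q n)" using r q(1)[of n] by simp
        with elim H show ?case by blast
      qed
      have "0 \<le> r" using r s by simp
      from right_limit_sequence[OF rc[OF this] q(2) q(1)]
      have "(\<lambda>n. x (real_of_rat (q n))) \<longlonglongrightarrow> x r" .
      from tendsto_lowerbound[OF this ev sequentially_bot] show ?thesis .
    qed (use H in simp)
  qed (use s in auto)
  finally show ?thesis .
qed

locale cadlag_process =
  fixes P :: "'w measure" and X :: "real \<Rightarrow> 'w \<Rightarrow> real"
  assumes X_rv: "\<And>t. 0 \<le> t \<Longrightarrow> X t \<in> borel_measurable P"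
    and X_right: "\<And>\<omega> s. \<omega> \<in> space P \<Longrightarrow> 0 \<le> s \<Longrightarrow> continuous (at_right s) (\<lambda>u. X u \<omega>)"
    and X_left: "\<And>\<omega> s. \<omega> \<in> space P \<Longrightarrow> 0 < s \<Longrightarrow> \<exists>l. ((\<lambda>u. X u \<omega>) \<longlongrightarrow> l) (at_left s)"
begin

text \<open>The path at time \<open>s\<close> is the limit of its values at the next grid times to the right of \<open>s\<close>.\<close>

lemma jointly_measurable: "(\<lambda>(\<omega>, s). X (max 0 s) \<omega>) \<in> borel_measurable (P \<Otimes>\<^sub>M borel)"
proof -
  define g :: "nat \<Rightarrow> real \<Rightarrow> nat" where "g n s = Suc (nat \<lfloor>max 0 s * Suc n\<rfloor>)" for n s
  have gm: "g n \<in> borel \<rightarrow>\<^sub>M count_space UNIV" for n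
    unfolding g_def[abs_def] by measurable
  have m: "(\<lambda>p. X (real (g n (snd p)) / Suc n) (fst p)) \<in> borel_measurable (P \<Otimes>\<^sub>M borel)" for n
  proof (rule measurable_compose_countable[where g="\<lambda>p. g n (snd p)" and f="\<lambda>i p. X (real i / Suc n) (fst p)"])
    show "(\<lambda>p. X (real i / Suc n) (fst p)) \<in> borel_measurable (P \<Otimes>\<^sub>M borel)" for i
      by (rule measurable_compose[OF measurable_fst X_rv]) simp
    show "(\<lambda>p. g n (snd p)) \<in> P \<Otimes>\<^sub>M borel \<rightarrow>\<^sub>M count_space UNIV"
      by (rule measurable_compose[OF measurable_snd gm])
  qed
  have gb: "max 0 s < real (g n s) / Suc n" "real (g n s) / Suc n \<le> max 0 s + 1 / Suc n" for n s
  proof -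
    define m where "m = max 0 s"
    have "0 \<le> m * Suc n" by (simp add: m_def)
    then have "real (g n s) = of_int \<lfloor>m * Suc n\<rfloor> + 1" by (simp add: g_def m_def)
    then have "m * Suc n < real (g n s)" "real (g n s) \<le> m * Suc n + 1" by linarith+
    then have "m < real (g n s) / Suc n" "real (g n s) / Suc n \<le> (m * Suc n + 1) / Suc n"
      by (simp_all add: pos_less_divide_eq divide_right_mono del: of_nat_Suc)
    then show "max 0 s < real (g n s) / Suc n" "real (g n s) / Suc n \<le> max 0 s + 1 / Suc n"
      unfolding m_def[symmetric] by (simp_all add: add_divide_distrib del: of_nat_Suc)
  qed
  have lim: "(\<lambda>n. X (real (g n s) / Suc n) \<omega>) \<longlonglongrightarrow> X (max 0 s) \<omega>" if "\<omega> \<in> space P" for \<omega> s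
  proof (rule right_limit_sequence[OF X_right[OF that]])
    show "(\<lambda>n. real (g n s) / Suc n) \<longlonglongrightarrow> max 0 s"
    proof (rule tendsto_sandwich)
      show "(\<lambda>n. max 0 s) \<longlonglongrightarrow> max 0 s" by simp
      have "(\<lambda>n. max 0 s + 1 / real (Suc n)) \<longlonglongrightarrow> max 0 s + 0" by (intro tendsto_intros LIMSEQ_Suc[OF lim_const_over_n])
      then show "(\<lambda>n. max 0 s + 1 / real (Suc n)) \<longlonglongrightarrow> max 0 s" by simp
    qed (use gb in \<open>auto intro!: always_eventually less_imp_le simp del: of_nat_Suc\<close>)
  qed (use gb in auto)
  have "(\<lambda>p. X (max 0 (snd p)) (fst p)) \<in> borel_measurable (P \<Otimes>\<^sub>M borel)"
    by (rule borel_measurable_LIMSEQ_real[OF _ m]) (use lim in \<open>auto simp: space_pair_measure\<close>)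
  then show ?thesis by (simp add: case_prod_beta)
qed

lemma inf_jointly_measurable:
  assumes t: "0 \<le> t"
  shows "(\<lambda>p. inf_between X (fst p) (max 0 (min (snd p) t)) t) \<in> borel_measurable (P \<Otimes>\<^sub>M borel)"
  unfolding borel_measurable_iff_ge
proof
  fix y
  let ?A = "{p \<in> space (P \<Otimes>\<^sub>M borel). y \<le> X t (fst p) \<and>
     (\<forall>q::rat. max 0 (min (snd p) t) < real_of_rat q \<and> real_of_rat q < t \<longrightarrow> y \<le> X (max 0 (real_of_rat q)) (fst p))}"
  have [measurable]: "X t \<in> borel_measurable P" "\<And>q. X (max 0 (real_of_rat q)) \<in> borel_measurable P"
    using X_rv t by auto
  have "?A \<in> sets (P \<Otimes>\<^sub>M borel)" by measurable
  also have "?A = {p \<in> space (P \<Otimes>\<^sub>M borel). y \<le> inf_between X (fst p) (max 0 (min (snd p) t)) t}"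
  proof (intro Collect_cong conj_cong HOL.refl)
    fix p :: "'w \<times> real" assume "p \<in> space (P \<Otimes>\<^sub>M borel)"
    then have \<omega>: "fst p \<in> space P" by (auto simp: space_pair_measure)
    let ?s = "max 0 (min (snd p) t)"
    have s: "0 \<le> ?s" "?s \<le> t" using t by auto
    have "(\<forall>q. ?s < real_of_rat q \<and> real_of_rat q < t \<longrightarrow> y \<le> X (max 0 (real_of_rat q)) (fst p)) \<longleftrightarrow>
       (\<forall>q. ?s < real_of_rat q \<and> real_of_rat q < t \<longrightarrow> y \<le> X (real_of_rat q) (fst p))"
      by (auto simp: max_absorb2)
    then show "(y \<le> X t (fst p) \<and> (\<forall>q. ?s < real_of_rat q \<and> real_of_rat q < t \<longrightarrow> y \<le> X (max 0 (real_of_rat q)) (fst p)))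
       = (y \<le> inf_between X (fst p) ?s t)"
      unfolding inf_between_def
      by (subst le_inf_iff_rational[where x="\<lambda>u. X u (fst p)", OF X_right[OF \<omega>] X_left[OF \<omega>] s]) auto
  qed
  finally show "{p \<in> space (P \<Otimes>\<^sub>M borel). y \<le> inf_between X (fst p) (max 0 (min (snd p) t)) t} \<in> sets (P \<Otimes>\<^sub>M borel)" .
qed

lemma running_inf_le:
  assumes "\<omega> \<in> space P" "0 \<le> t" shows "running_inf X \<omega> t \<le> X t \<omega>"
  unfolding inf_between_def
  by (rule cINF_lower[OF cadlag_bdd_below[OF X_right[OF assms(1)] X_left[OF assms(1)] order_refl]]) (use assms in auto)

lemma running_inf_measurable:
  assumes t: "0 \<le> t"
  shows "(\<lambda>\<omega>. running_inf X \<omega> t) \<in> borel_measurable P"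
proof -
  have "(\<lambda>\<omega>. (\<omega>, 0::real)) \<in> P \<rightarrow>\<^sub>M P \<Otimes>\<^sub>M borel" by (rule measurable_Pair2') simp
  from measurable_compose[OF this inf_jointly_measurable[OF t]]
  have "(\<lambda>\<omega>. inf_between X \<omega> (max 0 (min 0 t)) t) \<in> borel_measurable P" by (simp only: fst_conv snd_conv)
  moreover have "max 0 (min 0 t) = 0" using t by simp
  ultimately show ?thesis by (simp only:)
qed

text \<open>The approximation of the height process whose limit in probability defines \<open>H\<close>.\<close>

definition occupation :: "real \<Rightarrow> real \<Rightarrow> 'w \<Rightarrow> real" where
  "occupation t \<epsilon> \<omega> = 1 / \<epsilon> * (LBINT s:{0..t}.
     indicator {u. inf_between X \<omega> u t < X u \<omega> \<and> X u \<omega> < inf_between X \<omega> u t + \<epsilon>} s)"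

lemma occupation_measurable:
  assumes t: "0 \<le> t"
  shows "occupation t \<epsilon> \<in> borel_measurable P"
proof -
  define F where "F = (\<lambda>p. X (max 0 (snd p)) (fst p))"
  define I where "I = (\<lambda>p. inf_between X (fst p) (max 0 (min (snd p) t)) t)"
  have [measurable]: "F \<in> borel_measurable (P \<Otimes>\<^sub>M lborel)" "I \<in> borel_measurable (P \<Otimes>\<^sub>M lborel)"
  proof -
    have sets: "sets (P \<Otimes>\<^sub>M lborel) = sets (P \<Otimes>\<^sub>M (borel :: real measure))"
      by (rule sets_pair_measure_cong) simp_all
    show "F \<in> borel_measurable (P \<Otimes>\<^sub>M lborel)"
      using jointly_measurable unfolding F_def case_prod_beta measurable_cong_sets[OF sets HOL.refl] .
    show "I \<in> borel_measurable (P \<Otimes>\<^sub>M lborel)"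
      using inf_jointly_measurable[OF t] unfolding I_def measurable_cong_sets[OF sets HOL.refl] .
  qed
  have m: "(\<lambda>p. if 0 \<le> snd p \<and> snd p \<le> t \<and> I p < F p \<and> F p < I p + \<epsilon> then 1 else 0 :: real) \<in> borel_measurable (P \<Otimes>\<^sub>M lborel)"
    by measurable
  then have "(\<lambda>\<omega>. \<integral>s. (if 0 \<le> s \<and> s \<le> t \<and> I (\<omega>, s) < F (\<omega>, s) \<and> F (\<omega>, s) < I (\<omega>, s) + \<epsilon> then 1 else 0 :: real) \<partial>lborel) \<in> borel_measurable P"
    by (intro lborel.borel_measurable_lebesgue_integral) (simp add: case_prod_beta)
  also have "(\<lambda>\<omega>. \<integral>s. (if 0 \<le> s \<and> s \<le> t \<and> I (\<omega>, s) < F (\<omega>, s) \<and> F (\<omega>, s) < I (\<omega>, s) + \<epsilon> then 1 else 0 :: real) \<partial>lborel)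
    = (\<lambda>\<omega>. LBINT s:{0..t}. indicator {u. inf_between X \<omega> u t < X u \<omega> \<and> X u \<omega> < inf_between X \<omega> u t + \<epsilon>} s)"
    unfolding set_lebesgue_integral_def
    by (intro ext Bochner_Integration.integral_cong) (auto simp: F_def I_def indicator_def max_absorb2 min_absorb1)
  finally show ?thesis unfolding occupation_def[abs_def] by (intro borel_measurable_times borel_measurable_const)
qed

end

section \<open>The height process of Brownian motion\<close>

lemma brownian_cadlag:
  assumes "brownian_var_2t P X" shows "cadlag_process P X"
  using assms unfolding brownian_var_2t_def levy_process_def cadlag_process_def by blast

lemma continuous_on_halfline:
  fixes f :: "real \<Rightarrow> real"
  assumes "\<And>N::nat. continuous_on {0..real N} f"
  shows "continuous_on {0..} f"
  unfolding continuous_on_iff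
proof (intro ballI allI impI)
  fix s e :: real assume s: "s \<in> {0..}" and e: "0 < e"
  obtain N :: nat where N: "s + 1 < real N" using reals_Archimedean2 by blast
  then obtain d where d: "0 < d" "\<And>y. y \<in> {0..real N} \<Longrightarrow> dist y s < d \<Longrightarrow> dist (f y) (f s) < e"
    using assms[of N] s e unfolding continuous_on_iff by force
  show "\<exists>d>0. \<forall>x'\<in>{0..}. dist x' s < d \<longrightarrow> dist (f x') (f s) < e"
  proof (intro exI[of _ "min d 1"] conjI ballI impI)
    fix y assume "y \<in> {0::real..}" "dist y s < min d 1"
    then show "dist (f y) (f s) < e" using N by (intro d(2)) (auto simp: dist_real_def)
  qed (use d in auto)
qed

lemma AE_brownian_modulus:
  assumes B: "brownian_var_2t P X"
  shows "AE \<omega> in P. \<forall>N::nat. \<exists>m0. levy_modulus m0 (real N) (\<lambda>u. X u \<omega>)"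
  unfolding AE_all_countable
proof
  fix N :: nat
  interpret cadlag_process P X using B by (rule brownian_cadlag)
  show "AE \<omega> in P. \<exists>m0. levy_modulus m0 (real N) (\<lambda>u. X u \<omega>)"
    by (rule AE_levy_modulus[OF brownian_gaussian_increments[OF B] X_right])
qed

lemma AE_brownian_continuous:
  assumes B: "brownian_var_2t P X"
  shows "AE \<omega> in P. continuous_on {0..} (\<lambda>u. X u \<omega>)"
  using AE_brownian_modulus[OF B]
proof eventually_elim
  case (elim \<omega>)
  then show ?case using levy_modulus_continuous by (intro continuous_on_halfline) blast
qed

text \<open>Reversal and change of sign turn the infima of \<open>X\<close> over \<open>[s, t]\<close> into running maxima.\<close>

lemma reversed_reflected_walk:
  assumes B: "brownian_var_2t P X" and t: "0 < t" "0 < n"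
  shows "reflected_walk P (\<lambda>u \<omega>. - X (t - u) \<omega>) t n"
  using gaussian_increments_uminus[OF gaussian_increments_reverse[OF brownian_gaussian_increments[OF B]]] t
  by (intro reflected_walk.intro)

text \<open>The slope \<open>c\<close> is the area of the trapezoid divided by \<open>\<epsilon>\<close>, and so lies between the areas
  of the rectangles over its top and its base.\<close>

lemma trapezoid_second_antiderivative:
  assumes lo: "0 < lo" "lo + 2 * h < hi" and h: "0 < h" and e: "0 < \<epsilon>"
  obtains f f' c where
    "\<And>x. (f has_real_derivative f' x) (at x)" "\<And>x. (f' has_real_derivative (trapezoid lo hi h x / \<epsilon>)) (at x)"
    "\<And>x. x \<le> 0 \<Longrightarrow> f x = - c * x" "\<And>x. hi \<le> x \<Longrightarrow> f' x = 0"
    "\<And>x. \<bar>f' x\<bar> \<le> c" "\<And>x. 0 \<le> x \<Longrightarrow> \<bar>f x\<bar> \<le> c * hi"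
    "0 \<le> c" "(hi - lo - 2 * h) / \<epsilon> \<le> c" "c \<le> (hi - lo) / \<epsilon>"
proof -
  let ?\<phi> = "\<lambda>x. trapezoid lo hi h x / \<epsilon>"
  have lip: "\<bar>?\<phi> x - ?\<phi> y\<bar> \<le> 1 / (h * \<epsilon>) * \<bar>x - y\<bar>" for x y
  proof -
    have "\<bar>?\<phi> x - ?\<phi> y\<bar> = \<bar>trapezoid lo hi h x - trapezoid lo hi h y\<bar> / \<epsilon>"
      using e by (simp add: diff_divide_distrib[symmetric])
    also have "\<dots> \<le> (\<bar>x - y\<bar> / h) / \<epsilon>" using e trapezoid(6)[OF h] by (intro divide_right_mono) auto
    finally show ?thesis by simp
  qed
  have hi: "0 < hi" using lo h by linarith
  obtain f f' c where F: "\<And>x. (f has_real_derivative f' x) (at x)" "\<And>x. (f' has_real_derivative ?\<phi> x) (at x)"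
    "\<And>x. x \<le> 0 \<Longrightarrow> f x = - c * x" "\<And>x. x \<le> 0 \<Longrightarrow> f' x = - c" "\<And>x. hi \<le> x \<Longrightarrow> f' x = 0"
    "0 \<le> c" "\<And>x. \<bar>f' x\<bar> \<le> c" "\<And>x. 0 \<le> x \<Longrightarrow> \<bar>f x\<bar> \<le> c * hi"
  proof (rule second_antiderivative[OF lip _ _ _ hi])
    show "0 \<le> ?\<phi> x" for x using trapezoid(1)[OF h] e by simp
    show "?\<phi> x = 0" if "x \<le> 0" for x using trapezoid(3)[OF h, of x lo] that lo by simp
    show "?\<phi> x = 0" if "hi \<le> x" for x using trapezoid(4)[OF h that] by simp
  qed blast
  have f'lo: "f' lo = - c"
  proof -
    obtain z where z: "0 < z" "z < lo" "f' lo - f' 0 = (lo - 0) * ?\<phi> z"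
      using MVT2[OF lo(1), of f' ?\<phi>] F(2) by blast
    then show ?thesis using trapezoid(3)[OF h, of z lo] F(4)[of 0] by simp
  qed
  have lohi: "lo < hi" using lo h by linarith
  obtain z where z: "lo < z" "z < hi" "f' hi - f' lo = (hi - lo) * ?\<phi> z"
    using MVT2[OF lohi, of f' ?\<phi>] F(2) by blast
  have up: "c \<le> (hi - lo) / \<epsilon>"
  proof -
    have "c = (hi - lo) * ?\<phi> z" using z f'lo F(5)[of hi] by simp
    also have "\<dots> \<le> (hi - lo) * (1 / \<epsilon>)"
      using lohi e trapezoid(2)[OF h] by (intro mult_left_mono divide_right_mono) auto
    finally show ?thesis by simp
  qed
  have mid: "lo + h < hi - h" using lo by linarith
  obtain y where y: "lo + h < y" "y < hi - h" "f' (hi - h) - f' (lo + h) = (hi - h - (lo + h)) * ?\<phi> y"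
    using MVT2[OF mid, of f' ?\<phi>] F(2) by blast
  have low: "(hi - lo - 2 * h) / \<epsilon> \<le> c"
  proof -
    have mono: "f' u \<le> f' v" if "u \<le> v" for u v
      using that by (rule DERIV_nonneg_imp_nondecreasing)
        (use F(2) trapezoid(1)[OF h] e in \<open>meson divide_nonneg_nonneg less_imp_le\<close>)
    have "trapezoid lo hi h y = 1" using trapezoid(5)[OF h, of lo y hi] y by simp
    with y(3) have "f' (hi - h) - f' (lo + h) = (hi - h - (lo + h)) * (1 / \<epsilon>)" by (simp only:)
    then have "f' (hi - h) - f' (lo + h) = (hi - lo - 2 * h) / \<epsilon>" by simp
    moreover have "f' lo \<le> f' (lo + h)" "f' (hi - h) \<le> f' hi" using h by (auto intro!: mono)
    ultimately show ?thesis using f'lo F(5)[of hi] by linarith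
  qed
  show ?thesis by (rule that[OF F(1,2,3,5,7,8,6) low up])
qed

text \<open>Let the mesh tend to \<open>0\<close> in \<open>deviation_L1\<close>.  For a continuous path the deviations converge to
  that of the continuous occupation integral, and Fatou's lemma keeps the bound.  Defining \<open>Z\<close> as
  a lower limit makes it measurable without any measurability of the continuous integral.\<close>

lemma occupation_limit:
  assumes B: "brownian_var_2t P X" and t: "0 < t"
    and lo: "0 < lo" "lo + 2 * h < hi" and h: "0 < h" and e: "0 < \<epsilon>"
  shows "\<exists>c Z. (hi - lo - 2 * h) / \<epsilon> \<le> c \<and> c \<le> (hi - lo) / \<epsilon> \<and> Z \<in> borel_measurable P \<and>
    (\<forall>\<kappa>>0. (\<integral>\<^sup>+\<omega>. Z \<omega> \<partial>P) \<le> ennreal (c * hi + 2 * \<kappa> + 16 * c\<^sup>2 * hi * (1 + 2 * t) / \<kappa>)) \<and>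
    (\<forall>\<omega>\<in>space P. continuous_on {0..} (\<lambda>u. X u \<omega>) \<longrightarrow>
      Z \<omega> = ennreal \<bar>c * (X t \<omega> - running_inf X \<omega> t) -
         (\<integral>s. indicator {0<..t} s * (trapezoid lo hi h (height_at (\<lambda>u. X u \<omega>) t s) / \<epsilon>) \<partial>lborel)\<bar>)"
proof -
  let ?\<phi> = "\<lambda>x. trapezoid lo hi h x / \<epsilon>"
  have hi: "0 < hi" using lo h by linarith
  obtain f f' c where F: "\<And>x. (f has_real_derivative f' x) (at x)" "\<And>x. (f' has_real_derivative ?\<phi> x) (at x)"
    "\<And>x. x \<le> 0 \<Longrightarrow> f x = - c * x" "\<And>x. hi \<le> x \<Longrightarrow> f' x = 0"
    "\<And>x. \<bar>f' x\<bar> \<le> c" "\<And>x. 0 \<le> x \<Longrightarrow> \<bar>f x\<bar> \<le> c * hi"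
    "0 \<le> c" "(hi - lo - 2 * h) / \<epsilon> \<le> c" "c \<le> (hi - lo) / \<epsilon>"
    using trapezoid_second_antiderivative[OF lo h e] by blast
  define L where "L = 1 / (h * \<epsilon>)"
  have lip: "\<bar>?\<phi> x - ?\<phi> y\<bar> \<le> L * \<bar>x - y\<bar>" for x y
  proof -
    have "\<bar>?\<phi> x - ?\<phi> y\<bar> = \<bar>trapezoid lo hi h x - trapezoid lo hi h y\<bar> / \<epsilon>"
      using e by (simp add: diff_divide_distrib[symmetric])
    also have "\<dots> \<le> (\<bar>x - y\<bar> / h) / \<epsilon>" using e trapezoid(6)[OF h] by (intro divide_right_mono) auto
    finally show ?thesis by (simp add: L_def)
  qed
  have p0: "0 \<le> ?\<phi> x" and p1: "?\<phi> x \<le> 1 / \<epsilon>" for x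
    using trapezoid(1,2)[OF h] e by (auto intro: divide_right_mono)
  have pc: "isCont ?\<phi> x" for x
    using trapezoid_isCont[OF h, where lo=lo and hi=hi and x=x] e by (intro continuous_intros) auto
  define V where "V = (\<lambda>j. reflected_walk.deviation (\<lambda>u \<omega>. - X (t - u) \<omega>) t (Suc j) c ?\<phi>)"
  note W = reversed_reflected_walk[OF B t zero_less_Suc]
  have Vm: "V j \<in> borel_measurable P" and
    Vi: "0 < \<kappa> \<Longrightarrow> 12 * (t / Suc j) \<le> hi\<^sup>2 \<Longrightarrow> (\<integral>\<^sup>+\<omega>. ennreal \<bar>V j \<omega>\<bar> \<partial>P) \<le>
      ennreal (c * hi + 2 * \<kappa> + 16 * c\<^sup>2 * hi * (1 + 2 * t) / \<kappa> + 2 * (1/\<epsilon>)\<^sup>2 * t * (t / Suc j) / \<kappa> + 6 * L * t * sqrt (t / Suc j))" for j \<kappa>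
  proof -
    interpret W: reflected_walk P "\<lambda>u \<omega>. - X (t - u) \<omega>" t "Suc j" by (rule W)
    show "0 < \<kappa> \<Longrightarrow> 12 * (t / Suc j) \<le> hi\<^sup>2 \<Longrightarrow> (\<integral>\<^sup>+\<omega>. ennreal \<bar>V j \<omega>\<bar> \<partial>P) \<le>
      ennreal (c * hi + 2 * \<kappa> + 16 * c\<^sup>2 * hi * (1 + 2 * t) / \<kappa> + 2 * (1/\<epsilon>)\<^sup>2 * t * (t / Suc j) / \<kappa> + 6 * L * t * sqrt (t / Suc j))"
      unfolding V_def
      by (rule W.deviation_L1(2)[OF F(1,2,3,4,7,5,6) lip p0 p1 hi, unfolded W.mesh_def])
    show "V j \<in> borel_measurable P"
      unfolding V_def W.deviation_def[abs_def]
      by (intro borel_measurable_diff borel_measurable_times borel_measurable_add borel_measurable_sum borel_measurable_const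
          W.R_rv W.incr_rv W.fn_R_rv borel_measurable_continuous_onI continuous_at_imp_continuous_on ballI pc) auto
  qed
  define Z where "Z = (\<lambda>\<omega>. liminf (\<lambda>j. ennreal \<bar>V j \<omega>\<bar>))"
  have Zm: "Z \<in> borel_measurable P" unfolding Z_def
    using Vm by (intro borel_measurable_liminf measurable_compose[OF _ measurable_ennreal] borel_measurable_abs)
  have Zi: "(\<integral>\<^sup>+\<omega>. Z \<omega> \<partial>P) \<le> ennreal (c * hi + 2 * \<kappa> + 16 * c\<^sup>2 * hi * (1 + 2 * t) / \<kappa>)" if \<kappa>: "0 < \<kappa>" for \<kappa>
  proof -
    let ?b = "\<lambda>j. c * hi + 2 * \<kappa> + 16 * c\<^sup>2 * hi * (1 + 2 * t) / \<kappa> + 2 * (1/\<epsilon>)\<^sup>2 * t * (t / Suc j) / \<kappa> + 6 * L * t * sqrt (t / Suc j)"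
    have l0: "(\<lambda>j. t / Suc j) \<longlonglongrightarrow> 0" by (rule LIMSEQ_Suc[OF lim_const_over_n])
    have "?b \<longlonglongrightarrow> c * hi + 2 * \<kappa> + 16 * c\<^sup>2 * hi * (1 + 2 * t) / \<kappa> + 2 * (1/\<epsilon>)\<^sup>2 * t * 0 / \<kappa> + 6 * L * t * sqrt 0"
      using \<kappa> by (intro tendsto_intros l0) auto
    then have bl: "(\<lambda>j. ennreal (?b j)) \<longlonglongrightarrow> ennreal (c * hi + 2 * \<kappa> + 16 * c\<^sup>2 * hi * (1 + 2 * t) / \<kappa>)"
      by (intro tendsto_ennrealI) simp
    have "(\<lambda>j. 12 * (t / Suc j)) \<longlonglongrightarrow> 12 * 0" by (intro tendsto_intros l0)
    then have "eventually (\<lambda>j. 12 * (t / Suc j) < hi\<^sup>2) sequentially"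
      by (rule order_tendstoD) (use hi in simp)
    then have ev: "eventually (\<lambda>j. (\<integral>\<^sup>+\<omega>. ennreal \<bar>V j \<omega>\<bar> \<partial>P) \<le> ennreal (?b j)) sequentially"
      by eventually_elim (rule Vi[OF \<kappa>], simp)
    have "(\<integral>\<^sup>+\<omega>. Z \<omega> \<partial>P) \<le> liminf (\<lambda>j. \<integral>\<^sup>+\<omega>. ennreal \<bar>V j \<omega>\<bar> \<partial>P)"
      unfolding Z_def by (rule nn_integral_liminf) (use Vm in measurable)
    also have "\<dots> \<le> liminf (\<lambda>j. ennreal (?b j))" by (rule Liminf_mono[OF ev])
    also have "\<dots> = ennreal (c * hi + 2 * \<kappa> + 16 * c\<^sup>2 * hi * (1 + 2 * t) / \<kappa>)"
      by (rule lim_imp_Liminf[OF sequentially_bot bl])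
    finally show ?thesis .
  qed
  have Zc: "Z \<omega> = ennreal \<bar>c * (X t \<omega> - running_inf X \<omega> t) -
         (\<integral>s. indicator {0<..t} s * ?\<phi> (height_at (\<lambda>u. X u \<omega>) t s) \<partial>lborel)\<bar>"
    if cont: "continuous_on {0..} (\<lambda>u. X u \<omega>)" for \<omega>
  proof -
    let ?x = "\<lambda>u. X u \<omega>"
    have V: "V j \<omega> = c * (discrete_height ?x t (Suc j) (Suc j) +
        (\<Sum>k<Suc j. backward_walk ?x t (Suc j) (Suc k) - backward_walk ?x t (Suc j) k))
        - t / Suc j * (\<Sum>k<Suc j. ?\<phi> (discrete_height ?x t (Suc j) k))" for j
    proof -
      interpret W: reflected_walk P "\<lambda>u \<omega>. - X (t - u) \<omega>" t "Suc j" by (rule W)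
      have "W.incr k \<omega> = backward_walk ?x t (Suc j) (Suc k) - backward_walk ?x t (Suc j) k" for k
        unfolding W.incr_def backward_walk_def by (simp only:)
      then show ?thesis
        unfolding V_def W.deviation_def W.R_def W.mesh_def discrete_height_def by (simp only:)
    qed
    have l1: "(\<lambda>j. discrete_height ?x t (Suc j) (Suc j) +
        (\<Sum>k<Suc j. backward_walk ?x t (Suc j) (Suc k) - backward_walk ?x t (Suc j) k)) \<longlonglongrightarrow> height_at ?x t t + (?x t - low ?x 0 t)"
      by (rule LIMSEQ_Suc[OF discrete_local_time_tendsto[OF cont t]])
    have l2: "(\<lambda>j. t / Suc j * (\<Sum>k<Suc j. ?\<phi> (discrete_height ?x t (Suc j) k))) \<longlonglongrightarrow> (\<integral>s. indicator {0<..t} s * ?\<phi> (height_at ?x t s) \<partial>lborel)"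
      by (rule LIMSEQ_Suc[OF riemann_sum_tendsto(1)[OF cont t pc p0 p1]])
    have "height_at ?x t t + (?x t - low ?x 0 t) = X t \<omega> - running_inf X \<omega> t"
      using t by (simp add: height_at_def low_def inf_between_def)
    note l1' = l1[unfolded this]
    have "(\<lambda>j. ennreal \<bar>V j \<omega>\<bar>) \<longlonglongrightarrow> ennreal \<bar>c * (X t \<omega> - running_inf X \<omega> t) -
         (\<integral>s. indicator {0<..t} s * ?\<phi> (height_at ?x t s) \<partial>lborel)\<bar>"
      unfolding V by (intro tendsto_ennrealI tendsto_rabs tendsto_diff tendsto_mult[OF tendsto_const] l1' l2)
    then show ?thesis unfolding Z_def by (rule lim_imp_Liminf[OF sequentially_bot])
  qed
  show ?thesis
    by (intro exI[of _ c] exI[of _ Z] conjI allI impI ballI F Zm Zi Zc)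
qed

context cadlag_process
begin

lemma occupation_height:
  assumes cont: "continuous_on {0..} (\<lambda>u. X u \<omega>)" and t: "0 < t"
  shows "occupation t \<epsilon> \<omega> = 1 / \<epsilon> * (\<integral>s. indicator {0<..t} s * indicator {0<..<\<epsilon>} (height_at (\<lambda>u. X u \<omega>) t s) \<partial>lborel)"
    and "integrable lborel (\<lambda>s. indicator {0<..t} s * indicator {0<..<\<epsilon>} (height_at (\<lambda>u. X u \<omega>) t s) :: real)"
proof -
  let ?h = "height_at (\<lambda>u. X u \<omega>) t"
  let ?g = "\<lambda>s. indicator {0<..t} s * indicator {0<..<\<epsilon>} (?h s) :: real"
  let ?f = "\<lambda>s. indicator {0..t} s *\<^sub>R indicator {u. inf_between X \<omega> u t < X u \<omega> \<and> X u \<omega> < inf_between X \<omega> u t + \<epsilon>} s :: real"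
  define d where "d = ?f 0"
  have eq: "?f s = ?g s + d * indicator {0} s" for s
  proof (cases "s \<in> {0<..t}")
    case True
    then have "inf_between X \<omega> s t = low (\<lambda>u. X u \<omega>) s t" by (simp add: inf_between_def low_def)
    then have "s \<in> {u. inf_between X \<omega> u t < X u \<omega> \<and> X u \<omega> < inf_between X \<omega> u t + \<epsilon>} \<longleftrightarrow> ?h s \<in> {0<..<\<epsilon>}"
      by (auto simp: height_at_def)
    then show ?thesis using True by (simp add: indicator_def)
  next
    case False
    then have "s < 0 \<or> s = 0 \<or> t < s" by auto
    then show ?thesis using t unfolding d_def by (elim disjE) simp_all
  qed
  have [measurable]: "(\<lambda>s. indicator {0<..t} s * ?h s) \<in> borel_measurable borel"
    by (rule height_at_measurable[OF cont t])
  have "(\<lambda>s. indicator {0<..t} s * indicator {0<..<\<epsilon>} (indicator {0<..t} s * ?h s) :: real) \<in> borel_measurable borel" by measurable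
  also have "(\<lambda>s. indicator {0<..t} s * indicator {0<..<\<epsilon>} (indicator {0<..t} s * ?h s) :: real) = ?g"
    by (auto simp: fun_eq_iff indicator_def)
  finally have gm: "?g \<in> borel_measurable borel" .
  show gi: "integrable lborel ?g"
  proof (rule Bochner_Integration.integrable_bound)
    show "integrable lborel (indicator {0<..t} :: real \<Rightarrow> real)" using t by simp
    show "AE s in lborel. norm (?g s) \<le> norm (indicator {0<..t} s :: real)" by (auto simp: indicator_def)
  qed (use gm in simp)
  have zi: "integrable lborel (\<lambda>s. d * indicator {0} s :: real)" by (intro integrable_mult_right integrable_real_indicator) auto
  have "(\<integral>s. ?f s \<partial>lborel) = (\<integral>s. ?g s + d * indicator {0} s \<partial>lborel)"
    by (rule Bochner_Integration.integral_cong[OF HOL.refl]) (rule eq)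
  also have "\<dots> = (\<integral>s. ?g s \<partial>lborel) + (\<integral>s. d * indicator {0} s \<partial>lborel)"
    by ((rule Bochner_Integration.integral_add[OF gi zi]) | (use gi zi in \<open>rule Bochner_Integration.integral_add\<close>) | (use gi zi in simp))
  also have "(\<integral>s. d * indicator {0} s \<partial>lborel) = d * measure lborel {0}" by (simp only: integral_mult_right_zero) simp
  also have "measure lborel {0::real} = 0" by simp
  finally have "(\<integral>s. ?f s \<partial>lborel) = (\<integral>s. ?g s \<partial>lborel)" by simp
  then show "occupation t \<epsilon> \<omega> = 1 / \<epsilon> * (\<integral>s. ?g s \<partial>lborel)"
    unfolding occupation_def set_lebesgue_integral_def by simp
qed

text \<open>The approximations at \<open>2 \<epsilon>\<close> and \<open>\<epsilon>\<close> combine to the occupation of \<open>[\<epsilon>, 2 \<epsilon>)\<close> alone.  This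
  combination has the same limit and stays away from height \<open>0\<close>, where the test functions of the
  Tanaka formula have to vanish.\<close>

lemma occupation_band:
  assumes cont: "continuous_on {0..} (\<lambda>u. X u \<omega>)" and t: "0 < t" and e: "0 < \<epsilon>"
  shows "2 * occupation t (2 * \<epsilon>) \<omega> - occupation t \<epsilon> \<omega>
      = (\<integral>s. indicator {0<..t} s * (indicator {\<epsilon>..<2*\<epsilon>} (height_at (\<lambda>u. X u \<omega>) t s) / \<epsilon>) \<partial>lborel)"
    and "integrable lborel (\<lambda>s. indicator {0<..t} s * (indicator {\<epsilon>..<2*\<epsilon>} (height_at (\<lambda>u. X u \<omega>) t s) / \<epsilon>) :: real)"
proof -
  let ?h = "height_at (\<lambda>u. X u \<omega>) t"
  let ?g = "\<lambda>\<epsilon> s. indicator {0<..t} s * indicator {0<..<\<epsilon>} (?h s) :: real"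
  have eq: "indicator {0<..t} s * (indicator {\<epsilon>..<2*\<epsilon>} (?h s) / \<epsilon>) = 1 / \<epsilon> * (?g (2 * \<epsilon>) s - ?g \<epsilon> s)" for s
    using e by (auto simp: indicator_def)
  note g = occupation_height[OF cont t]
  show "integrable lborel (\<lambda>s. indicator {0<..t} s * (indicator {\<epsilon>..<2*\<epsilon>} (?h s) / \<epsilon>) :: real)"
    unfolding eq by (intro integrable_mult_right Bochner_Integration.integrable_diff g(2))
  have "(\<integral>s. indicator {0<..t} s * (indicator {\<epsilon>..<2*\<epsilon>} (?h s) / \<epsilon>) \<partial>lborel) = 1 / \<epsilon> * ((\<integral>s. ?g (2 * \<epsilon>) s \<partial>lborel) - (\<integral>s. ?g \<epsilon> s \<partial>lborel))"
    unfolding eq integral_mult_right_zero by (subst Bochner_Integration.integral_diff[OF g(2) g(2)]) (rule HOL.refl)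
  then show "2 * occupation t (2 * \<epsilon>) \<omega> - occupation t \<epsilon> \<omega> = (\<integral>s. indicator {0<..t} s * (indicator {\<epsilon>..<2*\<epsilon>} (?h s) / \<epsilon>) \<partial>lborel)"
    unfolding g(1) by (simp add: right_diff_distrib)
qed

end

text \<open>Squeeze the indicator of the band \<open>[\<epsilon>, 2 \<epsilon>)\<close> between two trapezoids whose slopes have width
  \<open>\<eta> \<epsilon>\<close>: an inner one on \<open>[\<epsilon>, 2 \<epsilon>]\<close> and an outer one on \<open>[(1 - \<eta>) \<epsilon>, (2 + \<eta>) \<epsilon>]\<close>.  Their areas divided by
  \<open>\<epsilon>\<close> are \<open>1\<close> up to \<open>2 \<eta>\<close>.  Both mean deviations are of order \<open>sqrt \<epsilon>\<close>, by the choice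
  \<open>\<kappa> = sqrt \<epsilon>\<close>; in the bound, \<open>c \<le> 2\<close> and \<open>hi \<le> 3 \<epsilon>\<close>.\<close>

lemma occupation_band_deviation:
  assumes B: "brownian_var_2t P X" and t: "0 < t" and e: "0 < \<epsilon>" and \<eta>: "0 < \<eta>" "\<eta> < 1/4" and x: "0 < x"
  shows "\<exists>Z1 Z2. Z1 \<in> borel_measurable P \<and> Z2 \<in> borel_measurable P \<and>
    (\<integral>\<^sup>+\<omega>. Z1 \<omega> \<partial>P) \<le> ennreal (6 * \<epsilon> + 2 * sqrt \<epsilon> + 192 * (1 + 2 * t) * sqrt \<epsilon>) \<and>
    (\<integral>\<^sup>+\<omega>. Z2 \<omega> \<partial>P) \<le> ennreal (6 * \<epsilon> + 2 * sqrt \<epsilon> + 192 * (1 + 2 * t) * sqrt \<epsilon>) \<and>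
    (\<forall>\<omega>\<in>space P. continuous_on {0..} (\<lambda>u. X u \<omega>) \<longrightarrow> Z1 \<omega> < ennreal x \<longrightarrow> Z2 \<omega> < ennreal x \<longrightarrow>
       \<bar>2 * cadlag_process.occupation X t (2 * \<epsilon>) \<omega> - cadlag_process.occupation X t \<epsilon> \<omega> - (X t \<omega> - running_inf X \<omega> t)\<bar>
          \<le> 2 * \<eta> * (X t \<omega> - running_inf X \<omega> t) + x)"
proof -
  interpret cadlag_process P X using B by (rule brownian_cadlag)
  have h: "0 < \<eta> * \<epsilon>" using e \<eta> by simp
  have eh: "\<eta> * \<epsilon> < \<epsilon> / 4" using e \<eta> by simp
  have bound: "c * hi + 2 * sqrt \<epsilon> + 16 * c\<^sup>2 * hi * (1 + 2 * t) / sqrt \<epsilon> \<le> 6 * \<epsilon> + 2 * sqrt \<epsilon> + 192 * (1 + 2 * t) * sqrt \<epsilon>"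
    if "0 \<le> c" "c \<le> 2" "0 \<le> hi" "hi \<le> 3 * \<epsilon>" for c hi
  proof -
    have "c * hi \<le> 2 * (3 * \<epsilon>)" using that by (intro mult_mono) auto
    moreover have "c\<^sup>2 * hi \<le> 2\<^sup>2 * (3 * \<epsilon>)" using that by (intro mult_mono power_mono) auto
    then have "16 * (1 + 2 * t) * (c\<^sup>2 * hi) \<le> 16 * (1 + 2 * t) * (2\<^sup>2 * (3 * \<epsilon>))" using t by (intro mult_left_mono) auto
    then have "16 * (1 + 2 * t) * (c\<^sup>2 * hi) / sqrt \<epsilon> \<le> 16 * (1 + 2 * t) * (2\<^sup>2 * (3 * \<epsilon>)) / sqrt \<epsilon>"
      using e by (intro divide_right_mono) auto
    moreover have "16 * (1 + 2 * t) * (2\<^sup>2 * (3 * \<epsilon>)) / sqrt \<epsilon> = 192 * (1 + 2 * t) * sqrt \<epsilon>"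
    proof -
      have "16 * (1 + 2 * t) * (2\<^sup>2 * (3 * \<epsilon>)) / sqrt \<epsilon> = 192 * (1 + 2 * t) * (\<epsilon> / sqrt \<epsilon>)" by simp
      also have "\<epsilon> / sqrt \<epsilon> = sqrt \<epsilon>" using e by (simp add: real_div_sqrt)
      finally show ?thesis .
    qed
    moreover have "16 * c\<^sup>2 * hi * (1 + 2 * t) / sqrt \<epsilon> = 16 * (1 + 2 * t) * (c\<^sup>2 * hi) / sqrt \<epsilon>" by (simp add: mult_ac)
    ultimately have "16 * c\<^sup>2 * hi * (1 + 2 * t) / sqrt \<epsilon> \<le> 192 * (1 + 2 * t) * sqrt \<epsilon>" by (simp only:)
    with \<open>c * hi \<le> 2 * (3 * \<epsilon>)\<close> show ?thesis by linarith
  qed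
  have lo1: "0 < \<epsilon>" "\<epsilon> + 2 * (\<eta> * \<epsilon>) < 2 * \<epsilon>" using e eh by linarith+
  have lo2: "0 < (1 - \<eta>) * \<epsilon>" "(1 - \<eta>) * \<epsilon> + 2 * (\<eta> * \<epsilon>) < (2 + \<eta>) * \<epsilon>"
    using e \<eta> by (simp, simp add: algebra_simps)
  let ?x = "\<lambda>\<omega> u. X u \<omega>"
  define J1 where "J1 = (\<lambda>\<omega>. \<integral>s. indicator {0<..t} s * (trapezoid \<epsilon> (2 * \<epsilon>) (\<eta> * \<epsilon>) (height_at (?x \<omega>) t s) / \<epsilon>) \<partial>lborel)"
  define J2 where "J2 = (\<lambda>\<omega>. \<integral>s. indicator {0<..t} s * (trapezoid ((1 - \<eta>) * \<epsilon>) ((2 + \<eta>) * \<epsilon>) (\<eta> * \<epsilon>) (height_at (?x \<omega>) t s) / \<epsilon>) \<partial>lborel)"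
  define S where "S = (\<lambda>\<omega>. X t \<omega> - running_inf X \<omega> t)"
  obtain c1 Z1 where 1: "(2 * \<epsilon> - \<epsilon> - 2 * (\<eta> * \<epsilon>)) / \<epsilon> \<le> c1" "c1 \<le> (2 * \<epsilon> - \<epsilon>) / \<epsilon>" "Z1 \<in> borel_measurable P"
    "\<And>\<kappa>. 0 < \<kappa> \<Longrightarrow> (\<integral>\<^sup>+\<omega>. Z1 \<omega> \<partial>P) \<le> ennreal (c1 * (2 * \<epsilon>) + 2 * \<kappa> + 16 * c1\<^sup>2 * (2 * \<epsilon>) * (1 + 2 * t) / \<kappa>)"
    "\<And>\<omega>. \<omega> \<in> space P \<Longrightarrow> continuous_on {0..} (?x \<omega>) \<Longrightarrow> Z1 \<omega> = ennreal \<bar>c1 * S \<omega> - J1 \<omega>\<bar>"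
    using occupation_limit[OF B t lo1 h e] unfolding J1_def S_def by blast
  obtain c2 Z2 where 2: "((2 + \<eta>) * \<epsilon> - (1 - \<eta>) * \<epsilon> - 2 * (\<eta> * \<epsilon>)) / \<epsilon> \<le> c2" "c2 \<le> ((2 + \<eta>) * \<epsilon> - (1 - \<eta>) * \<epsilon>) / \<epsilon>" "Z2 \<in> borel_measurable P"
    "\<And>\<kappa>. 0 < \<kappa> \<Longrightarrow> (\<integral>\<^sup>+\<omega>. Z2 \<omega> \<partial>P) \<le> ennreal (c2 * ((2 + \<eta>) * \<epsilon>) + 2 * \<kappa> + 16 * c2\<^sup>2 * ((2 + \<eta>) * \<epsilon>) * (1 + 2 * t) / \<kappa>)"
    "\<And>\<omega>. \<omega> \<in> space P \<Longrightarrow> continuous_on {0..} (?x \<omega>) \<Longrightarrow> Z2 \<omega> = ennreal \<bar>c2 * S \<omega> - J2 \<omega>\<bar>"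
    using occupation_limit[OF B t lo2 h e] unfolding J2_def S_def by blast
  have c1: "1 - 2 * \<eta> \<le> c1" "c1 \<le> 1"
  proof -
    have "(2 * \<epsilon> - \<epsilon> - 2 * (\<eta> * \<epsilon>)) / \<epsilon> = 1 - 2 * \<eta>" "(2 * \<epsilon> - \<epsilon>) / \<epsilon> = 1" using e by (simp_all add: field_simps)
    with 1(1,2) show "1 - 2 * \<eta> \<le> c1" "c1 \<le> 1" by simp_all
  qed
  have c2: "1 \<le> c2" "c2 \<le> 1 + 2 * \<eta>"
  proof -
    have "((2 + \<eta>) * \<epsilon> - (1 - \<eta>) * \<epsilon> - 2 * (\<eta> * \<epsilon>)) / \<epsilon> = 1" "((2 + \<eta>) * \<epsilon> - (1 - \<eta>) * \<epsilon>) / \<epsilon> = 1 + 2 * \<eta>"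
      using e by (simp_all add: field_simps)
    with 2(1,2) show "1 \<le> c2" "c2 \<le> 1 + 2 * \<eta>" by simp_all
  qed
  have se: "0 < sqrt \<epsilon>" using e by simp
  have i1: "(\<integral>\<^sup>+\<omega>. Z1 \<omega> \<partial>P) \<le> ennreal (6 * \<epsilon> + 2 * sqrt \<epsilon> + 192 * (1 + 2 * t) * sqrt \<epsilon>)"
    by (rule order_trans[OF 1(4)[OF se] ennreal_leI[OF bound]]) (use c1 \<eta> e in auto)
  have i2: "(\<integral>\<^sup>+\<omega>. Z2 \<omega> \<partial>P) \<le> ennreal (6 * \<epsilon> + 2 * sqrt \<epsilon> + 192 * (1 + 2 * t) * sqrt \<epsilon>)"
    by (rule order_trans[OF 2(4)[OF se] ennreal_leI[OF bound]]) (use c2 \<eta> e in auto)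
  have main: "\<bar>2 * occupation t (2 * \<epsilon>) \<omega> - occupation t \<epsilon> \<omega> - S \<omega>\<bar> \<le> 2 * \<eta> * S \<omega> + x"
    if \<omega>: "\<omega> \<in> space P" and cont: "continuous_on {0..} (?x \<omega>)" and z: "Z1 \<omega> < ennreal x" "Z2 \<omega> < ennreal x" for \<omega>
  proof -
    have S0: "0 \<le> S \<omega>" using running_inf_le[OF \<omega>, of t] t by (simp add: S_def)
    have z1: "\<bar>c1 * S \<omega> - J1 \<omega>\<bar> < x" using z(1) 1(5)[OF \<omega> cont] x by (simp add: ennreal_less_iff)
    have z2: "\<bar>c2 * S \<omega> - J2 \<omega>\<bar> < x" using z(2) 2(5)[OF \<omega> cont] x by (simp add: ennreal_less_iff)
    have pc: "isCont (\<lambda>y. trapezoid lo hi (\<eta> * \<epsilon>) y / \<epsilon>) y" for lo hi y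
      using trapezoid_isCont[OF h, where lo=lo and hi=hi and x=y] e by (intro continuous_intros) auto
    have p0: "0 \<le> trapezoid lo hi (\<eta> * \<epsilon>) y / \<epsilon>" "trapezoid lo hi (\<eta> * \<epsilon>) y / \<epsilon> \<le> 1 / \<epsilon>" for lo hi y
      using trapezoid(1,2)[OF h] e by (auto intro: divide_right_mono)
    note ri = riemann_sum_tendsto(2)[OF cont t pc p0]
    note band = occupation_band[OF cont t e]
    have "J1 \<omega> \<le> 2 * occupation t (2 * \<epsilon>) \<omega> - occupation t \<epsilon> \<omega>"
      unfolding J1_def band(1)
      using trapezoid_le_indicator[OF h, of \<epsilon> "2 * \<epsilon>"] e
      by (intro integral_mono[OF ri band(2)] mult_left_mono divide_right_mono) auto
    moreover have "2 * occupation t (2 * \<epsilon>) \<omega> - occupation t \<epsilon> \<omega> \<le> J2 \<omega>"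
    proof -
      have e2: "(1 - \<eta>) * \<epsilon> + \<eta> * \<epsilon> = \<epsilon>" "(2 + \<eta>) * \<epsilon> - \<eta> * \<epsilon> = 2 * \<epsilon>" by (simp_all add: algebra_simps)
      show ?thesis unfolding J2_def band(1)
        using indicator_le_trapezoid[OF h, of "(1 - \<eta>) * \<epsilon>" "(2 + \<eta>) * \<epsilon>", unfolded e2] e
        by (intro integral_mono[OF band(2) ri] mult_left_mono divide_right_mono) auto
    qed
    moreover have "S \<omega> - 2 * \<eta> * S \<omega> \<le> c1 * S \<omega>" "c2 * S \<omega> \<le> S \<omega> + 2 * \<eta> * S \<omega>"
      using mult_right_mono[OF c1(1) S0] mult_right_mono[OF c2(2) S0] by (simp_all only: left_diff_distrib distrib_right mult_1_left)
    moreover have "\<bar>D - a\<bar> \<le> p + x"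
      if "u \<le> D" "D \<le> v" "a - p \<le> k" "l \<le> a + p" "\<bar>k - u\<bar> < x" "\<bar>l - v\<bar> < x" for D a p u v k l :: real
      using that by linarith
    ultimately show ?thesis using z1 z2 by blast
  qed
  show ?thesis
    using 1(3) 2(3) i1 i2 main unfolding S_def by blast
qed

text \<open>Let \<open>\<epsilon>\<close> tend to \<open>0\<close>.  The error \<open>5 x\<close> collects \<open>x\<close> from the deviation and \<open>2 x + x\<close> from replacing the two
  occupations by \<open>H\<close>, and leaves room for strictness.\<close>

lemma height_close:
  assumes B: "brownian_var_2t P X" and H: "height_process P X H" and t: "0 < t"
    and \<eta>: "0 < \<eta>" "\<eta> < 1/4" and x: "0 < x"
  shows "AE \<omega> in P. \<bar>H t \<omega> - (X t \<omega> - running_inf X \<omega> t)\<bar> \<le> 2 * \<eta> * (X t \<omega> - running_inf X \<omega> t) + 5 * x"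
proof -
  interpret cadlag_process P X using B by (rule brownian_cadlag)
  interpret prob_space P using B by (simp add: brownian_var_2t_def levy_process_def)
  have Hm [measurable]: "H t \<in> borel_measurable P" using H t by (simp add: height_process_def)
  have Xm [measurable]: "X t \<in> borel_measurable P" using X_rv t by simp
  have Im [measurable]: "(\<lambda>\<omega>. running_inf X \<omega> t) \<in> borel_measurable P" using running_inf_measurable t by simp
  have Om [measurable]: "occupation t e \<in> borel_measurable P" for e using occupation_measurable t by simp
  define p where "p = (\<lambda>e. prob {\<omega>\<in>space P. x < \<bar>occupation t e \<omega> - H t \<omega>\<bar>})"
  have "tendsto_in_prob P (occupation t) (H t) (at_right 0)"
    using H t unfolding height_process_def occupation_def[abs_def] by simp
  then have p: "(p \<longlongrightarrow> 0) (at_right 0)" unfolding tendsto_in_prob_def p_def using x by blast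
  define S where "S = (\<lambda>\<omega>. X t \<omega> - running_inf X \<omega> t)"
  have Sm [measurable]: "S \<in> borel_measurable P" unfolding S_def by measurable
  define Bad where "Bad = {\<omega>\<in>space P. 2 * \<eta> * S \<omega> + 5 * x < \<bar>H t \<omega> - S \<omega>\<bar>}"
  have Bm: "Bad \<in> events" unfolding Bad_def by measurable
  define \<beta> where "\<beta> = (\<lambda>e. 6 * e + 2 * sqrt e + 192 * (1 + 2 * t) * sqrt e)"
  have le: "prob Bad \<le> p (2 * e) + p e + 2 * (\<beta> e / x)" if e: "0 < e" for e
  proof -
    obtain Z1 Z2 where Z: "Z1 \<in> borel_measurable P" "Z2 \<in> borel_measurable P"
      "(\<integral>\<^sup>+\<omega>. Z1 \<omega> \<partial>P) \<le> ennreal (\<beta> e)" "(\<integral>\<^sup>+\<omega>. Z2 \<omega> \<partial>P) \<le> ennreal (\<beta> e)"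
      "\<And>\<omega>. \<omega> \<in> space P \<Longrightarrow> continuous_on {0..} (\<lambda>u. X u \<omega>) \<Longrightarrow> Z1 \<omega> < ennreal x \<Longrightarrow> Z2 \<omega> < ennreal x \<Longrightarrow>
        \<bar>2 * occupation t (2 * e) \<omega> - occupation t e \<omega> - S \<omega>\<bar> \<le> 2 * \<eta> * S \<omega> + x"
      using occupation_band_deviation[OF B t e \<eta> x] unfolding \<beta>_def S_def by blast
    have markov: "prob {\<omega>\<in>space P. ennreal x \<le> Z \<omega>} \<le> \<beta> e / x"
      if [measurable]: "Z \<in> borel_measurable P" and Zi: "(\<integral>\<^sup>+\<omega>. Z \<omega> \<partial>P) \<le> ennreal (\<beta> e)" for Z
    proof -
      have b0: "0 \<le> \<beta> e" using e t by (simp add: \<beta>_def)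
      have "{\<omega>\<in>space P. ennreal x \<le> Z \<omega>} \<subseteq> {\<omega>\<in>space P. 1 \<le> ennreal (1 / x) * Z \<omega>}"
      proof safe
        fix \<omega> assume "ennreal x \<le> Z \<omega>"
        then have "ennreal (1 / x) * ennreal x \<le> ennreal (1 / x) * Z \<omega>" by (intro mult_left_mono) auto
        moreover have "ennreal (1 / x) * ennreal x = 1" using x by (simp add: ennreal_mult[symmetric])
        ultimately show "1 \<le> ennreal (1 / x) * Z \<omega>" by simp
      qed
      then have "emeasure P {\<omega>\<in>space P. ennreal x \<le> Z \<omega>} \<le> emeasure P {\<omega>\<in>space P. 1 \<le> ennreal (1 / x) * Z \<omega>}"
        by (intro emeasure_mono) measurable
      also have "\<dots> \<le> ennreal (1 / x) * (\<integral>\<^sup>+\<omega>. Z \<omega> * indicator (space P) \<omega> \<partial>P)"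
        by (rule nn_integral_Markov_inequality) (use that in auto)
      also have "(\<integral>\<^sup>+\<omega>. Z \<omega> * indicator (space P) \<omega> \<partial>P) = (\<integral>\<^sup>+\<omega>. Z \<omega> \<partial>P)"
        by (intro nn_integral_cong) (simp add: indicator_def)
      also have "ennreal (1 / x) * (\<integral>\<^sup>+\<omega>. Z \<omega> \<partial>P) \<le> ennreal (1 / x) * ennreal (\<beta> e)"
        by (intro mult_left_mono Zi) auto
      also have "\<dots> = ennreal (\<beta> e / x)" using x b0 by (simp add: ennreal_mult[symmetric])
      finally show ?thesis using x b0 by (simp add: emeasure_eq_measure)
    qed
    let ?E1 = "{\<omega>\<in>space P. x < \<bar>occupation t (2 * e) \<omega> - H t \<omega>\<bar>}" and ?E2 = "{\<omega>\<in>space P. x < \<bar>occupation t e \<omega> - H t \<omega>\<bar>}"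
    let ?F1 = "{\<omega>\<in>space P. ennreal x \<le> Z1 \<omega>}" and ?F2 = "{\<omega>\<in>space P. ennreal x \<le> Z2 \<omega>}"
    have m: "?E1 \<in> events" "?E2 \<in> events" "?F1 \<in> events" "?F2 \<in> events" using Z(1,2) by measurable
    have "AE \<omega> in P. \<omega> \<in> Bad \<longrightarrow> \<omega> \<in> (?E1 \<union> ?E2) \<union> (?F1 \<union> ?F2)"
      using AE_brownian_continuous[OF B] AE_space
    proof eventually_elim
      case (elim \<omega>)
      show ?case
      proof (rule impI, rule ccontr)
        assume bad: "\<omega> \<in> Bad" and n: "\<omega> \<notin> (?E1 \<union> ?E2) \<union> (?F1 \<union> ?F2)"
        have "Z1 \<omega> < ennreal x" "Z2 \<omega> < ennreal x" using n elim(2) by (auto simp: not_le)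
        from Z(5)[OF elim(2,1) this]
        have d: "\<bar>2 * occupation t (2 * e) \<omega> - occupation t e \<omega> - S \<omega>\<bar> \<le> 2 * \<eta> * S \<omega> + x" .
        have o: "\<bar>occupation t (2 * e) \<omega> - H t \<omega>\<bar> \<le> x" "\<bar>occupation t e \<omega> - H t \<omega>\<bar> \<le> x" using n elim(2) by auto
        have "2 * \<eta> * S \<omega> + 5 * x < \<bar>H t \<omega> - S \<omega>\<bar>" using bad by (simp add: Bad_def)
        with d o x show False by linarith
      qed
    qed
    then have "prob Bad \<le> prob ((?E1 \<union> ?E2) \<union> (?F1 \<union> ?F2))"
      using m by (intro finite_measure_mono_AE) auto
    also have "\<dots> \<le> (prob ?E1 + prob ?E2) + (prob ?F1 + prob ?F2)"
      using m by (intro order_trans[OF measure_Un_le] add_mono measure_Un_le) auto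
    also have "\<dots> \<le> (p (2 * e) + p e) + (\<beta> e / x + \<beta> e / x)"
      unfolding p_def by (intro add_mono order_refl markov Z)
    finally show ?thesis by simp
  qed
  have s0: "((\<lambda>e::real. e) \<longlongrightarrow> 0) (at_right 0)" by (rule tendsto_ident_at)
  have "(\<beta> \<longlongrightarrow> 6 * 0 + 2 * sqrt 0 + 192 * (1 + 2 * t) * sqrt 0) (at_right 0)"
    unfolding \<beta>_def by (intro tendsto_intros s0)
  then have b: "(\<beta> \<longlongrightarrow> 0) (at_right 0)" by simp
  have "filterlim (\<lambda>e::real. 2 * e) (at_right 0) (at_right 0)"
    unfolding filterlim_at
  proof
    show "((\<lambda>e::real. 2 * e) \<longlongrightarrow> 0) (at_right 0)" using tendsto_mult_right_zero[OF s0, of 2] by simp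
    show "eventually (\<lambda>e::real. 2 * e \<in> {0<..} \<and> 2 * e \<noteq> 0) (at_right 0)"
      using eventually_at_right_less[of 0] by eventually_elim auto
  qed
  then have p2: "((\<lambda>e. p (2 * e)) \<longlongrightarrow> 0) (at_right 0)" by (rule filterlim_compose[OF p])
  have "((\<lambda>e. p (2 * e) + p e + 2 * (\<beta> e / x)) \<longlongrightarrow> 0 + 0 + 2 * (0 / x)) (at_right 0)"
    by (intro tendsto_intros p p2 b) (use x in simp)
  then have lim: "((\<lambda>e. p (2 * e) + p e + 2 * (\<beta> e / x)) \<longlongrightarrow> 0) (at_right 0)" by simp
  have "prob Bad \<le> 0"
    by (rule tendsto_lowerbound[OF lim _ trivial_limit_at_right_real])
      (use le eventually_at_right_less[of "0::real"] in \<open>auto elim!: eventually_mono\<close>)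
  then have "Bad \<in> null_sets P" using Bm by (intro null_setsI) (simp_all add: emeasure_eq_measure measure_le_0_iff)
  then show ?thesis
  proof (rule AE_I')
    show "{\<omega>\<in>space P. \<not> \<bar>H t \<omega> - (X t \<omega> - running_inf X \<omega> t)\<bar> \<le> 2 * \<eta> * (X t \<omega> - running_inf X \<omega> t) + 5 * x} \<subseteq> Bad"
      by (auto simp: Bad_def S_def not_le)
  qed
qed

lemma height_eq:
  assumes B: "brownian_var_2t P X" and H: "height_process P X H" and t: "0 < t"
  shows "AE \<omega> in P. H t \<omega> = X t \<omega> - running_inf X \<omega> t"
proof -
  define u where "u = (\<lambda>k::nat. 1 / (real k + 5))"
  have u: "0 < u k" "u k < 1/4" for k by (auto simp: u_def field_simps)
  have "AE \<omega> in P. \<forall>k. \<bar>H t \<omega> - (X t \<omega> - running_inf X \<omega> t)\<bar> \<le> 2 * u k * (X t \<omega> - running_inf X \<omega> t) + 5 * u k"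
    unfolding AE_all_countable using height_close[OF B H t u u(1)] by blast
  then show ?thesis
  proof eventually_elim
    case (elim \<omega>)
    let ?S = "X t \<omega> - running_inf X \<omega> t"
    have "(\<lambda>k. 1 / real (k + 5)) \<longlonglongrightarrow> 0" by (rule LIMSEQ_ignore_initial_segment[OF lim_const_over_n])
    then have ul: "u \<longlonglongrightarrow> 0" by (simp add: u_def)
    have "(\<lambda>k. 2 * u k * ?S + 5 * u k) \<longlonglongrightarrow> 2 * 0 * ?S + 5 * 0" by (intro tendsto_intros ul)
    then have "\<bar>H t \<omega> - ?S\<bar> \<le> 2 * 0 * ?S + 5 * 0" by (rule LIMSEQ_le_const) (use elim in blast)
    then show ?case by simp
  qed
qed

text \<open>Equality at all rational times extends to all times by continuity of both sides.\<close>

lemma AE_height_eq: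
  assumes B: "brownian_var_2t P X" and H: "height_process P X H"
  shows "AE \<omega> in P. \<forall>t\<ge>0. H t \<omega> = X t \<omega> - running_inf X \<omega> t"
proof -
  have "AE \<omega> in P. \<forall>q::rat. 0 < real_of_rat q \<longrightarrow> H (real_of_rat q) \<omega> = X (real_of_rat q) \<omega> - running_inf X \<omega> (real_of_rat q)"
    unfolding AE_all_countable
  proof
    fix q :: rat
    show "AE \<omega> in P. 0 < real_of_rat q \<longrightarrow> H (real_of_rat q) \<omega> = X (real_of_rat q) \<omega> - running_inf X \<omega> (real_of_rat q)"
    proof (cases "0 < real_of_rat q")
      case True
      from height_eq[OF B H this] show ?thesis by eventually_elim simp
    next
      case False
      then show ?thesis by simp
    qed
  qed
  with AE_brownian_continuous[OF B] show ?thesis using AE_space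
  proof eventually_elim
    case (elim \<omega>)
    let ?x = "\<lambda>u. X u \<omega>"
    have lw: "running_inf X \<omega> s = low ?x 0 s" if "0 \<le> s" for s using that by (simp add: inf_between_def low_def)
    show ?case
    proof (intro allI impI)
      fix t :: real assume t: "0 \<le> t"
      obtain q :: "nat \<Rightarrow> rat" where "(\<forall>n. t < real_of_rat (q n)) \<and> (\<lambda>n. real_of_rat (q n)) \<longlonglongrightarrow> t"
        using rational_right_sequence[of t] ..
      then have q: "\<And>n. t < real_of_rat (q n)" "(\<lambda>n. real_of_rat (q n)) \<longlonglongrightarrow> t" by simp_all
      define a where "a = (\<lambda>n. real_of_rat (q n))"
      have a: "\<And>n. t < a n" "a \<longlonglongrightarrow> t" using q by (simp_all add: a_def)
      have apos: "0 \<le> a n" "a n \<in> {0..}" for n using a(1)[of n] t by auto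
      have Hc: "continuous_on {0..} (\<lambda>t. H t \<omega>)" using H elim(3) by (simp add: height_process_def)
      have Hl: "(\<lambda>n. H (a n) \<omega>) \<longlonglongrightarrow> H t \<omega>"
        by (rule continuous_on_tendsto_compose[OF Hc a(2)]) (use t apos in auto)
      have Xl: "(\<lambda>n. ?x (a n)) \<longlonglongrightarrow> ?x t"
        by (rule continuous_on_tendsto_compose[OF elim(1) a(2)]) (use t apos in auto)
      have Il: "(\<lambda>n. low ?x 0 (a n)) \<longlonglongrightarrow> low ?x 0 t"
      proof (rule LIMSEQ_I)
        fix e :: real assume "0 < e"
        then obtain d where d: "0 < d" "\<And>y. y \<in> {0..} \<Longrightarrow> dist y t < d \<Longrightarrow> dist (?x y) (?x t) < e"
          using elim(1) t unfolding continuous_on_iff by (meson atLeast_iff)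
        obtain n0 where n0: "\<And>n. n0 \<le> n \<Longrightarrow> norm (a n - t) < d" using LIMSEQ_D[OF a(2) d(1)] by blast
        show "\<exists>no. \<forall>n\<ge>no. norm (low ?x 0 (a n) - low ?x 0 t) < e"
        proof (intro exI[of _ n0] allI impI)
          fix n assume "n0 \<le> n"
          obtain m where m: "m \<in> {min 0 (a n)..max 0 (a n)}" "low ?x 0 (a n) = ?x m"
            using low_attained[OF elim(1) order_refl apos(1)[of n]] by metis
          have le: "low ?x 0 (a n) \<le> low ?x 0 t"
            unfolding le_low_iff[OF elim(1) order_refl t]
            using low_le[OF elim(1) order_refl apos(1)[of n]] a(1)[of n] t by auto
          have tl: "low ?x 0 t \<le> ?x t" by (rule low_le[OF elim(1) order_refl t]) (use t in auto)
          have "low ?x 0 t - e < low ?x 0 (a n)"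
          proof (cases "m \<le> t")
            case True
            then have "low ?x 0 t \<le> ?x m" using m(1) t apos(1)[of n] by (intro low_le[OF elim(1) order_refl t]) auto
            then show ?thesis using \<open>0 < e\<close> m(2) by simp
          next
            case False
            then have "dist m t < d" "m \<in> {0..}" using m(1) n0[OF \<open>n0 \<le> n\<close>] apos(1)[of n] t by (auto simp: dist_real_def)
            then have "\<bar>?x m - ?x t\<bar> < e" using d(2) by (simp add: dist_real_def)
            then show ?thesis using m(2) tl by linarith
          qed
          then show "norm (low ?x 0 (a n) - low ?x 0 t) < e" using le by simp
        qed
      qed
      have "(\<lambda>n. H (a n) \<omega>) = (\<lambda>n. ?x (a n) - low ?x 0 (a n))"
      proof
        fix n
        have "0 < real_of_rat (q n)" using a(1)[of n] t unfolding a_def by linarith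
        then have "H (a n) \<omega> = ?x (a n) - running_inf X \<omega> (a n)" using elim(2) unfolding a_def by blast
        then show "H (a n) \<omega> = ?x (a n) - low ?x 0 (a n)" using lw[OF apos(1)[of n]] by simp
      qed
      with tendsto_diff[OF Xl Il] have "(\<lambda>n. H (a n) \<omega>) \<longlonglongrightarrow> ?x t - low ?x 0 t" by simp
      from LIMSEQ_unique[OF Hl this] show "H t \<omega> = X t \<omega> - running_inf X \<omega> t" using lw[OF t] by simp
    qed
  qed
qed

section \<open>Tree balls along a good path\<close>

text \<open>A countable dense family of times in the half-line, indexed by a type so that measurability of
  countable quantifiers applies directly.\<close>

definition nrat :: "rat \<Rightarrow> real" where
  "nrat q = max 0 (real_of_rat q)"

lemma nrat_nonneg [simp]: "0 \<le> nrat q" by (simp add: nrat_def)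

lemma nrat_dense:
  assumes "0 \<le> u" "u < v" obtains q where "u < nrat q" "nrat q < v"
proof -
  obtain q where "u < real_of_rat q" "real_of_rat q < v" using of_rat_dense[OF assms(2)] by blast
  then show ?thesis using assms that[of q] by (simp add: nrat_def)
qed

definition rational_near :: "(real \<Rightarrow> real) \<Rightarrow> real \<Rightarrow> real \<Rightarrow> real \<Rightarrow> bool" where
  "rational_near w r s t \<longleftrightarrow> (\<forall>q. min s t \<le> nrat q \<and> nrat q \<le> max s t \<longrightarrow> w s + w t - r \<le> 2 * w (nrat q))"

text \<open>The condition \<open>w t \<noteq> 0\<close> removes the times after the end of the excursion, where the path rests at
  \<open>0\<close>; their total length is infinite.\<close>

definition near_set :: "(real \<Rightarrow> real) \<Rightarrow> real \<Rightarrow> rat \<Rightarrow> real set" where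
  "near_set w r p = {t. 0 \<le> t \<and> w t \<noteq> 0 \<and> rational_near w r (nrat p) t}"

text \<open>The four conditions say that the path returns to \<open>0\<close>, is positive immediately after time \<open>0\<close>,
  has Levy's modulus of continuity, and that its sets of close times are small.  The second one is
  written as a positive lower bound on each compact interval of small positive times, so
  that rational times decide it.\<close>

definition good_path :: "(real \<Rightarrow> real) \<Rightarrow> bool" where
  "good_path w \<longleftrightarrow>
    (\<exists>k::nat. 0 < k \<and> w (real k) = 0) \<and>
    (\<exists>k::nat. 0 < k \<and> (\<forall>n::nat. \<exists>j::nat. \<forall>q. 1 / Suc n \<le> nrat q \<and> nrat q \<le> 1 / k \<longrightarrow> 1 / Suc j \<le> w (nrat q))) \<and>
    (\<exists>m0. \<forall>m\<ge>m0. \<forall>p q. \<bar>nrat p - nrat q\<bar> \<le> 1 / 2 ^ m \<longrightarrow> \<bar>w (nrat p) - w (nrat q)\<bar> \<le> 76 * sqrt (real m / 2 ^ m)) \<and>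
    (\<exists>n0. \<forall>n\<ge>n0. \<forall>p. emeasure lborel (near_set w (1 / 2 ^ n) p) \<le> ennreal (2 * visit_rate * n / 4 ^ n))"

text \<open>A power of two of order \<open>n\<close>.  The factor \<open>131072 = 2 ^ 17\<close> exceeds \<open>3 * 152\<^sup>2\<close>, which is what
  Levy's modulus requires for \<open>m = 2 n + l \<le> 3 n\<close>.\<close>

lemma length_scale:
  fixes n :: nat assumes "24 \<le> n"
  obtains l where "131072 * n \<le> 2 ^ l" "2 ^ l < 262144 * n" "l \<le> n"
proof -
  have p: "131072 * n \<le> 2 ^ n" using assms by (induction n rule: dec_induct) auto
  define l where "l = (LEAST l. 131072 * n \<le> (2::nat) ^ l)"
  have 1: "131072 * n \<le> 2 ^ l" unfolding l_def by (rule LeastI[of _ n]) (rule p)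
  have 2: "l \<le> n" unfolding l_def by (rule Least_le) (rule p)
  have "l \<noteq> 0"
  proof
    assume "l = 0"
    with 1 have "131072 * n \<le> 1" by simp
    then show False using assms by simp
  qed
  then obtain l' where l': "l = Suc l'" by (cases l) auto
  have "\<not> 131072 * n \<le> 2 ^ l'" using not_less_Least[of l' "\<lambda>l. 131072 * n \<le> (2::nat) ^ l"] l' unfolding l_def by auto
  then have 3: "2 ^ l < 262144 * n" unfolding l' by simp
  from that[OF 1 3 2] show ?thesis .
qed

lemma dyadic_radius:
  fixes r :: real
  assumes "0 < r" "r < 1 / 2 ^ N"
  obtains n where "N < n" "1 / 2 ^ n < r" "r \<le> 2 / 2 ^ n"
proof -
  obtain k where k: "1 / 2 ^ k < r" using real_arch_pow_inv[of r "1/2"] assms(1) by (auto simp: power_one_over)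
  define n where "n = (LEAST n. 1 / 2 ^ n < r)"
  have n: "1 / 2 ^ n < r" unfolding n_def by (rule LeastI[of _ k]) (rule k)
  have Nn: "N < n"
  proof (rule ccontr)
    assume "\<not> N < n"
    then have "(1::real) / 2 ^ N \<le> 1 / 2 ^ n" by (intro divide_left_mono power_increasing) auto
    then show False using n assms(2) by linarith
  qed
  then obtain n' where n': "n = Suc n'" by (cases n) auto
  have "\<not> 1 / 2 ^ n' < r" using not_less_Least[of n' "\<lambda>n. 1 / 2 ^ n < r"] n' unfolding n_def by auto
  then have "r \<le> 2 / 2 ^ n" unfolding n' by simp
  from that[OF Nn n this] show ?thesis .
qed

lemma log_radius:
  assumes "2 \<le> n" "0 < r" "r \<le> 2 / 2 ^ n"
  shows "real n / 4 \<le> ln (1 / r)"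
proof -
  have h: "1/2 \<le> ln (2::real)" using ln_le_minus_one[of "1/2::real"] by (simp add: ln_div)
  have "2 ^ n / 2 \<le> 1 / r" using assms(2,3) by (simp add: field_simps)
  then have "ln (2 ^ n / 2) \<le> ln (1 / r)" using assms(2) by (subst ln_le_cancel_iff) auto
  moreover have "ln (2 ^ n / 2 :: real) = (real n - 1) * ln 2" by (simp add: ln_div ln_realpow algebra_simps)
  moreover have "(real n - 1) * (1/2) \<le> (real n - 1) * ln 2" using h assms(1) by (intro mult_left_mono) auto
  moreover have "real n / 4 \<le> (real n - 1) * (1/2)" using assms(1) by simp
  ultimately show ?thesis by linarith
qed

context
  fixes w :: "real \<Rightarrow> real"
  assumes cont: "continuous_on {0..} w" and good: "good_path w"
begin

text \<open>The lifetime is an infimum of zeros; it is positive because the zero at time \<open>0\<close> is isolated.\<close>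

lemma good_path_lifetime:
  shows "0 < lifetime w" "\<And>t. 0 < t \<Longrightarrow> t < lifetime w \<Longrightarrow> w t \<noteq> 0"
proof -
  obtain k :: nat where k: "0 < k" "\<And>n. \<exists>j::nat. \<forall>q. 1 / Suc n \<le> nrat q \<and> nrat q \<le> 1 / k \<longrightarrow> 1 / Suc j \<le> w (nrat q)"
    using good unfolding good_path_def by blast
  obtain k' :: nat where k': "0 < k'" "w (real k') = 0" using good unfolding good_path_def by blast
  have pos: "w t \<noteq> 0" if t: "0 < t" "t < 1 / k" for t
  proof -
    obtain n :: nat where n: "1 / Suc n < t" using nat_approx_posE[OF t(1)] by auto
    obtain j :: nat where j: "\<And>q. 1 / Suc n \<le> nrat q \<Longrightarrow> nrat q \<le> 1 / k \<Longrightarrow> 1 / Suc j \<le> w (nrat q)"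
      using k(2)[of n] by blast
    show ?thesis
    proof
      assume w0: "w t = 0"
      have jp: "0 < 1 / real (Suc j)" by simp
      obtain d where d: "0 < d" "\<And>y. y \<in> {0..} \<Longrightarrow> dist y t < d \<Longrightarrow> dist (w y) (w t) < 1 / Suc j"
        using cont t jp unfolding continuous_on_iff by (meson atLeast_iff less_imp_le)
      have "t < min (t + d) (1 / k)" using t d by simp
      from nrat_dense[OF less_imp_le[OF t(1)] this] obtain q where q: "t < nrat q" "nrat q < min (t + d) (1 / k)" .
      have "dist (w (nrat q)) (w t) < 1 / Suc j" using q by (intro d(2)) (auto simp: dist_real_def)
      moreover have "1 / Suc j \<le> w (nrat q)" using q n by (intro j) auto
      ultimately show False using w0 by (simp add: dist_real_def)
    qed
  qed
  have "1 / real k \<le> lifetime w" unfolding lifetime_def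
  proof (rule cInf_greatest)
    show "{t. 0 < t \<and> w t = 0} \<noteq> {}" using k' by (intro ex_in_conv[THEN iffD1] exI[of _ "real k'"]) simp
    show "1 / real k \<le> t" if "t \<in> {t. 0 < t \<and> w t = 0}" for t using pos[of t] that by (simp add: not_less[symmetric]) blast
  qed
  then show "0 < lifetime w" using k(1) by (meson less_le_trans of_nat_0_less_iff zero_less_divide_1_iff)
  show "w t \<noteq> 0" if "0 < t" "t < lifetime w" for t
  proof
    assume "w t = 0"
    then have "lifetime w \<le> t" unfolding lifetime_def using that by (intro cInf_lower bdd_belowI[of _ 0]) auto
    then show False using that by simp
  qed
qed

lemma good_path_modulus:
  "\<exists>m0. \<forall>m\<ge>m0. \<forall>s\<ge>0. \<forall>t\<ge>0. \<bar>s - t\<bar> < 1 / 2 ^ m \<longrightarrow> \<bar>w s - w t\<bar> \<le> 76 * sqrt (real m / 2 ^ m)"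
proof -
  obtain m0 where m0: "\<And>m p q. m0 \<le> m \<Longrightarrow> \<bar>nrat p - nrat q\<bar> \<le> 1 / 2 ^ m \<Longrightarrow> \<bar>w (nrat p) - w (nrat q)\<bar> \<le> 76 * sqrt (real m / 2 ^ m)"
    using good unfolding good_path_def by blast
  show ?thesis
  proof (intro exI[of _ m0] allI impI)
    fix m s t assume m: "m0 \<le> m" and s: "0 \<le> (s::real)" and t: "0 \<le> (t::real)" and st: "\<bar>s - t\<bar> < 1 / 2 ^ m"
    have seq: "\<exists>q :: nat \<Rightarrow> rat. (\<lambda>n. nrat (q n)) \<longlonglongrightarrow> u" if u: "0 \<le> u" for u
    proof -
      obtain q :: "nat \<Rightarrow> rat" where q: "(\<forall>n. u < real_of_rat (q n)) \<and> (\<lambda>n. real_of_rat (q n)) \<longlonglongrightarrow> u"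
        using rational_right_sequence[of u] ..
      have "nrat (q n) = real_of_rat (q n)" for n
      proof -
        have "u < real_of_rat (q n)" using q by simp
        then show ?thesis unfolding nrat_def using u by linarith
      qed
      then have "(\<lambda>n. nrat (q n)) \<longlonglongrightarrow> u" using q by simp
      then show ?thesis by (rule exI[of _ q])
    qed
    obtain p :: "nat \<Rightarrow> rat" where p: "(\<lambda>n. nrat (p n)) \<longlonglongrightarrow> s" using seq[OF s] ..
    obtain q :: "nat \<Rightarrow> rat" where q: "(\<lambda>n. nrat (q n)) \<longlonglongrightarrow> t" using seq[OF t] ..
    have wp: "(\<lambda>n. w (nrat (p n))) \<longlonglongrightarrow> w s" by (rule continuous_on_tendsto_compose[OF cont p]) (use s in auto)
    have wq: "(\<lambda>n. w (nrat (q n))) \<longlonglongrightarrow> w t" by (rule continuous_on_tendsto_compose[OF cont q]) (use t in auto)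
    have lim: "(\<lambda>n. \<bar>w (nrat (p n)) - w (nrat (q n))\<bar>) \<longlonglongrightarrow> \<bar>w s - w t\<bar>" by (intro tendsto_intros wp wq)
    have "(\<lambda>n. \<bar>nrat (p n) - nrat (q n)\<bar>) \<longlonglongrightarrow> \<bar>s - t\<bar>" by (intro tendsto_intros p q)
    then have "eventually (\<lambda>n. \<bar>nrat (p n) - nrat (q n)\<bar> < 1 / 2 ^ m) sequentially" using st by (rule order_tendstoD)
    then have "eventually (\<lambda>n. \<bar>w (nrat (p n)) - w (nrat (q n))\<bar> \<le> 76 * sqrt (real m / 2 ^ m)) sequentially"
      by eventually_elim (use m0[OF m] in auto)
    from tendsto_upperbound[OF lim this sequentially_bot] show "\<bar>w s - w t\<bar> \<le> 76 * sqrt (real m / 2 ^ m)" .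
  qed
qed

text \<open>The ball contains an interval of length \<open>\<delta> = 2\<^sup>-\<^sup>m\<close> with \<open>m = 2 n + l\<close> and \<open>2\<^sup>l\<close> of order \<open>n\<close>, to the right
  or to the left of \<open>s\<close>: on it the path oscillates by at most
  \<open>76 sqrt (m / 2\<^sup>m)\<close>, and twice this is at most \<open>2\<^sup>-\<^sup>n < r\<close>.\<close>

lemma ball_lower_bound:
  "\<exists>N. \<forall>n\<ge>N. \<forall>s\<in>{0..lifetime w}. \<forall>r. 1 / 2 ^ n < r \<longrightarrow>
     1 / (262144 * real n * 4 ^ n) \<le> measure lborel {t \<in> {0..lifetime w}. tree_pdist w s t < r}"
proof -
  note z = good_path_lifetime(1)
  obtain m0 where m0: "\<And>m s t. m0 \<le> m \<Longrightarrow> 0 \<le> s \<Longrightarrow> 0 \<le> t \<Longrightarrow> \<bar>s - t\<bar> < 1 / 2 ^ m \<Longrightarrow> \<bar>w s - w t\<bar> \<le> 76 * sqrt (real m / 2 ^ m)"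
    using good_path_modulus by blast
  obtain k where k: "1 / 2 ^ k < lifetime w / 2" using real_arch_pow_inv[of "lifetime w / 2" "1/2"] z by (auto simp: power_one_over)
  show ?thesis
  proof (intro exI[of _ "max 24 (max m0 k)"] allI ballI impI)
    fix n s r assume n: "max 24 (max m0 k) \<le> n" and s: "s \<in> {0..lifetime w}" and r: "1 / 2 ^ n < (r::real)"
    have n24: "24 \<le> n" using n by simp
    obtain l where l: "131072 * n \<le> 2 ^ l" "2 ^ l < 262144 * n" "l \<le> n" using length_scale[OF n24] .
    define m where "m = 2 * n + l"
    have mm: "m0 \<le> m" "k \<le> m" using n by (auto simp: m_def)
    define \<delta> :: real where "\<delta> = 1 / 2 ^ m"
    have \<delta>: "0 < \<delta>" by (simp add: \<delta>_def)
    have pw: "(2::real) ^ m = 4 ^ n * 2 ^ l" by (simp add: m_def power_add power_mult)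
    have dz: "2 * \<delta> \<le> lifetime w"
    proof -
      have "\<delta> \<le> 1 / 2 ^ k" unfolding \<delta>_def using mm(2) by (intro divide_left_mono power_increasing) auto
      then show ?thesis using k by linarith
    qed
    have osc: "2 * (76 * sqrt (real m / 2 ^ m)) \<le> 1 / 2 ^ n"
    proof -
      have "23104 * m \<le> 2 ^ l" using l(1,3) by (simp add: m_def)
      then have "real (23104 * m) \<le> real (2 ^ l)" by (rule of_nat_mono)
      then have a: "23104 * real m \<le> 2 ^ l" by simp
      have "23104 * (real m / 2 ^ m) = (23104 * real m) / 2 ^ m" by simp
      also have "\<dots> \<le> 2 ^ l / 2 ^ m" by (rule divide_right_mono[OF a]) simp
      also have "\<dots> = 1 / 4 ^ n" unfolding pw by simp
      also have "1 / 4 ^ n = (1 / 2 ^ n :: real)\<^sup>2" by (simp add: power2_eq_square power_mult_distrib[symmetric])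
      finally have "sqrt (23104 * (real m / 2 ^ m)) \<le> sqrt ((1 / 2 ^ n)\<^sup>2)" by (rule real_sqrt_le_mono)
      moreover have "sqrt ((1 / 2 ^ n)\<^sup>2) = 1 / 2 ^ n" by (rule real_sqrt_unique) auto
      moreover have "sqrt (23104 * (real m / 2 ^ m)) = 152 * sqrt (real m / 2 ^ m)"
        unfolding real_sqrt_mult[of 23104] using real_sqrt_abs[of 152] by simp
      ultimately show ?thesis by linarith
    qed
    have near: "tree_pdist w s t < r" if t: "0 \<le> t" "\<bar>s - t\<bar> < \<delta>" for t
    proof -
      have s0: "0 \<le> s" using s by simp
      obtain q where q: "q \<in> {min s t..max s t}" "low w s t = w q" using low_attained[OF cont s0 t(1)] by metis
      have "\<bar>w s - w q\<bar> \<le> 76 * sqrt (real m / 2 ^ m)" "\<bar>w t - w q\<bar> \<le> 76 * sqrt (real m / 2 ^ m)"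
        using q(1) t s0 by (auto intro!: m0[OF mm(1)] simp: \<delta>_def)
      then show ?thesis unfolding tree_pdist_low q(2) using osc r by linarith
    qed
    define S where "S = {t \<in> {0..lifetime w}. tree_pdist w s t < r}"
    have Sm: "S \<in> sets lborel" unfolding S_def by (rule mass_ball(2)[OF cont less_imp_le[OF z] s])
    have "S \<subseteq> {0..lifetime w}" unfolding S_def by (rule Collect_restrict)
    then have "emeasure lborel S \<le> emeasure lborel {0..lifetime w}" by (rule emeasure_mono) simp
    also have "\<dots> < \<infinity>" using z by simp
    finally have Sf: "S \<in> fmeasurable lborel" by (rule fmeasurableI[OF Sm])
    have "\<delta> \<le> measure lborel S"
    proof (cases "s + \<delta> \<le> lifetime w")
      case True
      have "{s..<s + \<delta>} \<subseteq> S" unfolding S_def using True s near by auto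
      then have "measure lborel {s..<s + \<delta>} \<le> measure lborel S" by (rule measure_mono_fmeasurable[OF _ _ Sf]) simp
      then show ?thesis using \<delta> by simp
    next
      case False
      then have "0 \<le> s - \<delta>" using dz by linarith
      then have "{s - \<delta><..s} \<subseteq> S" unfolding S_def using s near by auto
      then have "measure lborel {s - \<delta><..s} \<le> measure lborel S" by (rule measure_mono_fmeasurable[OF _ _ Sf]) simp
      then show ?thesis using \<delta> by simp
    qed
    moreover have "1 / (262144 * real n * 4 ^ n) \<le> \<delta>"
    proof -
      have "real (2 ^ l) \<le> real (262144 * n)" using l(2) by (intro of_nat_mono) simp
      then have "2 ^ l \<le> 262144 * real n" by simp
      then have "4 ^ n * 2 ^ l \<le> 4 ^ n * (262144 * real n)" by (intro mult_left_mono) auto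
      then show ?thesis unfolding \<delta>_def pw using n24 by (intro divide_left_mono) (auto simp: mult_ac)
    qed
    ultimately show "1 / (262144 * real n * 4 ^ n) \<le> measure lborel {t \<in> {0..lifetime w}. tree_pdist w s t < r}"
      unfolding S_def by linarith
  qed
qed

text \<open>Replace the centre by a rational time \<open>p\<close> within tree distance \<open>2\<^sup>-\<^sup>n\<close>.  The ball is then
  contained, up to two points, in the set of times close to \<open>p\<close> at the scale \<open>4 / 2\<^sup>n\<close>.\<close>

lemma ball_upper_bound:
  assumes meas: "\<And>r p. near_set w r p \<in> sets lborel"
  shows "\<exists>N. \<forall>n\<ge>N. \<forall>s\<in>{0..lifetime w}. \<forall>r. r \<le> 2 / 2 ^ n \<longrightarrow>
     measure lborel {t \<in> {0..lifetime w}. tree_pdist w s t < r} \<le> 32 * visit_rate * n / 4 ^ n"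
proof -
  note z = good_path_lifetime
  note l0 = less_imp_le[OF z(1)]
  obtain n0 where n0: "\<And>n p. n0 \<le> n \<Longrightarrow> emeasure lborel (near_set w (1 / 2 ^ n) p) \<le> ennreal (2 * visit_rate * n / 4 ^ n)"
    using good unfolding good_path_def by blast
  show ?thesis
  proof (intro exI[of _ "n0 + 2"] allI ballI impI)
    fix n s r assume n: "n0 + 2 \<le> n" and s: "s \<in> {0..lifetime w}" and r: "r \<le> (2::real) / 2 ^ n"
    define n' where "n' = n - 2"
    have n': "n = n' + 2" "n0 \<le> n'" using n by (simp_all add: n'_def)
    obtain d where d: "0 < d" "\<And>u. u \<in> {0..lifetime w} \<Longrightarrow> \<bar>u - s\<bar> < d \<Longrightarrow> tree_pdist w s u < 1 / 2 ^ n"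
      using pdist_small[OF cont l0 s, of "1 / 2 ^ n"] by auto
    obtain p where p: "nrat p \<in> {0..lifetime w}" "\<bar>nrat p - s\<bar> < d"
    proof (cases "s = 0")
      case True
      then show ?thesis using that[of 0] d z by (simp add: nrat_def)
    next
      case False
      then have "max 0 (s - d) < s" using s d by auto
      from nrat_dense[OF max.cobounded1 this] obtain q where q: "max 0 (s - d) < nrat q" "nrat q < s" .
      show ?thesis by (rule that[of q]) (use q s in auto)
    qed
    let ?S = "{t \<in> {0..lifetime w}. tree_pdist w s t < r}"
    have Sm: "?S \<in> sets lborel" by (rule mass_ball(2)[OF cont l0 s])
    have sub: "?S \<subseteq> near_set w (1 / 2 ^ n') p \<union> {0, lifetime w}"
    proof
      fix t assume t: "t \<in> ?S"
      show "t \<in> near_set w (1 / 2 ^ n') p \<union> {0, lifetime w}"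
      proof (cases "t = 0 \<or> t = lifetime w")
        case False
        then have t': "0 < t" "t < lifetime w" using t by auto
        have s0: "0 \<le> s" using s by simp
        have "tree_pdist w (nrat p) t \<le> tree_pdist w (nrat p) s + tree_pdist w s t"
          by (rule pdist_triangle[OF cont l0]) (use t' s0 in auto)
        also have "tree_pdist w (nrat p) s = tree_pdist w s (nrat p)" by (rule pdist_commute[OF cont l0])
        also have "tree_pdist w s (nrat p) + tree_pdist w s t \<le> 1 / 2 ^ n + 2 / 2 ^ n"
          using d(2)[OF p] t r by auto
        also have "\<dots> \<le> 1 / 2 ^ n'" unfolding n'(1) by (simp add: power_add field_simps)
        finally have pt: "tree_pdist w (nrat p) t \<le> 1 / 2 ^ n'" .
        have "rational_near w (1 / 2 ^ n') (nrat p) t"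
          unfolding rational_near_def
        proof (intro allI impI)
          fix q assume q: "min (nrat p) t \<le> nrat q \<and> nrat q \<le> max (nrat p) t"
          have "low w (nrat p) t \<le> w (nrat q)"
            by (rule low_le[OF cont]) (use q t' in auto)
          then show "w (nrat p) + w t - 1 / 2 ^ n' \<le> 2 * w (nrat q)" using pt unfolding tree_pdist_low by linarith
        qed
        then show ?thesis using t' z(2)[OF t'] by (simp add: near_set_def)
      qed auto
    qed
    have "emeasure lborel ?S \<le> emeasure lborel (near_set w (1 / 2 ^ n') p \<union> {0, lifetime w})"
      using meas by (intro emeasure_mono[OF sub]) auto
    also have "\<dots> \<le> emeasure lborel (near_set w (1 / 2 ^ n') p) + emeasure lborel {0, lifetime w}"
      using meas by (intro emeasure_subadditive) auto
    also have "emeasure lborel {0, lifetime w} = 0" by (rule emeasure_lborel_countable) simp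
    also have "emeasure lborel (near_set w (1 / 2 ^ n') p) + 0 \<le> ennreal (2 * visit_rate * n' / 4 ^ n')"
      using n0[OF n'(2)] by simp
    also have "\<dots> \<le> ennreal (32 * visit_rate * n / 4 ^ n)"
    proof (rule ennreal_leI)
      have "2 * visit_rate * n' / 4 ^ n' = 32 * visit_rate * n' / (4 ^ n :: real)" unfolding n'(1) by (simp add: power_add)
      also have "\<dots> \<le> 32 * visit_rate * n / (4 ^ n :: real)" unfolding n'(1) by (intro divide_right_mono of_nat_mono) auto
      finally show "real (2 * visit_rate * n') / 4 ^ n' \<le> real (32 * visit_rate * n) / 4 ^ n" .
    qed
    finally have "emeasure lborel ?S \<le> ennreal (32 * visit_rate * n / 4 ^ n)" .
    then show "measure lborel ?S \<le> 32 * visit_rate * n / 4 ^ n"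
      unfolding measure_def by (intro enn2real_leI) auto
  qed
qed

text \<open>With \<open>2\<^sup>-\<^sup>n < r \<le> 2 / 2\<^sup>n\<close> the powers of two cancel against \<open>r\<^sup>2\<close> up to a factor \<open>4\<close>, and \<open>n \<le> 4 ln (1/r)\<close>.
  The constants are \<open>4194304 = 16 * 262144\<close> and \<open>128 = 4 * 32\<close>; the summand \<open>1\<close> makes the second one
  evidently positive.\<close>

lemma good_path_balls:
  assumes meas: "\<And>r p. near_set w r p \<in> sets lborel"
  shows "\<exists>r\<^sub>0>0. \<forall>r. 0 < r \<and> r < r\<^sub>0 \<longrightarrow> (\<forall>\<sigma>\<in>tree w.
      (1 / 4194304) / ln (1 / r) \<le> measure (mass_measure w) (tree_ball w \<sigma> r) / r\<^sup>2 \<and>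
      measure (mass_measure w) (tree_ball w \<sigma> r) / r\<^sup>2 \<le> (128 * visit_rate + 1) * ln (1 / r))"
proof -
  note l0 = less_imp_le[OF good_path_lifetime(1)]
  obtain N1 where N1: "\<And>n s r. N1 \<le> n \<Longrightarrow> s \<in> {0..lifetime w} \<Longrightarrow> 1 / 2 ^ n < r \<Longrightarrow>
     1 / (262144 * real n * 4 ^ n) \<le> measure lborel {t \<in> {0..lifetime w}. tree_pdist w s t < r}"
    using ball_lower_bound by blast
  obtain N2 where N2: "\<And>n s r. N2 \<le> n \<Longrightarrow> s \<in> {0..lifetime w} \<Longrightarrow> r \<le> 2 / 2 ^ n \<Longrightarrow>
     measure lborel {t \<in> {0..lifetime w}. tree_pdist w s t < r} \<le> 32 * visit_rate * n / 4 ^ n"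
    using ball_upper_bound[OF meas] by blast
  define N where "N = max 2 (max N1 N2)"
  show ?thesis
  proof (intro exI[of _ "1 / 2 ^ N"] conjI allI impI ballI)
    fix r :: real and \<sigma> assume r: "0 < r \<and> r < 1 / 2 ^ N" and \<sigma>: "\<sigma> \<in> tree w"
    obtain n where n: "N < n" "1 / 2 ^ n < r" "r \<le> 2 / 2 ^ n" using dyadic_radius[of r N] r by blast
    have nn: "2 \<le> n" "N1 \<le> n" "N2 \<le> n" using n(1) by (auto simp: N_def)
    have ln: "real n / 4 \<le> ln (1 / r)" using r n nn by (intro log_radius) auto
    have ln0: "0 < ln (1 / r)" using ln nn by simp
    obtain s where s: "s \<in> {0..lifetime w}" "\<sigma> = tree_proj w s" using \<sigma> unfolding tree_eq_image[OF cont l0] by blast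
    let ?m = "measure lborel {t \<in> {0..lifetime w}. tree_pdist w s t < r}"
    have m: "measure (mass_measure w) (tree_ball w \<sigma> r) = ?m" unfolding s(2) by (rule mass_ball(1)[OF cont l0 s(1)])
    have four: "(4::real) ^ n = 2 ^ n * 2 ^ n" by (simp add: power_mult_distrib[symmetric])
    have r2: "r\<^sup>2 \<le> 4 / 4 ^ n" "1 / 4 ^ n \<le> r\<^sup>2"
    proof -
      have "r * r \<le> (2 / 2 ^ n) * (2 / 2 ^ n)" using r n by (intro mult_mono) auto
      then show "r\<^sup>2 \<le> 4 / 4 ^ n" by (simp add: power2_eq_square four)
      have "(1 / 2 ^ n) * (1 / 2 ^ n) \<le> r * r" using r n by (intro mult_mono) auto
      then show "1 / 4 ^ n \<le> r\<^sup>2" by (simp add: power2_eq_square four)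
    qed
    have r20: "0 < r\<^sup>2" using r by simp
    have n0: "0 < real n" using nn by simp
    show "(1 / 4194304) / ln (1 / r) \<le> measure (mass_measure w) (tree_ball w \<sigma> r) / r\<^sup>2"
    proof -
      have "(1 / 4194304) / ln (1 / r) \<le> (1 / 4194304) / (real n / 4)"
        using ln ln0 n0 by (intro divide_left_mono) auto
      also have "\<dots> = 1 / (262144 * real n * 4 ^ n) / (4 / 4 ^ n)" using n0 by simp
      also have "\<dots> \<le> ?m / (4 / 4 ^ n)" using N1[OF nn(2) s(1) n(2)] by (intro divide_right_mono) auto
      also have "\<dots> \<le> ?m / r\<^sup>2" using r2 r20 by (intro divide_left_mono) auto
      finally show ?thesis unfolding m .
    qed
    show "measure (mass_measure w) (tree_ball w \<sigma> r) / r\<^sup>2 \<le> (128 * visit_rate + 1) * ln (1 / r)"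
    proof -
      have "?m / r\<^sup>2 \<le> (32 * visit_rate * n / 4 ^ n) / r\<^sup>2"
        using N2[OF nn(3) s(1) n(3)] r20 by (intro divide_right_mono) auto
      also have "\<dots> \<le> (32 * visit_rate * n / 4 ^ n) / (1 / 4 ^ n)" using r2 r20 by (intro divide_left_mono) auto
      also have "\<dots> = 128 * real visit_rate * (real n / 4)" by simp
      also have "\<dots> \<le> 128 * real visit_rate * ln (1 / r)" using ln by (intro mult_left_mono) auto
      also have "\<dots> \<le> (128 * visit_rate + 1) * ln (1 / r)" using ln0 by (intro mult_right_mono) auto
      finally show ?thesis unfolding m .
    qed
  qed simp
qed

end

section \<open>Excursions of Brownian motion are good\<close>

text \<open>During an excursion above the running infimum the infimum does not change: inside because a new
  minimum would be a zero of the excursion, at the right end by the intermediate value theorem.\<close>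

lemma low_excursion:
  assumes cont: "continuous_on {0..} x" and ab: "0 \<le> a" "a < b"
    and ha: "x a = low x 0 a" and hb: "x b = low x 0 b" and pos: "\<And>t. a < t \<Longrightarrow> t < b \<Longrightarrow> low x 0 t < x t"
    and t: "t \<in> {a..b}"
  shows "low x 0 t = low x 0 a"
proof -
  have below: "low x 0 a \<le> x q" if "0 \<le> q" "q \<le> a" for q using that by (intro low_le[OF cont]) auto
  have inner: "low x 0 a \<le> x s" if s: "a < s" "s < b" for s
  proof -
    have s0: "0 \<le> s" using s ab by simp
    obtain m where m: "m \<in> {min 0 s..max 0 s}" "low x 0 s = x m" using low_attained[OF cont order_refl s0] by metis
    have "low x 0 m \<le> x m" "low x 0 s \<le> low x 0 m"
      using m s0 low_le[OF cont order_refl s0] by (auto simp: le_low_iff[OF cont order_refl] intro!: low_le[OF cont order_refl])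
    then have "x m = low x 0 m" using m by simp
    have "m < b" using m(1) s s0 by auto
    then have "m \<le> a" using pos[of m] \<open>x m = low x 0 m\<close> by (cases "a < m") auto
    then have "low x 0 a \<le> x m" using m s0 by (intro below) auto
    then show ?thesis using m(2) low_le[OF cont order_refl s0, of s] s0 by simp
  qed
  have last: "low x 0 a \<le> x b"
  proof (rule ccontr)
    assume "\<not> low x 0 a \<le> x b"
    then have "x b < x a" using ha by simp
    moreover have "continuous_on {a..b} x" by (rule continuous_on_subset[OF cont]) (use ab in auto)
    ultimately obtain c where c: "a \<le> c" "c \<le> b" "x c = (x a + x b) / 2"
      using IVT2'[of x b "(x a + x b) / 2" a] ab by auto
    then have "a < c" "c < b" using \<open>x b < x a\<close> by (auto simp: less_le)
    then show False using inner c \<open>x b < x a\<close> ha by fastforce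
  qed
  have t0: "0 \<le> t" using t ab by simp
  have "low x 0 a \<le> low x 0 t"
    unfolding le_low_iff[OF cont order_refl t0]
  proof
    fix q assume "q \<in> {min 0 t..max 0 t}"
    then have "0 \<le> q" "q \<le> b" using t t0 by auto
    then show "low x 0 a \<le> x q" using below[of q] inner[of q] last by (cases "q \<le> a"; cases "q = b") auto
  qed
  moreover have "low x 0 t \<le> low x 0 a"
    unfolding le_low_iff[OF cont order_refl ab(1)] using t ab by (auto intro!: low_le[OF cont order_refl t0])
  ultimately show ?thesis by simp
qed

text \<open>Unless the interval is a single point, each of its points is a limit of rational times inside it.\<close>

lemma rational_near_real:
  assumes cont: "continuous_on {0..} w" and t: "0 \<le> t" and near: "rational_near w r (nrat p) t"
    and u: "min (nrat p) t \<le> u" "u \<le> max (nrat p) t"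
  shows "w (nrat p) + w t - r \<le> 2 * w u"
proof (cases "nrat p = t")
  case True
  then show ?thesis using near u unfolding rational_near_def by auto
next
  case False
  have u0: "0 \<le> u" using u t nrat_nonneg[of p] by linarith
  show ?thesis
  proof (rule ccontr)
    define c where "c = w (nrat p) + w t - r"
    assume "\<not> ?thesis"
    then have c: "0 < (c - 2 * w u) / 2" by (simp add: c_def)
    obtain d where d: "0 < d" "\<And>y. y \<in> {0..} \<Longrightarrow> dist y u < d \<Longrightarrow> dist (w y) (w u) < (c - 2 * w u) / 2"
      using cont u0 c unfolding continuous_on_iff by (meson atLeast_iff)
    define l where "l = max (min (nrat p) t) (u - d)"
    have l: "0 \<le> l" "l < min (max (nrat p) t) (u + d)"
      using False u d(1) t nrat_nonneg[of p] unfolding l_def by linarith+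
    obtain q where q: "l < nrat q" "nrat q < min (max (nrat p) t) (u + d)" using nrat_dense[OF l] .
    have "dist (w (nrat q)) (w u) < (c - 2 * w u) / 2" using q by (intro d(2)) (auto simp: dist_real_def l_def)
    then have "w (nrat q) - w u < (c - 2 * w u) / 2" unfolding dist_real_def by (rule le_less_trans[OF abs_ge_self])
    then have "2 * w (nrat q) < c" by (simp add: field_simps)
    moreover have "c \<le> 2 * w (nrat q)" using near q unfolding rational_near_def c_def l_def by auto
    ultimately show False by simp
  qed
qed

lemma
  assumes cont: "continuous_on {0..} x" and ab: "0 \<le> a" "a < b" "b \<le> real N"
    and h: "\<And>t. 0 \<le> t \<Longrightarrow> h t = x t - low x 0 t"
    and ha: "h a = 0" and hb: "h b = 0" and pos: "\<And>t. a < t \<Longrightarrow> t < b \<Longrightarrow> 0 < h t"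
    and L: "levy_modulus m0 (real N) x"
    and cover: "\<And>n s. n0 \<le> n \<Longrightarrow> s \<in> {0..real N} \<Longrightarrow> \<exists>B\<in>sets lborel. {t\<in>{0..real N}. near x (1 / 2 ^ n) s t} \<subseteq> B \<and>
       emeasure lborel B \<le> ennreal (2 * visit_rate * n / 4 ^ n)"
  shows excursion_in_path_space: "excursion h (a, b) \<in> space path_space"
    and excursion_good_path: "good_path (excursion h (a, b))"
proof -
  define y where "y = low x 0 a"
  \<comment> \<open>The excursion is the piece of \<open>x\<close> on \<open>[a, b]\<close>, lowered by the constant running infimum.\<close>
  define w where "w = excursion h (a, b)"
  have w: "w t = x (min (a + t) b) - y" if "0 \<le> t" for t
  proof -
    let ?t = "min (a + t) b"
    have "?t \<in> {a..b}" using that ab by auto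
    have "low x 0 ?t = y" unfolding y_def
    proof (rule low_excursion[OF cont ab(1,2)])
      show "x a = low x 0 a" "x b = low x 0 b" using ha hb h ab by auto
      show "low x 0 u < x u" if "a < u" "u < b" for u using pos[OF that] h[of u] that ab by auto
    qed fact
    moreover have "w t = h ?t" using that by (simp add: w_def excursion_def)
    ultimately show ?thesis using h[of ?t] that ab by simp
  qed
  have wpos: "0 < w t" if "0 < t" "t < b - a" for t
  proof -
    have "w t = h (a + t)" using that by (simp add: w_def excursion_def)
    then show ?thesis using pos[of "a + t"] that by simp
  qed
  have wend: "w t = 0" if "b - a \<le> t" for t
  proof -
    have "w t = h b" using that ab by (simp add: w_def excursion_def min_absorb2)
    then show ?thesis using hb by simp
  qed
  have wc: "continuous_on {0..} w"
  proof -
    have "continuous_on {0..} (\<lambda>t. x (min (a + t) b) - y)"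
      by (intro continuous_intros continuous_on_compose2[OF cont]) (use ab in auto)
    then show ?thesis using w by (subst continuous_on_cong[OF HOL.refl]) auto
  qed
  have "w \<in> extensional {0..}" unfolding w_def excursion_def by simp
  then show "excursion h (a, b) \<in> space path_space"
    unfolding w_def[symmetric] path_space_def space_restrict_space space_PiM using wc by (simp add: PiE_def)
  have "\<exists>k::nat. 0 < k \<and> w (real k) = 0"
    using reals_Archimedean2[of "b - a"] ab wend by (meson less_imp_le of_nat_0_less_iff less_trans diff_gt_0_iff_gt)
  moreover have "\<exists>k::nat. 0 < k \<and> (\<forall>n::nat. \<exists>j::nat. \<forall>q. 1 / Suc n \<le> nrat q \<and> nrat q \<le> 1 / k \<longrightarrow> 1 / Suc j \<le> w (nrat q))"
  proof -
    have "0 < b - a" using ab by simp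
    then obtain k' :: nat where k': "1 / Suc k' < b - a" using nat_approx_posE by blast
    define k where "k = Suc k'"
    have kb: "0 < k" "1 / real k < b - a" using k' by (simp_all add: k_def)
    have "\<exists>j::nat. \<forall>q. 1 / Suc n \<le> nrat q \<and> nrat q \<le> 1 / k \<longrightarrow> 1 / Suc j \<le> w (nrat q)" for n :: nat
    proof (cases "1 / real (Suc n) \<le> 1 / real k")
      case True
      have np: "0 < 1 / real (Suc n)" by simp
      have "continuous_on {1 / real (Suc n)..1 / real k} w"
        by (rule continuous_on_subset[OF wc]) (use np in \<open>auto simp del: of_nat_Suc\<close>)
      moreover have "{1 / real (Suc n)..1 / real k} \<noteq> {}" using True by (simp del: of_nat_Suc)
      ultimately obtain u where u: "u \<in> {1 / real (Suc n)..1 / real k}" "\<And>v. v \<in> {1 / real (Suc n)..1 / real k} \<Longrightarrow> w u \<le> w v"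
        using continuous_attains_inf[OF compact_Icc] by blast
      have "0 < w u"
      proof (rule wpos)
        show "0 < u" using u(1) np unfolding atLeastAtMost_iff by linarith
        show "u < b - a" using u(1) kb unfolding atLeastAtMost_iff by linarith
      qed
      then obtain j :: nat where "1 / Suc j < w u" using nat_approx_posE by blast
      then have "\<forall>q. 1 / Suc n \<le> nrat q \<and> nrat q \<le> 1 / k \<longrightarrow> 1 / Suc j \<le> w (nrat q)"
        using u(2) by (meson atLeastAtMost_iff less_imp_le order_trans)
      then show ?thesis by (rule exI[of _ j])
    next
      case False
      then have "\<forall>q. \<not> (1 / real (Suc n) \<le> nrat q \<and> nrat q \<le> 1 / real k)" by (meson order_trans)
      then show ?thesis by blast
    qed
    then show ?thesis using kb(1) by (intro exI[of _ k]) simp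
  qed
  moreover have "\<exists>m0. \<forall>m\<ge>m0. \<forall>p q. \<bar>nrat p - nrat q\<bar> \<le> 1 / 2 ^ m \<longrightarrow> \<bar>w (nrat p) - w (nrat q)\<bar> \<le> 76 * sqrt (real m / 2 ^ m)"
  proof (intro exI[of _ m0] allI impI)
    fix m p q assume m: "m0 \<le> m" and pq: "\<bar>nrat p - nrat q\<bar> \<le> 1 / 2 ^ m"
    let ?p = "min (a + nrat p) b" and ?q = "min (a + nrat q) b"
    have "\<bar>?p - ?q\<bar> \<le> 1 / 2 ^ m" using pq by linarith
    moreover have "?p \<in> {0..real N}" "?q \<in> {0..real N}" using ab by auto
    ultimately have "\<bar>x ?p - x ?q\<bar> \<le> 76 * sqrt (real m / 2 ^ m)" using L m unfolding levy_modulus_def by blast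
    then show "\<bar>w (nrat p) - w (nrat q)\<bar> \<le> 76 * sqrt (real m / 2 ^ m)" by (simp add: w)
  qed
  moreover have "\<exists>n0. \<forall>n\<ge>n0. \<forall>p. emeasure lborel (near_set w (1 / 2 ^ n) p) \<le> ennreal (2 * visit_rate * n / 4 ^ n)"
  proof (intro exI[of _ n0] allI impI)
    fix n p assume n: "n0 \<le> n"
    let ?r = "1 / 2 ^ n :: real" and ?s = "min (a + nrat p) b"
    have s: "?s \<in> {0..real N}" using ab by auto
    obtain B where B: "B \<in> sets lborel" "{t\<in>{0..real N}. near x ?r ?s t} \<subseteq> B"
      "emeasure lborel B \<le> ennreal (2 * visit_rate * n / 4 ^ n)" using cover[OF n s] by blast
    have sub: "near_set w ?r p \<subseteq> (+) a -` B"
    proof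
      fix t assume "t \<in> near_set w ?r p"
      then have t: "0 \<le> t" "w t \<noteq> 0" "rational_near w ?r (nrat p) t" by (simp_all add: near_set_def)
      then have tb: "a + t < b" using wend[of t] by (cases "b - a \<le> t") auto
      have "near x ?r ?s (a + t)" unfolding near_def
      proof
        fix q assume q: "q \<in> {min ?s (a + t)..max ?s (a + t)}"
        have "a \<le> min ?s (a + t)" "max ?s (a + t) \<le> b" using t tb ab by auto
        then have q0: "0 \<le> q - a" "q \<le> b" using q unfolding atLeastAtMost_iff by linarith+
        have "w (nrat p) + w t - ?r \<le> 2 * w (q - a)"
          by (rule rational_near_real[OF wc t(1,3)]) (use q tb in auto)
        then show "x ?s + x (a + t) - ?r \<le> 2 * x q" using q0 t tb by (simp add: w)
      qed
      moreover have "a + t \<in> {0..real N}" using t tb ab by auto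
      ultimately show "t \<in> (+) a -` B" using B(2) by auto
    qed
    have "(+) a \<in> measurable lborel borel" by simp
    then have pre: "(+) a -` B \<in> sets lborel" using measurable_sets[of "(+) a" lborel borel B] B(1) by simp
    have "emeasure lborel (near_set w ?r p) \<le> emeasure lborel ((+) a -` B)" by (rule emeasure_mono[OF sub pre])
    also have "\<dots> = emeasure (distr lborel borel ((+) a)) B" using B(1) by (subst emeasure_distr) auto
    also have "\<dots> = emeasure lborel B" unfolding lborel_distr_plus ..
    finally show "emeasure lborel (near_set w ?r p) \<le> ennreal (2 * visit_rate * n / 4 ^ n)" using B(3) by simp
  qed
  ultimately show "good_path (excursion h (a, b))" unfolding w_def[symmetric] good_path_def by blast
qed

lemma continuous_path: "w \<in> space path_space \<Longrightarrow> continuous_on {0..} w"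
  by (simp add: path_space_def space_restrict_space)

lemma path_space_cadlag: "cadlag_process path_space (\<lambda>t w. w t)"
proof
  show "(\<lambda>w. w t) \<in> borel_measurable path_space" if "0 \<le> t" for t
    unfolding path_space_def using that by (intro measurable_restrict_space1 measurable_component_singleton) simp
  fix w s assume w: "w \<in> space path_space"
  show "continuous (at_right s) w" if "0 \<le> s"
  proof -
    have "continuous (at s within {0..}) w" using continuous_path[OF w] that by (simp add: continuous_on_eq_continuous_within)
    then show ?thesis by (rule continuous_within_subset) (use that in auto)
  qed
  show "\<exists>l. (w \<longlongrightarrow> l) (at_left s)" if "0 < s"
  proof -
    have "continuous_on {0<..} w" by (rule continuous_on_subset[OF continuous_path[OF w]]) auto
    then have "isCont w s" using that by (simp add: continuous_on_eq_continuous_at)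
    then have "(w \<longlongrightarrow> w s) (at_left s)" unfolding isCont_def by (rule tendsto_mono[OF at_le, rotated]) simp
    then show ?thesis ..
  qed
qed

text \<open>The union of the sections \<open>near_set\<close>; its measurability makes their measure a measurable function
  of the path.\<close>

definition near_graph :: "real \<Rightarrow> rat \<Rightarrow> ((real \<Rightarrow> real) \<times> real) set" where
  "near_graph r p = {z \<in> space (path_space \<Otimes>\<^sub>M lborel). snd z \<in> near_set (fst z) r p}"

lemma near_graph_sets: "near_graph r p \<in> sets (path_space \<Otimes>\<^sub>M lborel)"
proof -
  interpret cadlag_process path_space "\<lambda>t w. w t" by (rule path_space_cadlag)
  define F where "F z = fst z (max 0 (snd z))" for z :: "(real \<Rightarrow> real) \<times> real"
  have sets: "sets (path_space \<Otimes>\<^sub>M lborel) = sets (path_space \<Otimes>\<^sub>M (borel :: real measure))"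
    by (rule sets_pair_measure_cong) simp_all
  have [measurable]: "F \<in> borel_measurable (path_space \<Otimes>\<^sub>M lborel)"
    using jointly_measurable unfolding F_def[abs_def] case_prod_beta measurable_cong_sets[OF sets HOL.refl] .
  have [measurable]: "(\<lambda>z. fst z (nrat q)) \<in> borel_measurable (path_space \<Otimes>\<^sub>M lborel)" for q
    by (rule measurable_compose[OF measurable_fst X_rv]) simp
  have "{z \<in> space (path_space \<Otimes>\<^sub>M lborel). 0 \<le> snd z \<and> F z \<noteq> 0 \<and>
     (\<forall>q. min (nrat p) (snd z) \<le> nrat q \<and> nrat q \<le> max (nrat p) (snd z) \<longrightarrow> fst z (nrat p) + F z - r \<le> 2 * fst z (nrat q))}
     \<in> sets (path_space \<Otimes>\<^sub>M lborel)" by measurable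
  also have "{z \<in> space (path_space \<Otimes>\<^sub>M lborel). 0 \<le> snd z \<and> F z \<noteq> 0 \<and>
     (\<forall>q. min (nrat p) (snd z) \<le> nrat q \<and> nrat q \<le> max (nrat p) (snd z) \<longrightarrow> fst z (nrat p) + F z - r \<le> 2 * fst z (nrat q))}
     = near_graph r p"
    unfolding near_graph_def near_set_def rational_near_def by (auto simp: F_def max_absorb2)
  finally show ?thesis .
qed

lemma near_graph_section: "w \<in> space path_space \<Longrightarrow> Pair w -` near_graph r p = near_set w r p"
  by (auto simp: near_graph_def space_pair_measure)

lemma near_set_sets: "w \<in> space path_space \<Longrightarrow> near_set w r p \<in> sets lborel"
  using sets_Pair1[OF near_graph_sets[of r p], of w] by (simp add: near_graph_section)

lemma good_path_measurable: "{w \<in> space path_space. good_path w} \<in> sets path_space"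
proof -
  interpret cadlag_process path_space "\<lambda>t w. w t" by (rule path_space_cadlag)
  have [measurable]: "(\<lambda>w. w (nrat q)) \<in> borel_measurable path_space" "(\<lambda>w. w (real k)) \<in> borel_measurable path_space" for q k
    by (simp_all add: X_rv)
  define E where "E r p w = emeasure lborel (Pair w -` near_graph r p)" for r p w
  have [measurable]: "E r p \<in> borel_measurable path_space" for r p
    unfolding E_def[abs_def] by (rule lborel.measurable_emeasure_Pair[OF near_graph_sets])
  have "{w \<in> space path_space.
    (\<exists>k::nat. 0 < k \<and> w (real k) = 0) \<and>
    (\<exists>k::nat. 0 < k \<and> (\<forall>n::nat. \<exists>j::nat. \<forall>q. 1 / Suc n \<le> nrat q \<and> nrat q \<le> 1 / k \<longrightarrow> 1 / Suc j \<le> w (nrat q))) \<and>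
    (\<exists>m0. \<forall>m\<ge>m0. \<forall>p q. \<bar>nrat p - nrat q\<bar> \<le> 1 / 2 ^ m \<longrightarrow> \<bar>w (nrat p) - w (nrat q)\<bar> \<le> 76 * sqrt (real m / 2 ^ m)) \<and>
    (\<exists>n0. \<forall>n\<ge>n0. \<forall>p. E (1 / 2 ^ n) p w \<le> ennreal (2 * visit_rate * n / 4 ^ n))} \<in> sets path_space"
    (is "?A \<in> _") by measurable
  also have "?A = {w \<in> space path_space. good_path w}"
    unfolding good_path_def E_def by (intro Collect_cong conj_cong HOL.refl) (simp only: near_graph_section)
  finally show ?thesis .
qed

text \<open>The almost sure properties of \<open>X\<close> hold on every bounded time interval, hence around every
  excursion interval simultaneously.\<close>

lemma AE_excursions_good:
  assumes B: "brownian_var_2t P X" and H: "height_process P X H"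
  shows "AE \<omega> in P. \<forall>(a, b)\<in>excursion_intervals (\<lambda>t. X t \<omega> - running_inf X \<omega> t).
    0 \<le> - running_inf X \<omega> a \<and> excursion (\<lambda>t. H t \<omega>) (a, b) \<in> {w \<in> space path_space. good_path w}"
proof -
  have start: "AE \<omega> in P. X 0 \<omega> = 0" using B by (simp add: brownian_var_2t_def levy_process_def)
  have near: "AE \<omega> in P. \<forall>N. \<exists>n0. \<forall>n\<ge>n0. \<forall>s\<in>{0..real N}. \<exists>B\<in>sets lborel.
     {t\<in>{0..real N}. near (\<lambda>u. X u \<omega>) (1 / 2 ^ n) s t} \<subseteq> B \<and> emeasure lborel B \<le> ennreal (2 * visit_rate * n / 4 ^ n)"
    unfolding AE_all_countable
  proof
    fix N
    have G: "gaussian_increments P X (real N)" by (rule brownian_gaussian_increments[OF B])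
    show "AE \<omega> in P. \<exists>n0. \<forall>n\<ge>n0. \<forall>s\<in>{0..real N}. \<exists>B\<in>sets lborel.
       {t\<in>{0..real N}. near (\<lambda>u. X u \<omega>) (1 / 2 ^ n) s t} \<subseteq> B \<and> emeasure lborel B \<le> ennreal (2 * visit_rate * n / 4 ^ n)"
      by (rule AE_near_measure[OF G]) (rule cadlag_process.X_right[OF brownian_cadlag[OF B]])
  qed
  show ?thesis
    using start near AE_height_eq[OF B H] AE_brownian_modulus[OF B] AE_brownian_continuous[OF B]
  proof eventually_elim
    case (elim \<omega>)
    let ?x = "\<lambda>u. X u \<omega>"
    have low: "running_inf X \<omega> t = low ?x 0 t" if "0 \<le> t" for t using that by (simp add: inf_between_def low_def)
    show ?case
    proof (clarify, intro conjI)
      fix a b assume "(a, b) \<in> excursion_intervals (\<lambda>t. X t \<omega> - running_inf X \<omega> t)"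
      then have ab: "0 \<le> a" "a < b" and ex: "X a \<omega> - running_inf X \<omega> a = 0" "X b \<omega> - running_inf X \<omega> b = 0"
          "\<And>t. a < t \<Longrightarrow> t < b \<Longrightarrow> 0 < X t \<omega> - running_inf X \<omega> t"
        by (auto simp: excursion_intervals_def)
      have "low ?x 0 a \<le> X 0 \<omega>" using ab by (intro low_le[OF elim(5)]) auto
      then show "0 \<le> - running_inf X \<omega> a" using elim(1) low[OF ab(1)] by simp
      obtain N :: nat where N: "b \<le> real N" using real_arch_simple by blast
      obtain m0 where m0: "levy_modulus m0 (real N) ?x" using elim(4) by blast
      obtain n0 where n0: "\<And>n s. n0 \<le> n \<Longrightarrow> s \<in> {0..real N} \<Longrightarrow> \<exists>B\<in>sets lborel.
         {t\<in>{0..real N}. near ?x (1 / 2 ^ n) s t} \<subseteq> B \<and> emeasure lborel B \<le> ennreal (2 * visit_rate * n / 4 ^ n)"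
        using elim(2) by meson
      have h: "\<And>t. 0 \<le> t \<Longrightarrow> H t \<omega> = X t \<omega> - low ?x 0 t" using elim(3) low by simp
      have hab: "H a \<omega> = 0" "H b \<omega> = 0" using ex ab elim(3) by auto
      have hpos: "\<And>t. a < t \<Longrightarrow> t < b \<Longrightarrow> 0 < H t \<omega>" using ex(3) ab elim(3) by simp
      have "excursion (\<lambda>t. H t \<omega>) (a, b) \<in> space path_space"
        by (rule excursion_in_path_space[OF elim(5) ab N h hab hpos m0 n0])
      moreover have "good_path (excursion (\<lambda>t. H t \<omega>) (a, b))"
        by (rule excursion_good_path[OF elim(5) ab N h hab hpos m0 n0])
      ultimately show "excursion (\<lambda>t. H t \<omega>) (a, b) \<in> {w \<in> space path_space. good_path w}" by simp
    qed
  qed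
qed

section \<open>Transfer to the excursion measure\<close>

text \<open>A Poisson variable with finite mean \<open>\<mu>\<close> vanishes with probability \<open>exp (- \<mu>)\<close>, and with infinite mean
  it is infinite.\<close>

lemma poisson_null:
  assumes "prob_space Q" and poisson: "poisson_point_measure Q \<eta> \<mu>" and A: "A \<in> sets \<mu>"
    and null: "AE \<omega> in Q. emeasure (\<eta> \<omega>) A = 0"
  shows "emeasure \<mu> A = 0"
proof -
  interpret Q: prob_space Q by fact
  have fin: "emeasure \<mu> A < \<infinity>"
  proof (rule ccontr)
    assume "\<not> ?thesis"
    then have "emeasure \<mu> A = \<infinity>" using top.not_eq_extremum[of "emeasure \<mu> A"] by auto
    then have "AE \<omega> in Q. emeasure (\<eta> \<omega>) A = \<infinity>" using poisson A by (simp add: poisson_point_measure_def)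
    with null have "AE \<omega> in Q. False" by eventually_elim simp
    then show False by simp
  qed
  have [measurable]: "(\<lambda>\<omega>. emeasure (\<eta> \<omega>) A) \<in> borel_measurable Q" using poisson A by (simp add: poisson_point_measure_def)
  have "{\<omega> \<in> space Q. emeasure (\<eta> \<omega>) A = of_nat 0} \<in> sets Q" by measurable
  then have "measure Q {\<omega> \<in> space Q. emeasure (\<eta> \<omega>) A = of_nat 0} = 1" using null by (subst Q.prob_Collect_eq_1) auto
  moreover have "measure Q {\<omega> \<in> space Q. emeasure (\<eta> \<omega>) A = of_nat 0} = measure \<mu> A ^ 0 / fact 0 * exp (- measure \<mu> A)"
    using poisson A fin unfolding poisson_point_measure_def by blast
  ultimately have "measure \<mu> A = 0" by simp
  then show ?thesis using fin by (simp add: emeasure_eq_ennreal_measure less_top)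
qed

theorem corollary1p5:
  fixes P :: "'w measure"
    and X H :: "real \<Rightarrow> 'w \<Rightarrow> real"
    and N :: "(real \<Rightarrow> real) measure"
  assumes "brownian_var_2t P X"
    and "height_process P X H"
    and "height_excursion_measure P X H N"
  shows "\<exists>c>0. \<exists>C>0. AE w in N. \<exists>r\<^sub>0>0. \<forall>r. 0 < r \<and> r < r\<^sub>0 \<longrightarrow> (\<forall>\<sigma>\<in>tree w.
           c / ln (1 / r) \<le> measure (mass_measure w) (tree_ball w \<sigma> r) / r\<^sup>2 \<and>
           measure (mass_measure w) (tree_ball w \<sigma> r) / r\<^sup>2 \<le> C * ln (1 / r))"
proof -
  interpret P: prob_space P using assms(1) by (simp add: brownian_var_2t_def levy_process_def)
  have N: "sets N = sets path_space" "sigma_finite_measure N"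
    "poisson_point_measure (completion P) (excursion_point_measure X H N) (excursion_intensity N)"
    using assms(3) by (auto simp: height_excursion_measure_def)
  interpret N: sigma_finite_measure N by fact
  have sp: "space N = space path_space" by (rule sets_eq_imp_space_eq) fact
  define bad where "bad = {w \<in> space path_space. \<not> good_path w}"
  have bad: "bad \<in> sets N"
    using sets.compl_sets[OF good_path_measurable] unfolding N(1) bad_def
    by (rule back_subst[where P="\<lambda>A. A \<in> sets path_space"]) auto
  have unit: "{0..1} \<in> sets (restrict_space lborel {0::real..})" by (simp add: sets_restrict_space_iff)
  \<comment> \<open>A bounded piece of local time, so that the intensity of \<open>A\<close> is the excursion measure of \<open>bad\<close>.\<close>
  define A where "A = {0..1::real} \<times> bad"
  have A: "A \<in> sets (excursion_intensity N)" unfolding A_def excursion_intensity_def by (rule pair_measureI[OF unit bad])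
  have "emeasure (excursion_intensity N) A = emeasure (restrict_space lborel {0::real..}) {0..1} * emeasure N bad"
    unfolding A_def excursion_intensity_def by (rule N.emeasure_pair_measure_Times[OF unit bad])
  also have "emeasure (restrict_space lborel {0::real..}) {0..1} = 1" by (subst emeasure_restrict_space) auto
  finally have mass: "emeasure (excursion_intensity N) A = emeasure N bad" by simp
  have "AE \<omega> in P. emeasure (excursion_point_measure X H N \<omega>) A = 0"
    using AE_excursions_good[OF assms(1,2)]
  proof eventually_elim
    case (elim \<omega>)
    let ?E = "excursion_intervals (\<lambda>t. X t \<omega> - running_inf X \<omega> t)"
    let ?f = "\<lambda>(a, b). (- running_inf X \<omega> a, excursion (\<lambda>t. H t \<omega>) (a, b))"
    have "?f \<in> measurable (count_space ?E) (excursion_intensity N)"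
      using elim unfolding excursion_intensity_def measurable_count_space_eq1
      by (auto simp: space_pair_measure sp space_restrict_space)
    then have "emeasure (excursion_point_measure X H N \<omega>) A = emeasure (count_space ?E) (?f -` A \<inter> space (count_space ?E))"
      unfolding excursion_point_measure_def by (rule emeasure_distr) (rule A)
    also have "?f -` A \<inter> space (count_space ?E) = {}" using elim by (auto simp: A_def bad_def)
    finally show ?case by simp
  qed
  then have "AE \<omega> in completion P. emeasure (excursion_point_measure X H N \<omega>) A = 0" by (rule AE_completion)
  then have "emeasure N bad = 0"
    unfolding mass[symmetric] by (rule poisson_null[OF P.prob_space_completion N(3) A])
  then have "bad \<in> null_sets N" using bad by auto
  then have "AE w in N. good_path w" by (rule AE_I') (auto simp: bad_def sp)
  with AE_space have "AE w in N. \<exists>r\<^sub>0>0. \<forall>r. 0 < r \<and> r < r\<^sub>0 \<longrightarrow> (\<forall>\<sigma>\<in>tree w.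
      (1 / 4194304) / ln (1 / r) \<le> measure (mass_measure w) (tree_ball w \<sigma> r) / r\<^sup>2 \<and>
      measure (mass_measure w) (tree_ball w \<sigma> r) / r\<^sup>2 \<le> (128 * visit_rate + 1) * ln (1 / r))"
  proof eventually_elim
    case (elim w)
    then have w: "w \<in> space path_space" by (simp add: sp)
    show ?case by (rule good_path_balls[OF continuous_path[OF w] elim(2) near_set_sets[OF w]])
  qed
  then show ?thesis
    by (intro exI[of _ "1 / 4194304"] exI[of _ "real (128 * visit_rate + 1)"] conjI) auto
qed

end
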